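(* Let $\Phi_1\in\mathcal C(A_0,A_1)$, $\Phi_2\in\mathcal C(A'_0,A_1)$ and $\epsilon\ge0$, and let $\delta_{\rm pre}(\Phi_1\|\Phi_2)=\min_{\Lambda\in\mathcal C(A'_0,A_0)}\|\Phi_1\circ\Lambda-\Phi_2\|_\diamond$. The following are equivalent. (i) $\delta_{\rm pre}(\Phi_1\|\Phi_2)\le\epsilon$. (ii) For every finite-dimensional ancilla $R_0$ and every $\rho\in\mathfrak S(R_0A_1)$, $$\|(\mathrm{id}_{R_0}\otimes\Phi_2^{\mathsf T})(\rho)\|^\diamond_{A'_0|R_0}\le\|(\mathrm{id}_{R_0}\otimes\Phi_1^{\mathsf T})(\rho)\|^\diamond_{A_0|R_0}+\frac{\epsilon}{2}\|\rho\|^\diamond_{A_1|R_0}.$$ (iii) For every ancilla $R_0$, every ensemble $\mathcal E=\{\lambda_i,\rho_i\}_{i=1}^k$ on $R_0A_1$ and every measurement $M=(M_1,\dots,M_k)$ on $A_1A_1$, $$\sup_{\alpha\in\mathcal C(R_0,A'_0)}P_{\rm succ}\big(((\Phi_2\circ\alpha)\otimes\mathrm{id}_{A_1})(\mathcal E),M\big)\le\sup_{\alpha\in\mathcal C(R_0,A_0)}P_{\rm succ}\big(((\Phi_1\circ\alpha)\otimes\mathrm{id}_{A_1})(\mathcal E),M\big)+\frac{\epsilon}{2}P_{\rm succ}(\mathcal E).$$ Moreover, (i) is also equivalent to (ii), resp. (iii), required only for $R_0=A'_0$.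
   Context: Finite-dimensional systems; $\mathcal C(X,Y)$ channels; $\|\cdot\|_\diamond$ diamond norm. For $\phi:\mathcal B(X)\to\mathcal B(Y)$ hermitian linear, $\phi^*$ is its Hilbert–Schmidt adjoint and $\phi^{\mathsf T}(Z)=(\phi^*(Z^{\mathsf T}))^{\mathsf T}$ (transpose in fixed standard bases), so $\Phi^{\mathsf T}$ maps $\mathcal B(A_1)$ to the input space of $\Phi$. For $X\in\mathcal B_h(R_0B)$ and $\phi\in\mathcal L(R_0,B)$ set $\langle X,\phi\rangle={\rm Tr}[XC_{\phi^*}]$, where $C_{\psi}=(\psi\otimes\mathrm{id})(|I\rangle\rangle\langle\langle I|)$ is the Choi matrix, $|I\rangle\rangle=\sum_i|i\rangle|i\rangle$. For $\rho\in\mathcal B_+(R_0B)$, $\|\rho\|^\diamond_{B|R_0}=\max_{\alpha\in\mathcal C(R_0,B)}\langle\rho,\alpha\rangle=\min\{\lambda>0:\rho\le\lambda\sigma\otimes I_B,\ \sigma\in\mathfrak S(R_0)\}$. An ensemble $\mathcal E=\{\lambda_i,\rho_i\}_{i=1}^k$ on $X$: states $\rho_i$ with probabilities $\lambda_i$; for a map $\Psi$, $\Psi(\mathcal E)=\{\lambda_i,\Psi(\rho_i)\}$; a $k$-outcome measurement $M$: $M_i\ge0$, $\sum M_i=I$; $P_{\rm succ}(\mathcal E,M)=\sum_i\lambda_i{\rm Tr}[\rho_iM_i]$, $P_{\rm succ}(\mathcal E)=\max_MP_{\rm succ}(\mathcal E,M)$. In (iii), $\Phi\circ\alpha$ acts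 on the $R_0$ part and the output is measured together with the $A_1$ part of the ensemble. *)

theory Defs
  imports "Jordan_Normal_Form.Schur_Decomposition"
begin

(* Finite-dimensional quantum systems are identified with their dimensions
   (positive naturals). Operators on a d-dimensional system are complex d x d
   matrices. Linear maps B(X) -> B(Y) are HOL functions on complex matrices,
   only their behaviour on carrier_mat dX dX matters.
   Composite systems X Y have dimension dX * dY, with the standard
   (lexicographic) tensor basis |i>|j> = e_(i*dY + j). *)

type_synonym cmap = "complex mat \<Rightarrow> complex mat"

definition mtrace :: "complex mat \<Rightarrow> complex" where
  "mtrace A = (\<Sum>i<dim_row A. A $$ (i,i))"

definition transp :: "complex mat \<Rightarrow> complex mat" where
  "transp A = transpose_mat A"

definition munit :: "nat \<Rightarrow> nat \<Rightarrow> nat \<Rightarrow> complex mat" where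
  "munit d i j = mat d d (\<lambda>(a,b). if a = i \<and> b = j then 1 else 0)"

definition psd :: "nat \<Rightarrow> complex mat \<Rightarrow> bool" where
  "psd d A \<longleftrightarrow> A \<in> carrier_mat d d \<and>
     (\<forall>v \<in> carrier_vec d. ((A *\<^sub>v v) \<bullet> conjugate v) \<in> \<real> \<and> 0 \<le> Re ((A *\<^sub>v v) \<bullet> conjugate v))"

definition state :: "nat \<Rightarrow> complex mat \<Rightarrow> bool" where
  "state d \<rho> \<longleftrightarrow> psd d \<rho> \<and> mtrace \<rho> = 1"

definition trace_norm :: "complex mat \<Rightarrow> real" where
  "trace_norm A = Re (mtrace (THE B. psd (dim_col A) B \<and> B * B = mat_adjoint A * A))"

definition lin_map :: "nat \<Rightarrow> nat \<Rightarrow> cmap \<Rightarrow> bool" where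
  "lin_map dX dY \<phi> \<longleftrightarrow>
     (\<forall>A \<in> carrier_mat dX dX. \<phi> A \<in> carrier_mat dY dY) \<and>
     (\<forall>A \<in> carrier_mat dX dX. \<forall>B \<in> carrier_mat dX dX. \<phi> (A + B) = \<phi> A + \<phi> B) \<and>
     (\<forall>A \<in> carrier_mat dX dX. \<forall>c. \<phi> (c \<cdot>\<^sub>m A) = c \<cdot>\<^sub>m \<phi> A)"

definition id_tensor :: "nat \<Rightarrow> nat \<Rightarrow> nat \<Rightarrow> cmap \<Rightarrow> cmap" where
  "id_tensor dR dX dY \<phi> M = mat (dR * dY) (dR * dY) (\<lambda>(p,q).
      \<phi> (mat dX dX (\<lambda>(i,j). M $$ ((p div dY) * dX + i, (q div dY) * dX + j)))
        $$ (p mod dY, q mod dY))"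

definition tensor_id :: "nat \<Rightarrow> nat \<Rightarrow> nat \<Rightarrow> cmap \<Rightarrow> cmap" where
  "tensor_id dX dY dR \<phi> M = mat (dY * dR) (dY * dR) (\<lambda>(p,q).
      \<phi> (mat dX dX (\<lambda>(i,j). M $$ (i * dR + p mod dR, j * dR + q mod dR)))
        $$ (p div dR, q div dR))"

definition CP_map :: "nat \<Rightarrow> nat \<Rightarrow> cmap \<Rightarrow> bool" where
  "CP_map dX dY \<phi> \<longleftrightarrow>
     (\<forall>n>0. \<forall>P. psd (n * dX) P \<longrightarrow> psd (n * dY) (id_tensor n dX dY \<phi> P))"

definition TP_map :: "nat \<Rightarrow> nat \<Rightarrow> cmap \<Rightarrow> bool" where
  "TP_map dX dY \<phi> \<longleftrightarrow> (\<forall>A \<in> carrier_mat dX dX. mtrace (\<phi> A) = mtrace A)"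

definition channel :: "nat \<Rightarrow> nat \<Rightarrow> cmap \<Rightarrow> bool" where
  "channel dX dY \<phi> \<longleftrightarrow> lin_map dX dY \<phi> \<and> CP_map dX dY \<phi> \<and> TP_map dX dY \<phi>"

(* Hilbert-Schmidt adjoint \<phi>^dag : B(Y) -> B(X) of \<phi> : B(X) -> B(Y):
   <A, \<phi>^dag(Z)> = <\<phi>(A), Z>, so \<phi>^dag(Z)_(i,j) = <\<phi>(|i><j|), Z> *)
definition hs_adj :: "nat \<Rightarrow> nat \<Rightarrow> cmap \<Rightarrow> cmap" where
  "hs_adj dX dY \<phi> Z = mat dX dX (\<lambda>(i,j). mtrace (mat_adjoint (\<phi> (munit dX i j)) * Z))"

definition map_transp :: "nat \<Rightarrow> nat \<Rightarrow> cmap \<Rightarrow> cmap" where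
  "map_transp dX dY \<phi> Z = transp (hs_adj dX dY \<phi> (transp Z))"

(* |I>> = \<Sum>_i |i>|i> as a column matrix, and |I>><<I| *)
definition max_ent :: "nat \<Rightarrow> complex mat" where
  "max_ent d = mat (d * d) (d * d) (\<lambda>(p,q).
      if p div d = p mod d \<and> q div d = q mod d then 1 else 0)"

definition choi :: "nat \<Rightarrow> nat \<Rightarrow> cmap \<Rightarrow> complex mat" where
  "choi dX dY \<psi> = tensor_id dX dY dX \<psi> (max_ent dX)"

definition pairing :: "nat \<Rightarrow> nat \<Rightarrow> complex mat \<Rightarrow> cmap \<Rightarrow> complex" where
  "pairing dR dB X \<phi> = mtrace (X * choi dB dR (hs_adj dR dB \<phi>))"

definition cond_dnorm :: "nat \<Rightarrow> nat \<Rightarrow> complex mat \<Rightarrow> real" where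
  "cond_dnorm dR dB \<rho> = Sup {Re (pairing dR dB \<rho> \<alpha>) | \<alpha>. channel dR dB \<alpha>}"

definition dnorm :: "nat \<Rightarrow> nat \<Rightarrow> cmap \<Rightarrow> real" where
  "dnorm dX dY \<phi> = Sup {trace_norm (tensor_id dX dY dX \<phi> X) | X.
      X \<in> carrier_mat (dX * dX) (dX * dX) \<and> trace_norm X \<le> 1}"

definition delta_pre :: "nat \<Rightarrow> nat \<Rightarrow> nat \<Rightarrow> cmap \<Rightarrow> cmap \<Rightarrow> real" where
  "delta_pre dA0 dA0' dA1 \<Phi>1 \<Phi>2 =
     Inf {dnorm dA0' dA1 (\<lambda>X. \<Phi>1 (\<Lambda> X) - \<Phi>2 X) | \<Lambda>. channel dA0' dA0 \<Lambda>}"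

definition ensemble :: "nat \<Rightarrow> nat \<Rightarrow> (nat \<Rightarrow> real) \<Rightarrow> (nat \<Rightarrow> complex mat) \<Rightarrow> bool" where
  "ensemble d k lam rho \<longleftrightarrow>
     (\<forall>i<k. 0 \<le> lam i \<and> state d (rho i)) \<and> (\<Sum>i<k. lam i) = 1"

definition measurement :: "nat \<Rightarrow> nat \<Rightarrow> (nat \<Rightarrow> complex mat) \<Rightarrow> bool" where
  "measurement d k M \<longleftrightarrow> (\<forall>i<k. psd d (M i)) \<and> (\<forall>a<d. \<forall>b<d. (\<Sum>i<k. M i $$ (a,b)) = 1\<^sub>m d $$ (a,b))"

definition psucc :: "nat \<Rightarrow> (nat \<Rightarrow> real) \<Rightarrow> (nat \<Rightarrow> complex mat) \<Rightarrow> (nat \<Rightarrow> complex mat) \<Rightarrow> real" where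
  "psucc k lam rho M = (\<Sum>i<k. lam i * Re (mtrace (rho i * M i)))"

definition psucc_opt :: "nat \<Rightarrow> nat \<Rightarrow> (nat \<Rightarrow> real) \<Rightarrow> (nat \<Rightarrow> complex mat) \<Rightarrow> real" where
  "psucc_opt d k lam rho = Sup {psucc k lam rho M | M. measurement d k M}"

definition cond_ii :: "nat \<Rightarrow> nat \<Rightarrow> nat \<Rightarrow> cmap \<Rightarrow> cmap \<Rightarrow> real \<Rightarrow> nat \<Rightarrow> bool" where
  "cond_ii dA0 dA0' dA1 \<Phi>1 \<Phi>2 \<epsilon> dR \<longleftrightarrow>
     (\<forall>\<rho>. state (dR * dA1) \<rho> \<longrightarrow>
        cond_dnorm dR dA0' (id_tensor dR dA1 dA0' (map_transp dA0' dA1 \<Phi>2) \<rho>)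
        \<le> cond_dnorm dR dA0 (id_tensor dR dA1 dA0 (map_transp dA0 dA1 \<Phi>1) \<rho>)
           + \<epsilon> / 2 * cond_dnorm dR dA1 \<rho>)"

definition cond_iii :: "nat \<Rightarrow> nat \<Rightarrow> nat \<Rightarrow> cmap \<Rightarrow> cmap \<Rightarrow> real \<Rightarrow> nat \<Rightarrow> bool" where
  "cond_iii dA0 dA0' dA1 \<Phi>1 \<Phi>2 \<epsilon> dR \<longleftrightarrow>
     (\<forall>k lam rho M. ensemble (dR * dA1) k lam rho \<longrightarrow> measurement (dA1 * dA1) k M \<longrightarrow>
        Sup {psucc k lam (\<lambda>i. tensor_id dR dA1 dA1 (\<lambda>X. \<Phi>2 (\<alpha> X)) (rho i)) M
               | \<alpha>. channel dR dA0' \<alpha>}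
        \<le> Sup {psucc k lam (\<lambda>i. tensor_id dR dA1 dA1 (\<lambda>X. \<Phi>1 (\<alpha> X)) (rho i)) M
               | \<alpha>. channel dR dA0 \<alpha>}
          + \<epsilon> / 2 * psucc_opt (dR * dA1) k lam rho)"

end

theory Submission
  imports Defs "HOL-Computational_Algebra.Fundamental_Theorem_Algebra"
begin

text \<open>
  Identify a map with its Choi kernel \<open>J\<close> and put \<open>\<langle>\<rho>, J\<rangle> = \<Sum> \<rho>\<^sub>p\<^sub>q J\<^sub>p\<^sub>q\<close>. Both sides of (ii) are then suprema of
  \<open>\<langle>\<rho>, \<Phi> \<circ> \<alpha>\<rangle>\<close> over channels \<open>\<alpha>\<close>, and so are those of (iii), with \<open>\<rho>\<close> the contraction of the ensemble with
  the measurement; pulling the measurement back through a channel bounds the conditional norm of this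
  contraction by the success probability of the ensemble.

  If (i) fails, the convex set of all \<open>\<Phi>\<^sub>1 \<circ> \<Lambda> + (\<epsilon> / 2) \<gamma> - \<Phi>\<^sub>2\<close> with channels \<open>\<Lambda>\<close> and \<open>\<gamma>\<close> stays away from the
  positive cone, because \<open>\<Phi>\<^sub>2 - \<Phi>\<^sub>1 \<circ> \<Lambda> \<le> t \<gamma>\<close> forces a diamond distance of at most \<open>2 t\<close>. A separating
  functional is a state on \<open>A'\<^sub>0 A\<^sub>1\<close> that violates (ii) with \<open>\<alpha> = id\<close>; its Weyl rotations, measured in the
  basis of maximally entangled vectors, violate (iii).

  Conversely, duality gives \<open>\<rho> \<le> \<lambda> \<sigma> \<otimes> I\<close> with \<open>\<lambda>\<close> the conditional norm of \<open>\<rho>\<close>. Applying \<open>\<alpha>\<close> and purifying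
  \<open>\<alpha>(\<sigma>)\<close> turns \<open>\<langle>\<rho>, (\<Phi>\<^sub>2 - \<Phi>\<^sub>1 \<circ> \<Lambda>) \<circ> \<alpha>\<rangle>\<close> into \<open>\<lambda>\<close> times the trace of a traceless Hermitian operator of trace
  norm at most \<open>\<epsilon>\<close> against some \<open>0 \<le> \<tau> \<le> I\<close>, which is at most \<open>\<lambda> \<epsilon> / 2\<close>.
\<close>

section \<open>Positive kernels and the spectral theorem\<close>

text \<open>The set of channels is never shown to be compact and no supremum or infimum is shown to
  be attained. Every separation or duality statement instead carries a slack \<eta> > 0 times the
  identity, and \<eta> is sent to 0 only in inequalities between reals. What takes the place of
  attainment is boundedness, because \<open>Sup\<close> and \<open>Inf\<close> of reals say nothing
  about unbounded sets; for channels and measurements it follows from bounding an entry of a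
  positive kernel by its trace. The pairing is bilinear and has no transpose. The conjugations and
  transposes in the definitions of adjoint, Choi matrix and transposed map cancel once against
  hermiticity, and afterwards applying a map, composing maps and measuring are one and the same
  contraction of positive kernels. The constant \<epsilon> / 2 arises from both directions: a
  difference of two positive kernels whose partial traces equal t times the identity has diamond
  norm at most 2 t, and the positive part of a traceless Hermitian operator carries half of its
  trace norm.\<close>

abbreviation grid :: "nat \<Rightarrow> nat \<Rightarrow> (nat \<times> nat) set" where
  "grid r n \<equiv> {..<r} \<times> {..<n}"

definition inner_on :: "'i set \<Rightarrow> ('i \<Rightarrow> complex) \<Rightarrow> ('i \<Rightarrow> complex) \<Rightarrow> complex" where
  "inner_on I u v = (\<Sum>p\<in>I. cnj (u p) * v p)"

definition kernel_app :: "'i set \<Rightarrow> ('i \<Rightarrow> 'i \<Rightarrow> complex) \<Rightarrow> ('i \<Rightarrow> complex) \<Rightarrow> 'i \<Rightarrow> complex" where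
  "kernel_app I A v p = (\<Sum>q\<in>I. A p q * v q)"

definition sform :: "'i set \<Rightarrow> ('i \<Rightarrow> 'i \<Rightarrow> complex) \<Rightarrow> ('i \<Rightarrow> complex) \<Rightarrow> ('i \<Rightarrow> complex) \<Rightarrow> complex" where
  "sform I A u v = (\<Sum>p\<in>I. \<Sum>q\<in>I. cnj (u p) * A p q * v q)"

text \<open>The order on \<open>complex\<close> makes the condition say that the form is real and
  nonnegative, so hermiticity is a consequence. Vectors are arbitrary functions of which only the
  values on \<open>I\<close> enter.\<close>

definition pos_kernel :: "'i set \<Rightarrow> ('i \<Rightarrow> 'i \<Rightarrow> complex) \<Rightarrow> bool" where
  "pos_kernel I A \<longleftrightarrow> (\<forall>v. 0 \<le> sform I A v v)"

definition herm_kernel :: "'i set \<Rightarrow> ('i \<Rightarrow> 'i \<Rightarrow> complex) \<Rightarrow> bool" where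
  "herm_kernel I A \<longleftrightarrow> (\<forall>p\<in>I. \<forall>q\<in>I. A q p = cnj (A p q))"

text \<open>Orthonormality and completeness are both recorded, so that expansions in the family
  require no dimension count later.\<close>

definition onb :: "'i set \<Rightarrow> (nat \<Rightarrow> 'i \<Rightarrow> complex) \<Rightarrow> bool" where
  "onb I v \<longleftrightarrow> (\<forall>j<card I. \<forall>k<card I. inner_on I (v j) (v k) = of_bool (j = k)) \<and>
     (\<forall>p\<in>I. \<forall>q\<in>I. (\<Sum>j<card I. v j p * cnj (v j q)) = of_bool (p = q))"

lemma sum_swap3:
  "(\<Sum>p\<in>I. \<Sum>q\<in>J. \<Sum>k\<in>K. f p q k) = (\<Sum>k\<in>K. \<Sum>p\<in>I. \<Sum>q\<in>J. (f p q k :: 'a :: comm_monoid_add))"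
proof -
  have "(\<Sum>p\<in>I. \<Sum>q\<in>J. \<Sum>k\<in>K. f p q k) = (\<Sum>p\<in>I. \<Sum>k\<in>K. \<Sum>q\<in>J. f p q k)"
    by (intro sum.cong refl sum.swap)
  also have "\<dots> = (\<Sum>k\<in>K. \<Sum>p\<in>I. \<Sum>q\<in>J. f p q k)" by (rule sum.swap)
  finally show ?thesis .
qed

lemma cnj_mult_self_nonneg: "0 \<le> cnj z * z"
  by (simp add: less_eq_complex_def mult.commute complex_mult_cnj)

lemma sform_inner: "sform I A u v = inner_on I u (kernel_app I A v)"
  by (simp add: sform_def inner_on_def kernel_app_def sum_distrib_left mult.assoc)

lemma sform_add_left: "sform I A (\<lambda>x. u x + u' x) v = sform I A u v + sform I A u' v"
  by (simp add: sform_def algebra_simps sum.distrib)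

lemma sform_add_right: "sform I A u (\<lambda>x. v x + v' x) = sform I A u v + sform I A u v'"
  by (simp add: sform_def algebra_simps sum.distrib)

lemma sform_scale_left: "sform I A (\<lambda>x. c * u x) v = cnj c * sform I A u v"
  by (simp add: sform_def algebra_simps sum_distrib_left)

lemma sform_scale_right: "sform I A u (\<lambda>x. c * v x) = c * sform I A u v"
  by (simp add: sform_def algebra_simps sum_distrib_left)

lemma sform_kernel_add: "sform I (\<lambda>p q. A p q + B p q) u v = sform I A u v + sform I B u v"
  by (simp add: sform_def algebra_simps sum.distrib)

lemma sform_kernel_scale: "sform I (\<lambda>p q. c * A p q) u v = c * sform I A u v"
  by (simp add: sform_def algebra_simps sum_distrib_left)

lemma inner_on_add_left: "inner_on I (\<lambda>x. u x + u' x) v = inner_on I u v + inner_on I u' v"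
  by (simp add: inner_on_def algebra_simps sum.distrib)

lemma inner_on_add_right: "inner_on I u (\<lambda>x. v x + v' x) = inner_on I u v + inner_on I u v'"
  by (simp add: inner_on_def algebra_simps sum.distrib)

lemma inner_on_diff_right: "inner_on I u (\<lambda>x. v x - v' x) = inner_on I u v - inner_on I u v'"
  by (simp add: inner_on_def algebra_simps sum_subtractf)

lemma inner_on_scale_left: "inner_on I (\<lambda>x. c * u x) v = cnj c * inner_on I u v"
  by (simp add: inner_on_def algebra_simps sum_distrib_left)

lemma inner_on_scale_right: "inner_on I u (\<lambda>x. c * v x) = c * inner_on I u v"
  by (simp add: inner_on_def algebra_simps sum_distrib_left)

lemma inner_on_cnj: "cnj (inner_on I u v) = inner_on I v u"
  by (simp add: inner_on_def mult.commute)

lemma inner_on_nonneg: "0 \<le> inner_on I u u"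
  unfolding inner_on_def by (intro sum_nonneg cnj_mult_self_nonneg)

lemma inner_on_self: "inner_on I u u = of_real (\<Sum>p\<in>I. (cmod (u p))\<^sup>2)"
  unfolding inner_on_def by (simp add: complex_norm_square mult.commute del: of_real_power)

lemma inner_on_self_eq_0:
  assumes "finite I" "inner_on I u u = 0" "p \<in> I"
  shows "u p = 0"
proof -
  have "(\<Sum>p\<in>I. (cmod (u p))\<^sup>2) = 0"
    using assms(2) unfolding inner_on_self of_real_eq_0_iff .
  then show ?thesis using assms by (simp add: sum_nonneg_eq_0_iff)
qed

lemma kernel_app_self_adjoint:
  assumes "herm_kernel I A"
  shows "inner_on I u (kernel_app I A v) = inner_on I (kernel_app I A u) v"
proof -
  have "inner_on I u (kernel_app I A v) = (\<Sum>q\<in>I. \<Sum>p\<in>I. cnj (u p) * A p q * v q)"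
    by (subst sum.swap) (simp add: inner_on_def kernel_app_def sum_distrib_left mult.assoc)
  also have "\<dots> = (\<Sum>q\<in>I. \<Sum>p\<in>I. cnj (A q p) * cnj (u p) * v q)"
  proof (intro sum.cong refl)
    fix q p assume "q \<in> I" "p \<in> I"
    then have *: "A p q = cnj (A q p)" using assms unfolding herm_kernel_def by blast
    show "cnj (u p) * A p q * v q = cnj (A q p) * cnj (u p) * v q" unfolding * by simp
  qed
  also have "\<dots> = inner_on I (kernel_app I A u) v"
    by (simp add: inner_on_def kernel_app_def sum_distrib_right)
  finally show ?thesis .
qed

section \<open>Existence of an orthonormal eigenbasis\<close>

text \<open>Bolzano-Weierstrass one coordinate at a time: the subsequence found for the old
  coordinates is refined along the new one.\<close>

lemma bounded_pointwise_convergent_subseq: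
  fixes x :: "nat \<Rightarrow> 'i \<Rightarrow> complex"
  assumes "finite I" "\<And>n p. p \<in> I \<Longrightarrow> cmod (x n p) \<le> C"
  shows "\<exists>r l. strict_mono (r :: nat \<Rightarrow> nat) \<and> (\<forall>p\<in>I. (\<lambda>n. x (r n) p) \<longlonglongrightarrow> l p)"
  using assms
proof (induction I rule: finite_induct)
  case empty
  show ?case by (auto intro!: exI[of _ id] simp: strict_mono_def)
next
  case (insert a I)
  then obtain r l where r: "strict_mono (r :: nat \<Rightarrow> nat)" and l: "\<forall>p\<in>I. (\<lambda>n. x (r n) p) \<longlonglongrightarrow> l p"
    by (metis insert_iff)
  have "\<forall>n. cmod (x (r n) a) \<le> C" using insert.prems by simp
  from Bolzano_Weierstrass_complex_disc[OF this] obtain f z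
    where f: "strict_mono (f :: nat \<Rightarrow> nat)" and z: "\<forall>e>0. \<exists>N. \<forall>n\<ge>N. cmod (x (r (f n)) a - z) < e"
    by blast
  have lim: "(\<lambda>n. x (r (f n)) a) \<longlonglongrightarrow> z"
    using z by (auto simp: LIMSEQ_iff)
  have "\<forall>p\<in>insert a I. (\<lambda>n. x ((r \<circ> f) n) p) \<longlonglongrightarrow> (l(a := z)) p"
    using l lim insert.hyps LIMSEQ_subseq_LIMSEQ[OF _ f]
    by (force simp: o_def)
  moreover have "strict_mono (r \<circ> f)" using r f by (simp add: strict_mono_o)
  ultimately show ?case by blast
qed

text \<open>The eigenvector is a maximiser of the Rayleigh quotient on the unit sphere of the
  orthogonal complement of the eigenvectors already found.\<close>

lemma herm_kernel_next_eigenvector: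
  fixes v :: "nat \<Rightarrow> 'i \<Rightarrow> complex" and d :: "nat \<Rightarrow> real"
  assumes fin: "finite I" and herm: "herm_kernel I A"
    and eig: "\<And>j p. j < k \<Longrightarrow> p \<in> I \<Longrightarrow> kernel_app I A (v j) p = of_real (d j) * v j p"
    and w0: "inner_on I w w \<noteq> 0" and wp: "\<And>j. j < k \<Longrightarrow> inner_on I (v j) w = 0"
  shows "\<exists>u \<mu>. inner_on I u u = 1 \<and> (\<forall>j<k. inner_on I (v j) u = 0) \<and>
    (\<forall>p\<in>I. kernel_app I A u p = of_real \<mu> * u p)"
proof -
  define U where "U = {u. inner_on I u u = 1 \<and> (\<forall>j<k. inner_on I (v j) u = 0)}"
  define f where "f u = Re (sform I A u u)" for u
  have normalise: "(\<lambda>p. of_real (1 / sqrt (Re (inner_on I w w))) * w p) \<in> U \<and>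
      f (\<lambda>p. of_real (1 / sqrt (Re (inner_on I w w))) * w p) = f w / Re (inner_on I w w)"
    if "inner_on I w w \<noteq> 0" "\<And>j. j < k \<Longrightarrow> inner_on I (v j) w = 0" for w
  proof -
    define s where "s = Re (inner_on I w w)"
    have nn: "0 \<le> inner_on I w w" by (rule inner_on_nonneg)
    then have s: "inner_on I w w = of_real s" "s > 0"
      using that(1) by (auto simp: s_def less_eq_complex_def complex_eq_iff)
    define c where "c = complex_of_real (1 / sqrt s)"
    have cc: "cnj c * c = of_real (1 / s)"
      unfolding c_def using s(2) by (simp flip: of_real_mult)
    have "inner_on I (\<lambda>p. c * w p) (\<lambda>p. c * w p) = (cnj c * c) * inner_on I w w"
      by (simp add: inner_on_scale_left inner_on_scale_right)
    then have 1: "inner_on I (\<lambda>p. c * w p) (\<lambda>p. c * w p) = 1"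
      unfolding cc s(1) using s(2) by (simp flip: of_real_mult)
    have "sform I A (\<lambda>p. c * w p) (\<lambda>p. c * w p) = (cnj c * c) * sform I A w w"
      by (simp add: sform_scale_left sform_scale_right)
    then have 2: "f (\<lambda>p. c * w p) = f w / s"
      unfolding cc f_def by simp
    have "\<forall>j<k. inner_on I (v j) (\<lambda>p. c * w p) = 0"
      using that(2) by (simp add: inner_on_scale_right)
    with 1 2 show ?thesis unfolding U_def s_def[symmetric] c_def[symmetric] by blast
  qed
  have le1: "cmod (u p) \<le> 1" if "u \<in> U" "p \<in> I" for u p
  proof -
    have "(\<Sum>p\<in>I. (cmod (u p))\<^sup>2) = 1"
      using that(1) unfolding U_def inner_on_self of_real_eq_1_iff by simp
    moreover have "(cmod (u p))\<^sup>2 \<le> (\<Sum>p\<in>I. (cmod (u p))\<^sup>2)"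
      using fin that(2) by (intro member_le_sum) auto
    ultimately show ?thesis by (simp add: power_le_one_iff abs_square_le_1)
  qed
  have bdd: "f u \<le> (\<Sum>p\<in>I. \<Sum>q\<in>I. cmod (A p q))" if "u \<in> U" for u
  proof -
    have "f u \<le> cmod (sform I A u u)" unfolding f_def by (rule complex_Re_le_cmod)
    also have "\<dots> \<le> (\<Sum>p\<in>I. \<Sum>q\<in>I. cmod (cnj (u p) * A p q * u q))"
      unfolding sform_def by (intro order_trans[OF norm_sum] sum_mono order_refl)
    also have "\<dots> \<le> (\<Sum>p\<in>I. \<Sum>q\<in>I. cmod (A p q))"
    proof (intro sum_mono)
      fix p q assume "p \<in> I" "q \<in> I"
      then have "cmod (u p) * cmod (A p q) * cmod (u q) \<le> 1 * cmod (A p q) * 1"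
        using le1[OF that] by (intro mult_mono) auto
      then show "cmod (cnj (u p) * A p q * u q) \<le> cmod (A p q)" by (simp add: norm_mult)
    qed
    finally show ?thesis .
  qed
  have ne: "U \<noteq> {}" using normalise[OF w0 wp] by blast
  define s where "s = Sup (f ` U)"
  have bddS: "bdd_above (f ` U)" using bdd by (auto intro!: bdd_aboveI2)
  have upper: "f u \<le> s" if "u \<in> U" for u
    unfolding s_def using bddS that by (auto intro: cSup_upper)
  have "\<exists>u\<in>U. f u > s - 1 / (real n + 1)" for n :: nat
    using less_cSup_iff[of "f ` U" "s - 1 / (real n + 1)"] bddS ne by (auto simp: s_def)
  then obtain x where x: "\<And>n. x n \<in> U" "\<And>n::nat. f (x n) > s - 1 / (real n + 1)"
    by metis
  have "\<exists>r l. strict_mono (r :: nat \<Rightarrow> nat) \<and> (\<forall>p\<in>I. (\<lambda>n. x (r n) p) \<longlonglongrightarrow> l p)"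
    using bounded_pointwise_convergent_subseq[OF fin, of x 1] le1[OF x(1)] by blast
  then obtain r u where r: "strict_mono (r :: nat \<Rightarrow> nat)"
    and lim: "\<And>p. p \<in> I \<Longrightarrow> (\<lambda>n. x (r n) p) \<longlonglongrightarrow> u p" by blast
  have "(\<lambda>n. inner_on I (x (r n)) (x (r n))) \<longlonglongrightarrow> inner_on I u u"
    unfolding inner_on_def by (intro tendsto_intros lim)
  moreover have "(\<lambda>n. inner_on I (x (r n)) (x (r n))) = (\<lambda>n. 1)"
    using x(1) by (auto simp: U_def)
  ultimately have uu: "inner_on I u u = 1"
    using LIMSEQ_unique[OF _ tendsto_const] by fastforce
  have vu: "inner_on I (v j) u = 0" if "j < k" for j
  proof -
    have "(\<lambda>n. inner_on I (v j) (x (r n))) \<longlonglongrightarrow> inner_on I (v j) u"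
      unfolding inner_on_def by (intro tendsto_intros lim)
    moreover have "(\<lambda>n. inner_on I (v j) (x (r n))) = (\<lambda>n. 0)"
      using x(1) that by (auto simp: U_def)
    ultimately show ?thesis using LIMSEQ_unique[OF _ tendsto_const] by fastforce
  qed
  have flim: "(\<lambda>n. f (x (r n))) \<longlonglongrightarrow> f u"
    unfolding f_def sform_def by (intro tendsto_intros lim)
  have "s \<le> f u"
  proof (rule LIMSEQ_le[OF _ flim])
    have "(\<lambda>n. s - 1 / (real n + 1)) \<longlonglongrightarrow> s - 0"
      using LIMSEQ_inverse_real_of_nat by (intro tendsto_diff tendsto_const) (simp add: field_simps)
    then show "(\<lambda>n. s - 1 / (real (r n) + 1)) \<longlonglongrightarrow> s"
      using LIMSEQ_subseq_LIMSEQ[OF _ r] by (fastforce simp: o_def)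
    show "\<exists>N. \<forall>n\<ge>N. s - 1 / (real (r n) + 1) \<le> f (x (r n))"
      using x(2) by (meson less_imp_le)
  qed
  then have fu: "f u = s" using upper[of u] uu vu by (auto simp: U_def)
  \<comment> \<open>On the complement \<open>g\<close> is nonnegative, and it vanishes at the
    maximiser \<open>u\<close>. Its first-order variation there is governed by the defect
    \<open>z\<close> of the eigenvalue equation, so \<open>u\<close> is moved in the direction of
    \<open>z\<close>.\<close>
  define g where "g w = s * Re (inner_on I w w) - f w" for w
  have gnn: "0 \<le> g w" if "\<And>j. j < k \<Longrightarrow> inner_on I (v j) w = 0" for w
  proof (cases "inner_on I w w = 0")
    case True
    then have "w p = 0" if "p \<in> I" for p using inner_on_self_eq_0[OF fin] that by blast
    then show ?thesis unfolding g_def f_def sform_def using True by simp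
  next
    case False
    have "Re (inner_on I w w) > 0"
      using False inner_on_nonneg[of I w] by (auto simp: less_eq_complex_def complex_eq_iff)
    moreover have "f w / Re (inner_on I w w) \<le> s"
      using normalise[OF False that] upper by metis
    ultimately show ?thesis unfolding g_def by (simp add: field_simps)
  qed
  define z where "z = (\<lambda>p. of_real s * u p - kernel_app I A u p)"
  \<comment> \<open>The defect stays in the complement because \<open>A\<close> is self-adjoint and
    maps each old eigenvector to a multiple of itself.\<close>
  have vz: "inner_on I (v j) z = 0" if "j < k" for j
  proof -
    have "inner_on I (kernel_app I A (v j)) u = inner_on I (\<lambda>p. of_real (d j) * v j p) u"
      unfolding inner_on_def using eig[OF that] by simp
    then show ?thesis unfolding z_def
      by (simp add: inner_on_diff_right inner_on_scale_right vu[OF that] kernel_app_self_adjoint[OF herm]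
          inner_on_scale_left)
  qed
  define Z where "Z = Re (inner_on I z z)"
  have Znn: "Z \<ge> 0" using inner_on_nonneg[of I z] by (simp add: Z_def less_eq_complex_def)
  have expand: "g (\<lambda>p. u p + of_real t * z p) = 2 * t * Z + t\<^sup>2 * g z" for t :: real
  proof -
    have zz: "inner_on I z z = of_real s * inner_on I z u - sform I A z u"
      unfolding sform_inner by (subst (2) z_def) (simp add: inner_on_diff_right inner_on_scale_right)
    have 1: "Re (inner_on I u z) = Re (inner_on I z u)"
      using arg_cong[OF inner_on_cnj[of I u z], of Re] by simp
    have "sform I A u z = cnj (sform I A z u)"
      unfolding sform_inner inner_on_cnj by (rule kernel_app_self_adjoint[OF herm])
    then have 2: "Re (sform I A u z) = Re (sform I A z u)" by simp
    have 3: "Z = s * Re (inner_on I z u) - Re (sform I A z u)"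
      unfolding Z_def zz by simp
    have 4: "s = Re (sform I A u u)" using fu by (simp add: f_def)
    have "Re (inner_on I (\<lambda>p. u p + of_real t * z p) (\<lambda>p. u p + of_real t * z p)) =
       1 + 2 * t * Re (inner_on I z u) + t\<^sup>2 * Re (inner_on I z z)"
      by (simp add: inner_on_add_left inner_on_add_right inner_on_scale_left inner_on_scale_right
          uu 1 power2_eq_square algebra_simps)
    moreover have "f (\<lambda>p. u p + of_real t * z p) =
       s + 2 * t * Re (sform I A z u) + t\<^sup>2 * f z"
      by (simp add: f_def sform_add_left sform_add_right sform_scale_left sform_scale_right
          4 2 power2_eq_square algebra_simps)
    ultimately show ?thesis unfolding g_def 3 by (simp add: algebra_simps)
  qed
  have "Z = 0"
  proof (rule ccontr)
    assume "Z \<noteq> 0"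
    then have Zp: "Z > 0" using Znn by simp
    \<comment> \<open>A negative step so short that the quadratic term cannot compensate:
      \<open>t * g z = - Z - t\<close> turns the value of \<open>g\<close> at the moved vector into
      \<open>t * Z - t\<^sup>2\<close>, which is negative.\<close>
    define t where "t = - Z / (g z + 1)"
    have gz: "g z \<ge> 0" using gnn vz by blast
    have "0 \<le> g (\<lambda>p. u p + of_real t * z p)"
      by (rule gnn) (simp add: inner_on_add_right inner_on_scale_right vu vz)
    then have "0 \<le> 2 * t * Z + t\<^sup>2 * g z" using expand by simp
    moreover have "t * g z = - Z - t" unfolding t_def using gz by (simp add: field_simps)
    ultimately have "0 \<le> t * Z - t\<^sup>2" by (simp add: power2_eq_square algebra_simps)
    moreover have "t < 0" unfolding t_def using Zp gz by (simp add: field_simps)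
    ultimately show False using Zp mult_neg_pos[of t Z] by (smt (verit) zero_le_power2)
  qed
  then have "inner_on I z z = 0"
    using inner_on_nonneg[of I z] by (simp add: Z_def less_eq_complex_def complex_eq_iff)
  then have "\<forall>p\<in>I. z p = 0" using inner_on_self_eq_0[OF fin] by blast
  then have "\<forall>p\<in>I. kernel_app I A u p = of_real s * u p" by (simp add: z_def)
  then show ?thesis using uu vu by blast
qed

definition eigenfamily :: "'i set \<Rightarrow> ('i \<Rightarrow> 'i \<Rightarrow> complex) \<Rightarrow> nat \<Rightarrow> (nat \<Rightarrow> 'i \<Rightarrow> complex) \<Rightarrow> (nat \<Rightarrow> real) \<Rightarrow> bool" where
  "eigenfamily I A k v d \<longleftrightarrow>
     (\<forall>i<k. \<forall>j<k. inner_on I (v i) (v j) = of_bool (i = j)) \<and>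
     (\<forall>j<k. \<forall>p\<in>I. kernel_app I A (v j) p = of_real (d j) * v j p)"

text \<open>For an orthonormal family this is the projection onto its orthogonal complement; column
  \<open>q\<close> is the projected basis vector at \<open>q\<close>.\<close>

definition residual :: "nat \<Rightarrow> (nat \<Rightarrow> 'i \<Rightarrow> complex) \<Rightarrow> 'i \<Rightarrow> 'i \<Rightarrow> complex" where
  "residual k v p q = of_bool (p = q) - (\<Sum>j<k. v j p * cnj (v j q))"

lemma residual_orth:
  assumes "finite I" "eigenfamily I A k v d" "q \<in> I" "j < k"
  shows "inner_on I (v j) (\<lambda>p. residual k v p q) = 0"
proof -
  have "inner_on I (v j) (\<lambda>p. residual k v p q) =
     (\<Sum>p\<in>I. cnj (v j p) * of_bool (p = q)) - (\<Sum>p\<in>I. \<Sum>i<k. cnj (v j p) * v i p * cnj (v i q))"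
    by (simp add: inner_on_def residual_def algebra_simps sum_subtractf sum_distrib_left)
  also have "(\<Sum>p\<in>I. \<Sum>i<k. cnj (v j p) * v i p * cnj (v i q)) = (\<Sum>i<k. inner_on I (v j) (v i) * cnj (v i q))"
    by (subst sum.swap) (simp add: inner_on_def sum_distrib_right)
  also have "\<dots> = (\<Sum>i<k. if i = j then cnj (v j q) else 0)"
    using assms(2,4) by (intro sum.cong) (auto simp: eigenfamily_def)
  finally show ?thesis using assms by (simp add: of_bool_def if_distrib cong: if_cong)
qed

lemma residual_inner:
  assumes "finite I" "eigenfamily I A k v d" "q \<in> I"
  shows "inner_on I (\<lambda>p. residual k v p q) (\<lambda>p. residual k v p q) = residual k v q q"
proof -
  let ?r = "\<lambda>p. residual k v p q"
  have ex: "inner_on I u ?r = inner_on I u (\<lambda>p. of_bool (p = q)) - (\<Sum>j<k. cnj (v j q) * inner_on I u (v j))" for u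
  proof -
    have "inner_on I u ?r = inner_on I u (\<lambda>p. of_bool (p = q)) - (\<Sum>p\<in>I. \<Sum>j<k. cnj (u p) * (v j p * cnj (v j q)))"
      by (simp add: inner_on_def residual_def right_diff_distrib sum_subtractf sum_distrib_left)
    also have "(\<Sum>p\<in>I. \<Sum>j<k. cnj (u p) * (v j p * cnj (v j q))) = (\<Sum>j<k. cnj (v j q) * inner_on I u (v j))"
      unfolding inner_on_def sum_distrib_left by (subst sum.swap) (simp add: mult_ac)
    finally show ?thesis .
  qed
  have "inner_on I ?r ?r = inner_on I ?r (\<lambda>p. of_bool (p = q)) - (\<Sum>j<k. cnj (v j q) * inner_on I ?r (v j))"
    by (rule ex)
  also have "(\<Sum>j<k. cnj (v j q) * inner_on I ?r (v j)) = 0"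
    using residual_orth[OF assms] by (intro sum.neutral ballI) (metis complex_cnj_zero inner_on_cnj lessThan_iff mult_zero_right)
  also have "inner_on I ?r (\<lambda>p. of_bool (p = q)) = cnj (residual k v q q)"
    using assms by (simp add: inner_on_def of_bool_def if_distrib cong: if_cong)
  also have "\<dots> = residual k v q q" by (simp add: residual_def mult.commute)
  finally show ?thesis by simp
qed

text \<open>The trace of the complementary projection counts the missing vectors. Its nonnegativity
  bounds the size of a family by \<open>card I\<close>, and a vanishing residual forces
  equality.\<close>

lemma residual_trace:
  assumes "finite I" "eigenfamily I A k v d"
  shows "(\<Sum>q\<in>I. residual k v q q) = of_nat (card I) - of_nat k"
proof -
  have "(\<Sum>q\<in>I. residual k v q q) = of_nat (card I) - (\<Sum>q\<in>I. \<Sum>j<k. v j q * cnj (v j q))"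
    by (simp add: residual_def sum_subtractf)
  also have "(\<Sum>q\<in>I. \<Sum>j<k. v j q * cnj (v j q)) = (\<Sum>j<k. inner_on I (v j) (v j))"
    by (subst sum.swap) (simp add: inner_on_def mult.commute)
  also have "\<dots> = of_nat k" using assms(2) by (simp add: eigenfamily_def)
  finally show ?thesis .
qed

text \<open>An eigenfamily of maximal size is complete: a nonzero column of its residual is
  orthogonal to the family and would give rise to one more eigenvector.\<close>

theorem spectral_kernel:
  assumes fin: "finite I" and herm: "herm_kernel I A"
  shows "\<exists>v (d :: nat \<Rightarrow> real). onb I v \<and>
    (\<forall>p\<in>I. \<forall>q\<in>I. A p q = (\<Sum>j<card I. of_real (d j) * v j p * cnj (v j q)))"
proof -
  have kle: "k \<le> card I" if "eigenfamily I A k v d" for k v d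
  proof -
    have "0 \<le> (\<Sum>q\<in>I. residual k v q q)"
      using residual_inner[OF fin that] inner_on_nonneg by (metis (no_types, lifting) sum_nonneg)
    then show ?thesis unfolding residual_trace[OF fin that] by (simp add: less_eq_complex_def)
  qed
  have "eigenfamily I A 0 (\<lambda>_ _. 0) (\<lambda>_. 0)" by (simp add: eigenfamily_def)
  then have ex: "\<exists>v d. eigenfamily I A 0 v d" by blast
  define k where "k = (GREATEST k. \<exists>v d. eigenfamily I A k v d)"
  have "\<exists>v d. eigenfamily I A k v d"
    unfolding k_def by (rule GreatestI_nat[where P = "\<lambda>k. \<exists>v d. eigenfamily I A k v d", OF ex]) (use kle in blast)
  then obtain v d where e: "eigenfamily I A k v d" by blast
  have nomore: "\<not> eigenfamily I A (Suc k) v' d'" for v' d'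
  proof
    assume "eigenfamily I A (Suc k) v' d'"
    then have "Suc k \<le> k"
      unfolding k_def by (intro Greatest_le_nat[where b = "card I"]) (use kle in blast)+
    then show False by simp
  qed
  have res: "residual k v p q = 0" if pq: "p \<in> I" "q \<in> I" for p q
  proof (rule ccontr)
    assume nz: "residual k v p q \<noteq> 0"
    let ?w = "\<lambda>p. residual k v p q"
    have "inner_on I ?w ?w \<noteq> 0" using inner_on_self_eq_0[OF fin _ pq(1), of ?w] nz by blast
    from herm_kernel_next_eigenvector[of I A k v d ?w, OF fin herm _ this residual_orth[OF fin e pq(2)]] e
    obtain u \<mu> where u: "inner_on I u u = 1" "\<forall>j<k. inner_on I (v j) u = 0"
      "\<forall>p\<in>I. kernel_app I A u p = of_real \<mu> * u p"
      by (auto simp: eigenfamily_def)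
    have "\<forall>j<k. inner_on I u (v j) = 0"
      using u(2) by (metis complex_cnj_zero inner_on_cnj)
    then have "eigenfamily I A (Suc k) (v(k := u)) (d(k := \<mu>))"
      using e u unfolding eigenfamily_def by (auto simp: less_Suc_eq)
    then show False using nomore by blast
  qed
  have "of_nat (card I) - of_nat k = (0::complex)"
    using residual_trace[OF fin e] res by simp
  then have k: "k = card I" by simp
  have complete: "(\<Sum>j<k. v j p * cnj (v j q)) = of_bool (p = q)" if "p \<in> I" "q \<in> I" for p q
    using res[OF that] by (simp add: residual_def)
  have "A p q = (\<Sum>j<k. of_real (d j) * v j p * cnj (v j q))" if pq: "p \<in> I" "q \<in> I" for p q
  proof -
    have "A p q = (\<Sum>r\<in>I. A p r * of_bool (r = q))"
      using pq fin by (simp add: of_bool_def if_distrib cong: if_cong)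
    also have "\<dots> = (\<Sum>r\<in>I. A p r * (\<Sum>j<k. v j r * cnj (v j q)))"
      using complete pq by (intro sum.cong) auto
    also have "\<dots> = (\<Sum>j<k. kernel_app I A (v j) p * cnj (v j q))"
      unfolding kernel_app_def sum_distrib_left sum_distrib_right
      by (subst sum.swap) (simp add: mult.assoc)
    also have "\<dots> = (\<Sum>j<k. of_real (d j) * v j p * cnj (v j q))"
      using e pq by (intro sum.cong) (auto simp: eigenfamily_def)
    finally show ?thesis .
  qed
  then show ?thesis using e complete unfolding k onb_def eigenfamily_def by blast
qed


section \<open>Gram vectors and closure properties of the positive cone\<close>

lemma sform_delta:
  assumes "finite I" "p \<in> I" "q \<in> I"
  shows "sform I A (\<lambda>x. of_bool (x = p)) (\<lambda>x. of_bool (x = q)) = A p q"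
proof -
  have "sform I A (\<lambda>x. of_bool (x = p)) (\<lambda>x. of_bool (x = q)) =
      (\<Sum>x\<in>I. if x = p then (\<Sum>y\<in>I. if y = q then A x y else 0) else 0)"
    unfolding sform_def by (intro sum.cong refl) (auto intro!: sum.cong)
  then show ?thesis using assms by simp
qed

text \<open>Polarisation: the form at \<open>e p + c * e q\<close> is real for \<open>c = 1\<close>
  and for \<open>c = \<i>\<close>, which relates the imaginary, respectively the real, parts of the
  two off-diagonal entries.\<close>

lemma pos_kernel_herm:
  assumes "finite I" "pos_kernel I A"
  shows "herm_kernel I A"
  unfolding herm_kernel_def
proof (intro ballI)
  fix p q assume pq: "p \<in> I" "q \<in> I"
  define e where "e p = (\<lambda>x. of_bool (x = p) :: complex)" for p :: 'a
  have ee: "sform I A (e x) (e y) = A x y" if "x \<in> I" "y \<in> I" for x y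
    unfolding e_def using sform_delta[OF assms(1) that] .
  have nn: "0 \<le> sform I A v v" for v using assms(2) by (simp add: pos_kernel_def)
  have 1: "0 \<le> A p p + c * A p q + cnj c * (A q p + c * A q q)" for c
    using nn[of "\<lambda>x. e p x + c * e q x"] pq
    by (simp add: sform_add_left sform_add_right sform_scale_left sform_scale_right ee algebra_simps)
  have 2: "0 \<le> A p p" "0 \<le> A q q" using nn[of "e p"] nn[of "e q"] pq by (simp_all add: ee)
  show "A q p = cnj (A p q)"
    using 1[of 1] 1[of \<i>] 2 by (auto simp: less_eq_complex_def complex_eq_iff)
qed

text \<open>Together with its converse \<open>pos_kernel_gramE\<close> this is the working form of
  positivity: for most constructions it suffices to exhibit the Gram vectors of the new
  kernel.\<close>

lemma pos_kernel_gramI: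
  assumes "\<And>p q. p \<in> I \<Longrightarrow> q \<in> I \<Longrightarrow> A p q = (\<Sum>k\<in>K. g k p * cnj (g k q))"
  shows "pos_kernel I A"
  unfolding pos_kernel_def
proof
  fix v
  have "sform I A v v = (\<Sum>p\<in>I. \<Sum>q\<in>I. \<Sum>k\<in>K. (cnj (v p) * g k p) * (cnj (g k q) * v q))"
    unfolding sform_def
    by (intro sum.cong refl) (simp add: assms sum_distrib_left sum_distrib_right mult_ac)
  also have "\<dots> = (\<Sum>k\<in>K. \<Sum>p\<in>I. \<Sum>q\<in>I. (cnj (v p) * g k p) * (cnj (g k q) * v q))"
    by (rule sum_swap3)
  also have "\<dots> = (\<Sum>k\<in>K. cnj (\<Sum>q\<in>I. cnj (g k q) * v q) * (\<Sum>q\<in>I. cnj (g k q) * v q))"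
    by (intro sum.cong refl, subst sum_product[symmetric]) (simp add: mult.commute)
  finally have "sform I A v v = \<dots>" .
  then show "0 \<le> sform I A v v" by (simp only:) (intro sum_nonneg cnj_mult_self_nonneg)
qed

lemma sform_spectral:
  assumes "onb I v" "\<And>p q. p \<in> I \<Longrightarrow> q \<in> I \<Longrightarrow> A p q = (\<Sum>j<card I. of_real (d j) * v j p * cnj (v j q))"
    "k < card I"
  shows "sform I A (v k) (v k) = of_real (d k)"
proof -
  have "sform I A (v k) (v k) = (\<Sum>p\<in>I. \<Sum>q\<in>I. \<Sum>j<card I. of_real (d j) * ((cnj (v k p) * v j p) * (cnj (v j q) * v k q)))"
    unfolding sform_def
    by (intro sum.cong refl) (simp add: assms(2) sum_distrib_left sum_distrib_right mult_ac)
  also have "\<dots> = (\<Sum>j<card I. \<Sum>p\<in>I. \<Sum>q\<in>I. of_real (d j) * ((cnj (v k p) * v j p) * (cnj (v j q) * v k q)))"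
    by (rule sum_swap3)
  also have "\<dots> = (\<Sum>j<card I. of_real (d j) * (inner_on I (v k) (v j) * inner_on I (v j) (v k)))"
    unfolding inner_on_def by (intro sum.cong refl) (simp flip: sum_distrib_left sum_distrib_right)
  also have "\<dots> = (\<Sum>j<card I. if j = k then of_real (d j) else 0)"
    using assms(1,3) by (intro sum.cong refl) (auto simp: onb_def)
  finally show ?thesis using assms(3) by simp
qed

lemma pos_kernel_spectral:
  assumes "finite I" "pos_kernel I A"
  shows "\<exists>v (d :: nat \<Rightarrow> real). onb I v \<and> (\<forall>j<card I. 0 \<le> d j) \<and>
    (\<forall>p\<in>I. \<forall>q\<in>I. A p q = (\<Sum>j<card I. of_real (d j) * v j p * cnj (v j q)))"
proof -
  obtain v d where v: "onb I v" "\<forall>p\<in>I. \<forall>q\<in>I. A p q = (\<Sum>j<card I. of_real (d j) * v j p * cnj (v j q))"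
    using spectral_kernel[OF assms(1) pos_kernel_herm[OF assms]] by blast
  have "0 \<le> d j" if "j < card I" for j
  proof -
    have "0 \<le> sform I A (v j) (v j)" using assms(2) by (simp add: pos_kernel_def)
    also have "sform I A (v j) (v j) = of_real (d j)"
      by (rule sform_spectral[OF v(1) _ that]) (use v(2) in blast)
    finally show ?thesis by (simp add: less_eq_complex_def)
  qed
  then show ?thesis using v by blast
qed

lemma pos_kernel_gramE:
  assumes "finite I" "pos_kernel I A"
  obtains g where "\<And>p q. p \<in> I \<Longrightarrow> q \<in> I \<Longrightarrow> A p q = (\<Sum>k<card I. g k p * cnj (g k q))"
proof -
  obtain v d where v: "onb I v" "\<And>j. j < card I \<Longrightarrow> 0 \<le> d j"
    "\<And>p q. p \<in> I \<Longrightarrow> q \<in> I \<Longrightarrow> A p q = (\<Sum>j<card I. of_real (d j) * v j p * cnj (v j q))"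
    using pos_kernel_spectral[OF assms] by blast
  define g where "g k p = of_real (sqrt (d k)) * v k p" for k p
  have "of_real (d j) * v j p * cnj (v j q) = g j p * cnj (g j q)" if "j < card I" for j p q
  proof -
    have "g j p * cnj (g j q) = of_real (sqrt (d j) * sqrt (d j)) * v j p * cnj (v j q)"
      unfolding g_def
      by (simp only: of_real_mult complex_cnj_mult complex_cnj_complex_of_real mult_ac)
    also have "sqrt (d j) * sqrt (d j) = d j" using v(2) that by simp
    finally show ?thesis by simp
  qed
  then show ?thesis using that[of g] v(3) by simp
qed

lemma pos_kernel_cong:
  assumes "pos_kernel I A" "\<And>p q. p \<in> I \<Longrightarrow> q \<in> I \<Longrightarrow> B p q = A p q"
  shows "pos_kernel I B"
  using assms unfolding pos_kernel_def sform_def by simp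

lemma pos_kernel_add: "pos_kernel I A \<Longrightarrow> pos_kernel I B \<Longrightarrow> pos_kernel I (\<lambda>p q. A p q + B p q)"
  unfolding pos_kernel_def
proof
  fix v
  assume "\<forall>v. 0 \<le> sform I A v v" "\<forall>v. 0 \<le> sform I B v v"
  then have "0 \<le> sform I A v v + sform I B v v" by (intro add_nonneg_nonneg) auto
  then show "0 \<le> sform I (\<lambda>p q. A p q + B p q) v v"
    by (simp add: sform_def algebra_simps sum.distrib)
qed

lemma pos_kernel_scale:
  assumes "pos_kernel I A" "0 \<le> c"
  shows "pos_kernel I (\<lambda>p q. of_real c * A p q)"
  unfolding pos_kernel_def
proof
  fix v
  have "sform I (\<lambda>p q. of_real c * A p q) v v = of_real c * sform I A v v"
    by (simp add: sform_def algebra_simps sum_distrib_left)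
  then show "0 \<le> sform I (\<lambda>p q. of_real c * A p q) v v"
    using assms by (simp add: pos_kernel_def less_eq_complex_def)
qed

lemma pos_kernel_zero: "pos_kernel I (\<lambda>p q. 0)"
  by (simp add: pos_kernel_def sform_def)

lemma pos_kernel_sum:
  assumes "\<And>k. k \<in> K \<Longrightarrow> pos_kernel I (A k)"
  shows "pos_kernel I (\<lambda>p q. \<Sum>k\<in>K. A k p q)"
  using assms by (induction K rule: infinite_finite_induct) (auto intro: pos_kernel_add pos_kernel_zero)

lemma pos_kernel_delta: "finite I \<Longrightarrow> pos_kernel I (\<lambda>p q. of_bool (p = q))"
  by (rule pos_kernel_gramI[where K = I and g = "\<lambda>k p. of_bool (k = p)"])
    (auto simp: of_bool_def if_distrib cong: if_cong)

lemma pos_kernel_rank1: "pos_kernel I (\<lambda>p q. u p * cnj (u q))"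
  by (rule pos_kernel_gramI[where K = "{()}" and g = "\<lambda>_. u"]) simp

lemma pos_kernel_pullback:
  assumes "finite J" "pos_kernel J A" "f ` I \<subseteq> J"
  shows "pos_kernel I (\<lambda>p q. A (f p) (f q))"
proof -
  obtain g where "\<And>p q. p \<in> J \<Longrightarrow> q \<in> J \<Longrightarrow> A p q = (\<Sum>k<card J. g k p * cnj (g k q))"
    using pos_kernel_gramE[OF assms(1,2)] by blast
  then show ?thesis using assms(3)
    by (intro pos_kernel_gramI[where K = "{..<card J}" and g = "\<lambda>k p. g k (f p)"]) auto
qed

lemma pos_kernel_transpose:
  assumes "finite I" "pos_kernel I A"
  shows "pos_kernel I (\<lambda>p q. A q p)"
proof -
  obtain g where "\<And>p q. p \<in> I \<Longrightarrow> q \<in> I \<Longrightarrow> A p q = (\<Sum>k<card I. g k p * cnj (g k q))"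
    using pos_kernel_gramE[OF assms] by blast
  then show ?thesis
    by (intro pos_kernel_gramI[where K = "{..<card I}" and g = "\<lambda>k p. cnj (g k p)"]) (auto simp: mult.commute)
qed

lemma pos_kernel_diag: "finite I \<Longrightarrow> pos_kernel I A \<Longrightarrow> p \<in> I \<Longrightarrow> 0 \<le> A p p"
  unfolding pos_kernel_def by (metis sform_delta)

lemma pos_kernel_congruence:
  assumes "finite J" "pos_kernel J A"
  shows "pos_kernel I (\<lambda>p q. \<Sum>x\<in>J. \<Sum>y\<in>J. h p x * A x y * cnj (h q y))"
proof -
  obtain g where g: "\<And>p q. p \<in> J \<Longrightarrow> q \<in> J \<Longrightarrow> A p q = (\<Sum>k<card J. g k p * cnj (g k q))"
    using pos_kernel_gramE[OF assms] by blast
  show ?thesis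
  proof (rule pos_kernel_gramI[where K = "{..<card J}" and g = "\<lambda>k p. \<Sum>x\<in>J. h p x * g k x"])
    fix p q
    have "(\<Sum>x\<in>J. \<Sum>y\<in>J. h p x * A x y * cnj (h q y)) =
        (\<Sum>x\<in>J. \<Sum>y\<in>J. \<Sum>k<card J. (h p x * g k x) * cnj (h q y * g k y))"
      by (intro sum.cong refl) (simp add: g sum_distrib_left sum_distrib_right mult_ac)
    also have "\<dots> = (\<Sum>k<card J. \<Sum>x\<in>J. \<Sum>y\<in>J. (h p x * g k x) * cnj (h q y * g k y))"
      by (rule sum_swap3)
    also have "\<dots> = (\<Sum>k<card J. (\<Sum>x\<in>J. h p x * g k x) * cnj (\<Sum>x\<in>J. h q x * g k x))"
      by (simp add: sum_product)
    finally show "(\<Sum>x\<in>J. \<Sum>y\<in>J. h p x * A x y * cnj (h q y)) =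
       (\<Sum>k<card J. (\<Sum>x\<in>J. h p x * g k x) * cnj (\<Sum>x\<in>J. h q x * g k x))" .
  qed
qed

text \<open>The Gram vectors of the result are contractions over \<open>R\<close> of a Gram vector
  of \<open>A\<close> with one of \<open>C\<close>. Rows meet rows and columns meet columns, as the
  action of a Choi kernel demands. Acting on one factor of a system, composing maps and pulling back
  a measurement are all instances.\<close>

lemma pos_kernel_contract:
  assumes fin: "finite R" "finite S" "finite T" and A: "pos_kernel (R \<times> S) A" and C: "pos_kernel (R \<times> T) C"
  shows "pos_kernel (T \<times> S) (\<lambda>p q. \<Sum>r\<in>R. \<Sum>s\<in>R. A (r, snd p) (s, snd q) * C (r, fst p) (s, fst q))"
proof -
  obtain g where g: "\<And>p q. p \<in> R \<times> S \<Longrightarrow> q \<in> R \<times> S \<Longrightarrow> A p q = (\<Sum>k<card (R \<times> S). g k p * cnj (g k q))"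
    using pos_kernel_gramE[OF _ A] fin by blast
  obtain h where h: "\<And>p q. p \<in> R \<times> T \<Longrightarrow> q \<in> R \<times> T \<Longrightarrow> C p q = (\<Sum>k<card (R \<times> T). h k p * cnj (h k q))"
    using pos_kernel_gramE[OF _ C] fin by blast
  define K where "K = {..<card (R \<times> S)} \<times> {..<card (R \<times> T)}"
  define G where "G = (\<lambda>(k, l) p. \<Sum>r\<in>R. g k (r, snd p) * h l (r, fst p))"
  show ?thesis
  proof (rule pos_kernel_gramI[where K = K and g = G])
    fix p q assume p: "p \<in> T \<times> S" and q: "q \<in> T \<times> S"
    have "(\<Sum>r\<in>R. \<Sum>s\<in>R. A (r, snd p) (s, snd q) * C (r, fst p) (s, fst q)) =
      (\<Sum>r\<in>R. \<Sum>s\<in>R. \<Sum>(k,l)\<in>K. (g k (r, snd p) * h l (r, fst p)) * cnj (g k (s, snd q) * h l (s, fst q)))"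
    proof (intro sum.cong refl)
      fix r s assume rs: "r \<in> R" "s \<in> R"
      have m: "(r, snd p) \<in> R \<times> S" "(s, snd q) \<in> R \<times> S" "(r, fst p) \<in> R \<times> T" "(s, fst q) \<in> R \<times> T"
        using p q rs by auto
      show "A (r, snd p) (s, snd q) * C (r, fst p) (s, fst q) =
         (\<Sum>(k,l)\<in>K. (g k (r, snd p) * h l (r, fst p)) * cnj (g k (s, snd q) * h l (s, fst q)))"
        unfolding g[OF m(1,2)] h[OF m(3,4)] K_def sum_product sum.cartesian_product
        by (intro sum.cong refl) (auto simp: mult_ac)
    qed
    also have "\<dots> = (\<Sum>r\<in>R. \<Sum>kl\<in>K. \<Sum>s\<in>R. (case kl of (k,l) \<Rightarrow> (g k (r, snd p) * h l (r, fst p)) * cnj (g k (s, snd q) * h l (s, fst q))))"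
      by (intro sum.cong refl sum.swap)
    also have "\<dots> = (\<Sum>kl\<in>K. \<Sum>r\<in>R. \<Sum>s\<in>R. (case kl of (k,l) \<Rightarrow> (g k (r, snd p) * h l (r, fst p)) * cnj (g k (s, snd q) * h l (s, fst q))))"
      by (rule sum.swap)
    also have "\<dots> = (\<Sum>kl\<in>K. G kl p * cnj (G kl q))"
      unfolding G_def by (intro sum.cong refl) (auto simp: sum_product)
    finally show "(\<Sum>r\<in>R. \<Sum>s\<in>R. A (r, snd p) (s, snd q) * C (r, fst p) (s, fst q)) = (\<Sum>kl\<in>K. G kl p * cnj (G kl q))" .
  qed
qed

text \<open>This is the trace of \<open>A\<close> times the transpose of \<open>C\<close>. Without a
  transpose in the formula, the value of a linear map on an input is a pairing with its Choi kernel;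
  positive kernels still pair nonnegatively, since transposition preserves positivity.\<close>

definition kernel_pair :: "'i set \<Rightarrow> ('i \<Rightarrow> 'i \<Rightarrow> complex) \<Rightarrow> ('i \<Rightarrow> 'i \<Rightarrow> complex) \<Rightarrow> complex" where
  "kernel_pair I A C = (\<Sum>p\<in>I. \<Sum>q\<in>I. A p q * C p q)"

lemma kernel_pair_cong:
  assumes "\<And>p q. p \<in> I \<Longrightarrow> q \<in> I \<Longrightarrow> A p q = A' p q" "\<And>p q. p \<in> I \<Longrightarrow> q \<in> I \<Longrightarrow> C p q = C' p q"
  shows "kernel_pair I A C = kernel_pair I A' C'"
  unfolding kernel_pair_def using assms by simp

lemma kernel_pair_commute: "kernel_pair I A C = kernel_pair I C A"
  by (simp add: kernel_pair_def mult.commute)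

lemma kernel_pair_add_right: "kernel_pair I A (\<lambda>p q. C p q + D p q) = kernel_pair I A C + kernel_pair I A D"
  by (simp add: kernel_pair_def algebra_simps sum.distrib)

lemma kernel_pair_diff_right: "kernel_pair I A (\<lambda>p q. C p q - D p q) = kernel_pair I A C - kernel_pair I A D"
  by (simp add: kernel_pair_def algebra_simps sum_subtractf)

lemma kernel_pair_scale_right: "kernel_pair I A (\<lambda>p q. c * C p q) = c * kernel_pair I A C"
  by (simp add: kernel_pair_def algebra_simps sum_distrib_left)

lemma kernel_pair_scale_left: "kernel_pair I (\<lambda>p q. c * A p q) C = c * kernel_pair I A C"
  by (simp add: kernel_pair_def algebra_simps sum_distrib_left)

lemma kernel_pair_rank1: "kernel_pair I A (\<lambda>p q. u p * cnj (u q)) = sform I A (\<lambda>p. cnj (u p)) (\<lambda>p. cnj (u p))"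
  by (simp add: kernel_pair_def sform_def mult_ac)

lemma kernel_pair_delta: "finite I \<Longrightarrow> kernel_pair I A (\<lambda>p q. of_bool (p = q)) = (\<Sum>p\<in>I. A p p)"
  by (simp add: kernel_pair_def of_bool_def if_distrib cong: if_cong)

lemma kernel_pair_nonneg:
  assumes "finite I" "pos_kernel I A" "pos_kernel I C"
  shows "0 \<le> kernel_pair I A C"
proof -
  obtain g where g: "\<And>p q. p \<in> I \<Longrightarrow> q \<in> I \<Longrightarrow> C p q = (\<Sum>k<card I. g k p * cnj (g k q))"
    using pos_kernel_gramE[OF assms(1,3)] by blast
  have "kernel_pair I A C = (\<Sum>p\<in>I. \<Sum>q\<in>I. \<Sum>k<card I. A p q * (g k p * cnj (g k q)))"
    unfolding kernel_pair_def by (intro sum.cong refl) (simp add: g sum_distrib_left)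
  also have "\<dots> = (\<Sum>k<card I. \<Sum>p\<in>I. \<Sum>q\<in>I. A p q * (g k p * cnj (g k q)))"
    by (rule sum_swap3)
  also have "\<dots> = (\<Sum>k<card I. sform I A (\<lambda>p. cnj (g k p)) (\<lambda>p. cnj (g k p)))"
    by (simp add: sform_def mult_ac)
  finally show ?thesis using assms(2) by (auto simp: pos_kernel_def intro: sum_nonneg)
qed

lemma kernel_pair_mono:
  assumes "finite I" "pos_kernel I A" "pos_kernel I (\<lambda>p q. D p q - C p q)"
  shows "Re (kernel_pair I A C) \<le> Re (kernel_pair I A D)"
  using kernel_pair_nonneg[OF assms] by (simp add: kernel_pair_diff_right less_eq_complex_def)

text \<open>The arithmetic-geometric mean inequality on the Gram vectors bounds an entry by the mean
  of two diagonal entries. A trace normalisation thereby bounds all entries, which is what makes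
  suprema over channels and measurements finite.\<close>

lemma pos_kernel_entry_bound:
  assumes "finite I" "pos_kernel I A" "p \<in> I" "q \<in> I"
  shows "cmod (A p q) \<le> Re (\<Sum>x\<in>I. A x x)"
proof -
  obtain g where g: "\<And>p q. p \<in> I \<Longrightarrow> q \<in> I \<Longrightarrow> A p q = (\<Sum>k<card I. g k p * cnj (g k q))"
    using pos_kernel_gramE[OF assms(1,2)] by blast
  have diag: "Re (A x x) = (\<Sum>k<card I. (cmod (g k x))\<^sup>2)" if "x \<in> I" for x
    using g[OF that that] by (simp add: cmod_power2 flip: power2_eq_square)
  have le: "Re (A x x) \<le> Re (\<Sum>x\<in>I. A x x)" if "x \<in> I" for x
    using assms(1) that diag by (auto intro!: member_le_sum sum_nonneg)
  have "cmod (A p q) \<le> (\<Sum>k<card I. cmod (g k p) * cmod (g k q))"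
    unfolding g[OF assms(3,4)] by (rule order_trans[OF norm_sum]) (simp add: norm_mult)
  also have "\<dots> \<le> (\<Sum>k<card I. ((cmod (g k p))\<^sup>2 + (cmod (g k q))\<^sup>2) / 2)"
  proof (rule sum_mono)
    fix k show "cmod (g k p) * cmod (g k q) \<le> ((cmod (g k p))\<^sup>2 + (cmod (g k q))\<^sup>2) / 2"
      using sum_squares_bound[of "cmod (g k p)" "cmod (g k q)"] by simp
  qed
  also have "\<dots> = (Re (A p p) + Re (A q q)) / 2"
    using diag assms(3,4) by (simp add: sum.distrib flip: sum_divide_distrib)
  finally show ?thesis using le[OF assms(3)] le[OF assms(4)] by simp
qed

text \<open>Estimating each product of coordinates by the mean of their squares, the form is at most
  \<open>\<eta> * card I\<close> times the squared norm in modulus. Entrywise closeness to the cone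
  thus turns into membership after adding a multiple of the identity.\<close>

lemma pos_kernel_add_delta:
  assumes "finite I" "herm_kernel I A" "\<And>p q. p \<in> I \<Longrightarrow> q \<in> I \<Longrightarrow> cmod (A p q) \<le> \<eta>"
  shows "pos_kernel I (\<lambda>p q. A p q + of_real (\<eta> * card I) * of_bool (p = q))"
  unfolding pos_kernel_def
proof
  fix v
  define n where "n = (\<Sum>p\<in>I. (cmod (v p))\<^sup>2)"
  have real: "Im (sform I A v v) = 0"
  proof -
    have "cnj (sform I A v v) = sform I A v v"
      unfolding sform_inner inner_on_cnj by (rule kernel_app_self_adjoint[OF assms(2), symmetric])
    then show ?thesis by (simp add: complex_eq_iff)
  qed
  have "cmod (sform I A v v) \<le> (\<Sum>p\<in>I. \<Sum>q\<in>I. cmod (cnj (v p) * A p q * v q))"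
    unfolding sform_def by (intro order_trans[OF norm_sum] sum_mono order_refl)
  also have "\<dots> \<le> (\<Sum>p\<in>I. \<Sum>q\<in>I. \<eta> * (((cmod (v p))\<^sup>2 + (cmod (v q))\<^sup>2) / 2))"
  proof (intro sum_mono)
    fix p q assume "p \<in> I" "q \<in> I"
    then have a: "cmod (A p q) \<le> \<eta>" by (rule assms(3))
    have "cmod (v p) * cmod (v q) \<le> ((cmod (v p))\<^sup>2 + (cmod (v q))\<^sup>2) / 2"
      using sum_squares_bound[of "cmod (v p)" "cmod (v q)"] by simp
    with a have "cmod (A p q) * (cmod (v p) * cmod (v q)) \<le> \<eta> * (((cmod (v p))\<^sup>2 + (cmod (v q))\<^sup>2) / 2)"
      by (intro mult_mono) (auto intro: order_trans[OF norm_ge_zero])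
    then show "cmod (cnj (v p) * A p q * v q) \<le> \<eta> * (((cmod (v p))\<^sup>2 + (cmod (v q))\<^sup>2) / 2)"
      by (simp add: norm_mult mult_ac)
  qed
  also have "\<dots> = \<eta> * card I * n"
  proof -
    have "(\<Sum>p\<in>I. \<Sum>q\<in>I. ((cmod (v p))\<^sup>2 + (cmod (v q))\<^sup>2) / 2) = card I * n"
      by (simp add: sum.distrib add_divide_distrib n_def flip: sum_distrib_left sum_divide_distrib)
    then show ?thesis unfolding sum_distrib_left[symmetric] by simp
  qed
  finally have "- (\<eta> * card I * n) \<le> Re (sform I A v v)"
    using abs_Re_le_cmod[of "sform I A v v"] by linarith
  moreover have "sform I (\<lambda>p q. of_bool (p = q)) v v = of_real n"
  proof -
    have "sform I (\<lambda>p q. of_bool (p = q)) v v = (\<Sum>p\<in>I. \<Sum>q\<in>I. if q = p then cnj (v p) * v p else 0)"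
      unfolding sform_def by (intro sum.cong refl) auto
    then show ?thesis unfolding n_def inner_on_self[symmetric] inner_on_def using assms(1) by simp
  qed
  then have "sform I (\<lambda>p q. A p q + of_real (\<eta> * card I) * of_bool (p = q)) v v =
     sform I A v v + of_real (\<eta> * card I * n)"
    by (simp add: sform_kernel_add sform_kernel_scale)
  ultimately show "0 \<le> sform I (\<lambda>p q. A p q + of_real (\<eta> * card I) * of_bool (p = q)) v v"
    using real by (simp add: less_eq_complex_def)
qed

section \<open>Separation from the positive cone\<close>

text \<open>The functional is given by the point \<open>w\<close> of least norm in the closure of
  \<open>C\<close>, obtained as the limit of a minimising sequence. Since the functional takes the
  squared norm of \<open>w\<close> at \<open>w\<close>, the lower bound \<open>m\<close> on squared
  norms is also its lower bound on \<open>C\<close>.\<close>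

lemma convex_separation:
  fixes C :: "('i \<Rightarrow> complex) set"
  assumes fin: "finite X" and ne: "C \<noteq> {}"
    and conv: "\<And>x y t. x \<in> C \<Longrightarrow> y \<in> C \<Longrightarrow> 0 \<le> t \<Longrightarrow> t \<le> 1 \<Longrightarrow>
      (\<lambda>i. of_real (1 - t) * x i + of_real t * y i) \<in> C"
    and low: "\<And>x. x \<in> C \<Longrightarrow> m \<le> (\<Sum>i\<in>X. (cmod (x i))\<^sup>2)"
  shows "\<exists>w. \<forall>x\<in>C. m \<le> Re (\<Sum>i\<in>X. x i * cnj (w i))"
proof -
  define nsq where "nsq x = (\<Sum>i\<in>X. (cmod (x i))\<^sup>2)" for x :: "'i \<Rightarrow> complex"
  define \<mu> where "\<mu> = Inf (nsq ` C)"
  have bdd: "bdd_below (nsq ` C)"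
    by (rule bdd_belowI[of _ 0]) (auto simp: nsq_def intro: sum_nonneg)
  have \<mu>m: "m \<le> \<mu>" unfolding \<mu>_def using ne low by (intro cInf_greatest) (auto simp: nsq_def)
  have \<mu>le: "\<mu> \<le> nsq x" if "x \<in> C" for x
    unfolding \<mu>_def using bdd that by (intro cInf_lower) auto
  have "\<exists>x\<in>C. nsq x < \<mu> + 1 / (real n + 1)" for n :: nat
    using cInf_less_iff[of "nsq ` C" "\<mu> + 1 / (real n + 1)"] bdd ne by (auto simp: \<mu>_def)
  then obtain x where x: "\<And>n. x n \<in> C" "\<And>n::nat. nsq (x n) < \<mu> + 1 / (real n + 1)" by metis
  have bnd: "cmod (x n i) \<le> sqrt (\<mu> + 1)" if "i \<in> X" for n i
  proof -
    have "(cmod (x n i))\<^sup>2 \<le> nsq (x n)"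
      unfolding nsq_def using fin that by (intro member_le_sum) auto
    also have "\<dots> \<le> \<mu> + 1 / (real n + 1)" using x(2)[of n] by simp
    also have "\<dots> \<le> \<mu> + 1" by simp
    finally show ?thesis by (rule real_le_rsqrt)
  qed
  obtain r w where r: "strict_mono (r :: nat \<Rightarrow> nat)" and lim: "\<And>i. i \<in> X \<Longrightarrow> (\<lambda>n. x (r n) i) \<longlonglongrightarrow> w i"
    using bounded_pointwise_convergent_subseq[OF fin, of x] bnd by blast
  have nw: "nsq w \<le> \<mu>"
  proof (rule LIMSEQ_le)
    show "(\<lambda>n. nsq (x (r n))) \<longlonglongrightarrow> nsq w" unfolding nsq_def by (intro tendsto_intros lim)
    have "(\<lambda>n. \<mu> + 1 / (real n + 1)) \<longlonglongrightarrow> \<mu> + 0"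
      using LIMSEQ_inverse_real_of_nat by (intro tendsto_add tendsto_const) (simp add: field_simps)
    then show "(\<lambda>n. \<mu> + 1 / (real (r n) + 1)) \<longlonglongrightarrow> \<mu>"
      using LIMSEQ_subseq_LIMSEQ[OF _ r] by (fastforce simp: o_def)
    show "\<exists>N. \<forall>n\<ge>N. nsq (x (r n)) \<le> \<mu> + 1 / (real (r n) + 1)"
      using x(2) by (meson less_imp_le)
  qed
  have near: "\<mu> \<le> nsq (\<lambda>i. of_real (1 - t) * w i + of_real t * y i)" if "y \<in> C" "0 \<le> t" "t \<le> 1" for y t
  proof (rule LIMSEQ_le_const)
    show "(\<lambda>n. nsq (\<lambda>i. of_real (1 - t) * x (r n) i + of_real t * y i)) \<longlonglongrightarrow>
       nsq (\<lambda>i. of_real (1 - t) * w i + of_real t * y i)"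
      unfolding nsq_def by (intro tendsto_intros lim)
    show "\<exists>N. \<forall>n\<ge>N. \<mu> \<le> nsq (\<lambda>i. of_real (1 - t) * x (r n) i + of_real t * y i)"
      using conv[OF x(1) that] \<mu>le by blast
  qed
  have wge: "\<mu> \<le> nsq w" using near[of "x 0" 0] x(1) by simp
  have "\<mu> \<le> Re (\<Sum>i\<in>X. y i * cnj (w i))" if y: "y \<in> C" for y
  proof -
    define b where "b = Re (\<Sum>i\<in>X. y i * cnj (w i))"
    define D where "D = nsq (\<lambda>i. y i - w i)"
    have Dnn: "D \<ge> 0" unfolding D_def nsq_def by (intro sum_nonneg) auto
    have id: "nsq (\<lambda>i. of_real (1 - t) * w i + of_real t * y i) = nsq w + 2 * t * (b - nsq w) + t\<^sup>2 * D" for t :: real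
    proof -
      have pt: "(cmod (of_real (1 - t) * w i + of_real t * y i))\<^sup>2 =
         (cmod (w i))\<^sup>2 + 2 * t * (Re (y i * cnj (w i)) - (cmod (w i))\<^sup>2) + t\<^sup>2 * (cmod (y i - w i))\<^sup>2" for i
        unfolding cmod_power2 by (simp add: power2_eq_square algebra_simps)
      show ?thesis unfolding nsq_def pt b_def D_def
        by (simp add: sum.distrib sum_subtractf flip: sum_distrib_left)
    qed
    have "nsq w \<le> b"
    proof (rule ccontr)
      assume "\<not> nsq w \<le> b"
      then have neg: "nsq w - b > 0" by simp
      \<comment> \<open>Moving from \<open>w\<close> towards \<open>y\<close> changes the squared
        norm at rate \<open>2 * (b - nsq w)\<close>; this step keeps the quadratic correction below
        half of that decrease.\<close>
      define t where "t = min 1 ((nsq w - b) / (D + 1))"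
      have t: "0 < t" "t \<le> 1" unfolding t_def using neg Dnn by auto
      have "\<mu> \<le> nsq w + 2 * t * (b - nsq w) + t\<^sup>2 * D" using near[OF y, of t] t id by simp
      then have "0 \<le> t * (2 * (b - nsq w) + t * D)" using nw by (simp add: power2_eq_square algebra_simps)
      then have "0 \<le> 2 * (b - nsq w) + t * D" using t(1) by (simp add: zero_le_mult_iff)
      moreover have "t * D \<le> nsq w - b"
      proof -
        have "t * D \<le> (nsq w - b) / (D + 1) * D" unfolding t_def using Dnn by (intro mult_right_mono) auto
        also have "\<dots> \<le> nsq w - b" using neg Dnn by (simp add: field_simps)
        finally show ?thesis .
      qed
      ultimately show False using neg by (smt (verit))
    qed
    then show ?thesis using wge by (simp add: b_def)
  qed
  then show ?thesis using \<mu>m by (meson order_trans)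
qed

text \<open>No closedness is needed, since the
  first alternative only asks for positivity up to an arbitrarily small multiple of the identity.\<close>

lemma pos_kernel_alternative:
  fixes C :: "('i \<Rightarrow> 'i \<Rightarrow> complex) set"
  assumes fin: "finite I" and ne: "C \<noteq> {}"
    and herm: "\<And>c. c \<in> C \<Longrightarrow> herm_kernel I c"
    and conv: "\<And>x y t. x \<in> C \<Longrightarrow> y \<in> C \<Longrightarrow> 0 \<le> t \<Longrightarrow> t \<le> 1 \<Longrightarrow>
      (\<lambda>p q. of_real (1 - t) * x p q + of_real t * y p q) \<in> C"
    and "0 < \<eta>"
  shows "(\<exists>c\<in>C. pos_kernel I (\<lambda>p q. c p q + of_real \<eta> * of_bool (p = q))) \<or>
    (\<exists>Y m. pos_kernel I Y \<and> (\<Sum>p\<in>I. Y p p) = 1 \<and> 0 < m \<and> (\<forall>c\<in>C. Re (kernel_pair I Y c) \<le> - m))"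
proof (cases "I = {}")
  case True
  then show ?thesis using ne by (auto simp: pos_kernel_def sform_def)
next
  case False
  \<comment> \<open>\<open>pos_kernel_add_delta\<close> loses a factor \<open>card I\<close> in
    passing from entries to a multiple of the identity; the division pays for it in advance.\<close>
  define \<theta> where "\<theta> = \<eta> / card I"
  have \<theta>: "\<theta> > 0" "\<theta> * card I = \<eta>" using False fin \<open>0 < \<eta>\<close> by (auto simp: \<theta>_def card_gt_0_iff)
  \<comment> \<open>The difference of \<open>C\<close> and the cone, flattened to functions on
    \<open>I \<times> I\<close>. The dichotomy is whether it comes closer to the origin than
    \<theta>.\<close>
  define D where "D = {\<lambda>z. c (fst z) (snd z) - P (fst z) (snd z) | c P. c \<in> C \<and> pos_kernel I P}"
  show ?thesis
  proof (cases "\<exists>z\<in>D. (\<Sum>i\<in>I \<times> I. (cmod (z i))\<^sup>2) < \<theta>\<^sup>2")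
    case True
    then obtain c P where c: "c \<in> C" "pos_kernel I P"
      and small: "(\<Sum>i\<in>I \<times> I. (cmod (c (fst i) (snd i) - P (fst i) (snd i)))\<^sup>2) < \<theta>\<^sup>2"
      unfolding D_def by blast
    have "cmod (c p q - P p q) \<le> \<theta>" if "p \<in> I" "q \<in> I" for p q
    proof -
      have "(cmod (c p q - P p q))\<^sup>2 \<le> (\<Sum>i\<in>I \<times> I. (cmod (c (fst i) (snd i) - P (fst i) (snd i)))\<^sup>2)"
        using fin that by (intro member_le_sum[of "(p, q)" "I \<times> I" "\<lambda>i. (cmod (c (fst i) (snd i) - P (fst i) (snd i)))\<^sup>2", simplified]) auto
      then have "(cmod (c p q - P p q))\<^sup>2 \<le> \<theta>\<^sup>2" using small by simp
      then show ?thesis using \<theta>(1) by (simp add: power2_le_iff_abs_le)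
    qed
    moreover have "herm_kernel I (\<lambda>p q. c p q - P p q)"
    proof -
      have "c q p - P q p = cnj (c p q - P p q)" if "p \<in> I" "q \<in> I" for p q
        using herm[OF c(1)] pos_kernel_herm[OF fin c(2)] that unfolding herm_kernel_def
        by (metis complex_cnj_diff)
      then show ?thesis unfolding herm_kernel_def by blast
    qed
    ultimately have "pos_kernel I (\<lambda>p q. (c p q - P p q) + of_real (\<theta> * card I) * of_bool (p = q))"
      by (intro pos_kernel_add_delta[OF fin])
    from pos_kernel_add[OF this c(2)] show ?thesis
      unfolding \<theta>(2) using c(1) by (intro disjI1 bexI[of _ c]) (auto simp: algebra_simps)
  next
    case False
    have "\<exists>w. \<forall>z\<in>D. \<theta>\<^sup>2 \<le> Re (\<Sum>i\<in>I \<times> I. z i * cnj (w i))"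
    proof (rule convex_separation)
      show "finite (I \<times> I)" using fin by simp
      show "D \<noteq> {}" unfolding D_def using ne pos_kernel_zero by blast
      show "\<theta>\<^sup>2 \<le> (\<Sum>i\<in>I \<times> I. (cmod (z i))\<^sup>2)" if "z \<in> D" for z
        using False that by (meson not_le)
      fix x y t assume x: "x \<in> D" and y: "y \<in> D" and t: "0 \<le> t" "t \<le> (1::real)"
      obtain c P where c: "c \<in> C" "pos_kernel I P" "x = (\<lambda>z. c (fst z) (snd z) - P (fst z) (snd z))"
        using x unfolding D_def by blast
      obtain c' P' where c': "c' \<in> C" "pos_kernel I P'" "y = (\<lambda>z. c' (fst z) (snd z) - P' (fst z) (snd z))"
        using y unfolding D_def by blast
      have P: "pos_kernel I (\<lambda>p q. of_real (1 - t) * P p q + of_real t * P' p q)"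
        using t by (intro pos_kernel_add pos_kernel_scale c(2) c'(2)) auto
      show "(\<lambda>i. of_real (1 - t) * x i + of_real t * y i) \<in> D"
        unfolding D_def mem_Collect_eq
        apply (rule exI[of _ "\<lambda>p q. of_real (1 - t) * c p q + of_real t * c' p q"])
        apply (rule exI[of _ "\<lambda>p q. of_real (1 - t) * P p q + of_real t * P' p q"])
        using conv[OF c(1) c'(1) t] P by (simp add: c(3) c'(3) algebra_simps)
    qed
    then obtain w0 where w0: "\<And>z. z \<in> D \<Longrightarrow> \<theta>\<^sup>2 \<le> Re (\<Sum>i\<in>I \<times> I. z i * cnj (w0 i))" by blast
    define w where "w p q = w0 (p, q)" for p q
    define L where "L k = Re (\<Sum>p\<in>I. \<Sum>q\<in>I. k p q * cnj (w p q))" for k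
    have main: "\<theta>\<^sup>2 \<le> L c - L P" if "c \<in> C" "pos_kernel I P" for c P
    proof -
      have "\<theta>\<^sup>2 \<le> Re (\<Sum>i\<in>I \<times> I. (c (fst i) (snd i) - P (fst i) (snd i)) * cnj (w0 i))"
        by (rule w0) (use that in \<open>auto simp: D_def\<close>)
      also have "\<dots> = L c - L P"
        unfolding L_def w_def
        by (simp add: sum.cartesian_product split_def left_diff_distrib sum_subtractf)
      finally show ?thesis .
    qed
    \<comment> \<open>A functional that is bounded above on a cone is nonpositive there: a positive
      value could be scaled until it outweighs \<open>L c\<close>, against the gap.\<close>
    have Lpos: "L P \<le> 0" if P: "pos_kernel I P" for P
    proof (rule ccontr)
      assume "\<not> L P \<le> 0"
      then have LP: "L P > 0" by simp
      obtain c where c: "c \<in> C" using ne by blast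
      define s where "s = \<bar>L c\<bar> / L P"
      have s: "s \<ge> 0" using LP by (simp add: s_def)
      have "L (\<lambda>p q. of_real s * P p q) = s * L P"
        unfolding L_def by (simp add: mult.assoc flip: sum_distrib_left)
      moreover have "s * L P = \<bar>L c\<bar>" using LP by (simp add: s_def)
      ultimately have "\<theta>\<^sup>2 \<le> L c - \<bar>L c\<bar>" using main[OF c pos_kernel_scale[OF P s]] by simp
      moreover have "\<theta>\<^sup>2 > 0" using \<theta>(1) by simp
      ultimately show False by linarith
    qed
    \<comment> \<open>Minus the conjugated Hermitian part of \<open>w\<close>. The conjugate is due
      to the bilinear pairing, Hermitian kernels test nothing else, and the sign makes the
      functional nonnegative on the cone.\<close>
    define Y where "Y p q = - (cnj (w p q) + w q p) / 2" for p q
    have hermY: "herm_kernel I Y" unfolding herm_kernel_def Y_def by (simp add: add.commute)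
    have YL: "Re (kernel_pair I Y k) = - L k" if k: "herm_kernel I k" for k
    proof -
      define Q where "Q = (\<Sum>p\<in>I. \<Sum>q\<in>I. k p q * cnj (w p q))"
      have "kernel_pair I Y k = - ((\<Sum>p\<in>I. \<Sum>q\<in>I. k p q * cnj (w p q)) + (\<Sum>p\<in>I. \<Sum>q\<in>I. k p q * w q p)) / 2"
        unfolding kernel_pair_def Y_def
        by (simp add: algebra_simps add_divide_distrib sum_subtractf sum_negf sum.distrib flip: sum_divide_distrib)
      also have "(\<Sum>p\<in>I. \<Sum>q\<in>I. k p q * w q p) = (\<Sum>p\<in>I. \<Sum>q\<in>I. cnj (k q p * cnj (w q p)))"
      proof (intro sum.cong refl)
        fix p q assume "p \<in> I" "q \<in> I"
        then have "k p q = cnj (k q p)" using k unfolding herm_kernel_def by blast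
        then show "k p q * w q p = cnj (k q p * cnj (w q p))" by (metis complex_cnj_cnj complex_cnj_mult)
      qed
      also have "\<dots> = cnj (\<Sum>p\<in>I. \<Sum>q\<in>I. k p q * cnj (w p q))"
        by (subst sum.swap) simp
      finally have "kernel_pair I Y k = - (Q + cnj Q) / 2" unfolding Q_def .
      then have "Re (kernel_pair I Y k) = Re (- (Q + cnj Q) / 2)" by (rule arg_cong)
      also have "\<dots> = - Re Q" by simp
      finally show ?thesis unfolding L_def Q_def[symmetric] .
    qed
    have posY: "pos_kernel I Y" unfolding pos_kernel_def
    proof
      fix v
      have "kernel_pair I Y (\<lambda>p q. cnj (v p) * cnj (cnj (v q))) = sform I Y v v"
        unfolding kernel_pair_rank1 by simp
      moreover have "Re (kernel_pair I Y (\<lambda>p q. cnj (v p) * cnj (cnj (v q)))) \<ge> 0"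
        unfolding YL[OF pos_kernel_herm[OF fin pos_kernel_rank1]]
        using Lpos[OF pos_kernel_rank1] by (simp only: neg_0_le_iff_le)
      moreover have "cnj (sform I Y v v) = sform I Y v v"
        unfolding sform_inner inner_on_cnj by (rule kernel_app_self_adjoint[OF hermY, symmetric])
      ultimately show "0 \<le> sform I Y v v" by (simp add: less_eq_complex_def complex_eq_iff)
    qed
    have Yneg: "Re (kernel_pair I Y c) \<le> - \<theta>\<^sup>2" if "c \<in> C" for c
      using main[OF that pos_kernel_zero] YL[OF herm[OF that]] by (simp add: L_def)
    define \<tau> where "\<tau> = Re (\<Sum>p\<in>I. Y p p)"
    have tr: "(\<Sum>p\<in>I. Y p p) = of_real \<tau>" "\<tau> \<ge> 0"
    proof -
      have "0 \<le> (\<Sum>p\<in>I. Y p p)" using pos_kernel_diag[OF fin posY] by (intro sum_nonneg)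
      then show "(\<Sum>p\<in>I. Y p p) = of_real \<tau>" "\<tau> \<ge> 0"
        by (auto simp: \<tau>_def less_eq_complex_def complex_eq_iff)
    qed
    \<comment> \<open>With trace zero all entries of \<open>Y\<close> would vanish by the entry
      bound, contrary to the strict gap on the nonempty set \<open>C\<close>.\<close>
    have "\<tau> \<noteq> 0"
    proof
      assume "\<tau> = 0"
      then have "Y p q = 0" if "p \<in> I" "q \<in> I" for p q
        using pos_kernel_entry_bound[OF fin posY that] by (simp add: \<tau>_def)
      then have "kernel_pair I Y c = 0" for c by (simp add: kernel_pair_def)
      then show False using Yneg ne \<theta>(1) by fastforce
    qed
    with tr have \<tau>: "\<tau> > 0" by simp
    show ?thesis
    proof (intro disjI2 exI conjI ballI)
      show "pos_kernel I (\<lambda>p q. of_real (1 / \<tau>) * Y p q)"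
        using \<tau> by (intro pos_kernel_scale posY) simp
      show "(\<Sum>p\<in>I. of_real (1 / \<tau>) * Y p p) = 1"
        using \<tau> tr(1) by (simp flip: sum_divide_distrib)
      show "0 < \<theta>\<^sup>2 / \<tau>" using \<theta> \<tau> by simp
      show "Re (kernel_pair I (\<lambda>p q. of_real (1 / \<tau>) * Y p q) c) \<le> - (\<theta>\<^sup>2 / \<tau>)" if "c \<in> C" for c
        unfolding kernel_pair_scale_left using Yneg[OF that] \<tau> by (simp add: field_simps)
    qed
  qed
qed

section \<open>Trace norm\<close>

lemma onb_mult:
  assumes "onb I v" "q \<in> I"
  shows "(\<Sum>r\<in>I. (\<Sum>j<card I. a j * v j p * cnj (v j r)) * (\<Sum>k<card I. b k * v k r * cnj (v k q))) =
    (\<Sum>j<card I. a j * b j * v j p * cnj (v j q))"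
proof -
  have "(\<Sum>r\<in>I. (\<Sum>j<card I. a j * v j p * cnj (v j r)) * (\<Sum>k<card I. b k * v k r * cnj (v k q))) =
     (\<Sum>r\<in>I. \<Sum>j<card I. \<Sum>k<card I. (a j * v j p * b k * cnj (v k q)) * (cnj (v j r) * v k r))"
    unfolding sum_product by (intro sum.cong refl) simp
  also have "\<dots> = (\<Sum>j<card I. \<Sum>k<card I. \<Sum>r\<in>I. (a j * v j p * b k * cnj (v k q)) * (cnj (v j r) * v k r))"
    by (rule sum_swap3[symmetric])
  also have "\<dots> = (\<Sum>j<card I. \<Sum>k<card I. (a j * v j p * b k * cnj (v k q)) * inner_on I (v j) (v k))"
    by (simp add: inner_on_def sum_distrib_left)
  also have "\<dots> = (\<Sum>j<card I. \<Sum>k<card I. if k = j then a j * b j * v j p * cnj (v j q) else 0)"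
    using assms(1) by (intro sum.cong refl) (auto simp: onb_def)
  finally show ?thesis by simp
qed

lemma onb_trace:
  assumes "onb I v"
  shows "(\<Sum>p\<in>I. \<Sum>j<card I. a j * v j p * cnj (v j p)) = (\<Sum>j<card I. a j)"
proof -
  have "(\<Sum>p\<in>I. \<Sum>j<card I. a j * v j p * cnj (v j p)) = (\<Sum>j<card I. a j * inner_on I (v j) (v j))"
    by (subst sum.swap) (simp add: inner_on_def sum_distrib_left mult_ac)
  also have "\<dots> = (\<Sum>j<card I. a j)"
    using assms by (intro sum.cong refl) (auto simp: onb_def)
  finally show ?thesis .
qed

lemma onb_kernel_app:
  assumes "onb I v" "k < card I" "p \<in> I"
    "\<And>p q. p \<in> I \<Longrightarrow> q \<in> I \<Longrightarrow> A p q = (\<Sum>j<card I. a j * v j p * cnj (v j q))"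
  shows "kernel_app I A (v k) p = a k * v k p"
proof -
  have "kernel_app I A (v k) p = (\<Sum>q\<in>I. \<Sum>j<card I. a j * v j p * (cnj (v j q) * v k q))"
    unfolding kernel_app_def by (intro sum.cong refl) (simp add: assms(3,4) sum_distrib_right mult.assoc)
  also have "\<dots> = (\<Sum>j<card I. a j * v j p * inner_on I (v j) (v k))"
    by (subst sum.swap) (simp add: inner_on_def sum_distrib_left)
  also have "\<dots> = (\<Sum>j<card I. if j = k then a k * v k p else 0)"
    using assms(1,2) by (intro sum.cong refl) (auto simp: onb_def)
  finally show ?thesis using assms(2) by simp
qed

lemma onb_expand:
  assumes "onb I v" "onb I w" "finite I" "p \<in> I" "q \<in> I"
  shows "A p q = (\<Sum>j<card I. \<Sum>k<card I. v j p * sform I A (v j) (w k) * cnj (w k q))"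
proof -
  have "(\<Sum>j<card I. \<Sum>k<card I. v j p * sform I A (v j) (w k) * cnj (w k q)) =
    (\<Sum>j<card I. \<Sum>k<card I. \<Sum>(x,y)\<in>I\<times>I. (v j p * cnj (v j x)) * A x y * (w k y * cnj (w k q)))"
    unfolding sform_def sum.cartesian_product[symmetric]
    by (intro sum.cong refl) (simp add: sum_distrib_left sum_distrib_right mult_ac)
  also have "\<dots> = (\<Sum>(x,y)\<in>I\<times>I. \<Sum>j<card I. \<Sum>k<card I. (v j p * cnj (v j x)) * A x y * (w k y * cnj (w k q)))"
    unfolding split_def by (rule sum_swap3)
  also have "\<dots> = (\<Sum>(x,y)\<in>I\<times>I. (\<Sum>j<card I. v j p * cnj (v j x)) * A x y * (\<Sum>k<card I. w k y * cnj (w k q)))"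
    unfolding split_def by (intro sum.cong refl) (simp flip: sum_distrib_left sum_distrib_right)
  also have "\<dots> = (\<Sum>x\<in>I. \<Sum>y\<in>I. if x = p then (if y = q then A x y else 0) else 0)"
    unfolding sum.cartesian_product using assms by (intro sum.cong refl) (auto simp: onb_def)
  also have "\<dots> = (\<Sum>x\<in>I. if x = p then A x q else 0)"
    using assms by (intro sum.cong refl) auto
  finally show ?thesis using assms by simp
qed

text \<open>This resolves the definite description in \<open>trace_norm\<close>. For eigenvectors of
  \<open>B\<close> and \<open>C\<close> with inner product \<open>X\<close>, equality of the squares
  gives \<open>b\<^sup>2 * X = c\<^sup>2 * X\<close>; nonnegativity leaves \<open>X = 0\<close> or
  \<open>b = c\<close>, and in both cases the matrix elements \<open>b * X\<close> and
  \<open>c * X\<close> agree.\<close>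

lemma pos_sqrt_unique:
  assumes fin: "finite I" and B: "pos_kernel I B" and C: "pos_kernel I C"
    and eq: "\<And>p q. p \<in> I \<Longrightarrow> q \<in> I \<Longrightarrow> (\<Sum>r\<in>I. B p r * B r q) = (\<Sum>r\<in>I. C p r * C r q)"
    and pq: "p \<in> I" "q \<in> I"
  shows "B p q = C p q"
proof -
  obtain v b where v: "onb I v" "\<forall>j<card I. 0 \<le> b j"
     "\<forall>p\<in>I. \<forall>q\<in>I. B p q = (\<Sum>j<card I. of_real (b j) * v j p * cnj (v j q))"
    using pos_kernel_spectral[OF fin B] by blast
  obtain w c where w: "onb I w" "\<forall>j<card I. 0 \<le> c j"
     "\<forall>p\<in>I. \<forall>q\<in>I. C p q = (\<Sum>j<card I. of_real (c j) * w j p * cnj (w j q))"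
    using pos_kernel_spectral[OF fin C] by blast
  have Bv: "kernel_app I B (v j) p = of_real (b j) * v j p" if "j < card I" "p \<in> I" for j p
    using onb_kernel_app[OF v(1) that, of B "\<lambda>j. of_real (b j)"] v(3) by blast
  have Cw: "kernel_app I C (w j) p = of_real (c j) * w j p" if "j < card I" "p \<in> I" for j p
    using onb_kernel_app[OF w(1) that, of C "\<lambda>j. of_real (c j)"] w(3) by blast
  have sq: "kernel_app I A (kernel_app I A x) p = (\<Sum>q\<in>I. (\<Sum>r\<in>I. A p r * A r q) * x q)" for A x p
  proof -
    have "kernel_app I A (kernel_app I A x) p = (\<Sum>r\<in>I. \<Sum>q\<in>I. A p r * A r q * x q)"
      by (simp add: kernel_app_def sum_distrib_left mult.assoc)
    also have "\<dots> = (\<Sum>q\<in>I. (\<Sum>r\<in>I. A p r * A r q) * x q)"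
      by (subst sum.swap) (simp add: sum_distrib_right)
    finally show ?thesis .
  qed
  have "sform I B (v j) (w k) = sform I C (v j) (w k)" if choi_kernel: "j < card I" "k < card I" for j k
  proof -
    define X where "X = inner_on I (v j) (w k)"
    have iv: "inner_on I (kernel_app I B (v j)) y = of_real (b j) * inner_on I (v j) y" for y
    proof -
      have "inner_on I (kernel_app I B (v j)) y = inner_on I (\<lambda>p. of_real (b j) * v j p) y"
        unfolding inner_on_def using Bv[OF choi_kernel(1)] by (intro sum.cong refl) simp
      then show ?thesis by (simp add: inner_on_scale_left)
    qed
    have B1: "sform I B (v j) (w k) = of_real (b j) * X"
      unfolding sform_inner kernel_app_self_adjoint[OF pos_kernel_herm[OF fin B]] iv X_def ..
    have iw: "inner_on I y (kernel_app I C (w k)) = of_real (c k) * inner_on I y (w k)" for y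
    proof -
      have "inner_on I y (kernel_app I C (w k)) = inner_on I y (\<lambda>p. of_real (c k) * w k p)"
        unfolding inner_on_def using Cw[OF choi_kernel(2)] by (intro sum.cong refl) simp
      then show ?thesis by (simp add: inner_on_scale_right)
    qed
    have C1: "sform I C (v j) (w k) = of_real (c k) * X" unfolding sform_inner iw X_def ..
    have B2: "inner_on I (v j) (kernel_app I B (kernel_app I B (w k))) = of_real (b j) * (of_real (b j) * X)"
      unfolding kernel_app_self_adjoint[OF pos_kernel_herm[OF fin B], of "v j"] iv
      unfolding kernel_app_self_adjoint[OF pos_kernel_herm[OF fin B], of "v j"] iv X_def ..
    have "inner_on I (v j) (kernel_app I C (kernel_app I C (w k))) = inner_on I (kernel_app I C (v j)) (kernel_app I C (w k))"
      by (rule kernel_app_self_adjoint[OF pos_kernel_herm[OF fin C]])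
    also have "\<dots> = of_real (c k) * (of_real (c k) * X)"
      unfolding iw unfolding kernel_app_self_adjoint[OF pos_kernel_herm[OF fin C], symmetric] iw X_def ..
    finally have C2: "inner_on I (v j) (kernel_app I C (kernel_app I C (w k))) = of_real (c k) * (of_real (c k) * X)" .
    have "inner_on I (v j) (kernel_app I B (kernel_app I B (w k))) = inner_on I (v j) (kernel_app I C (kernel_app I C (w k)))"
      unfolding inner_on_def sq using eq by (intro sum.cong refl) simp
    then have "of_real (b j * b j) * X = of_real (c k * c k) * X" unfolding B2 C2 by simp
    then have "X = 0 \<or> b j * b j = c k * c k" by (metis mult_right_cancel of_real_eq_iff)
    then have "X = 0 \<or> b j = c k" using v(2) w(2) choi_kernel by (metis power2_eq_square power2_eq_imp_eq)
    then show ?thesis unfolding B1 C1 by auto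
  qed
  then show ?thesis
    using onb_expand[OF v(1) w(1) fin pq, of B] onb_expand[OF v(1) w(1) fin pq, of C] by simp
qed

text \<open>The right vectors are an eigenbasis of the adjoint of \<open>A\<close> times
  \<open>A\<close>, and the left ones are their normalised images. Division by zero makes
  \<open>u j\<close> vanish when \<open>s j = 0\<close>, so orthonormality of the left family is
  claimed only for positive singular values.\<close>

lemma svd_kernel:
  assumes fin: "finite I"
  shows "\<exists>u v (s :: nat \<Rightarrow> real). onb I v \<and> (\<forall>j<card I. 0 \<le> s j) \<and>
    (\<forall>j<card I. \<forall>k<card I. 0 < s j \<longrightarrow> 0 < s k \<longrightarrow> inner_on I (u j) (u k) = of_bool (j = k)) \<and>
    (\<forall>j<card I. \<forall>p\<in>I. kernel_app I A (v j) p = of_real (s j) * u j p) \<and>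
    (\<forall>p\<in>I. \<forall>q\<in>I. A p q = (\<Sum>j<card I. of_real (s j) * u j p * cnj (v j q))) \<and>
    (\<forall>p\<in>I. \<forall>q\<in>I. (\<Sum>r\<in>I. cnj (A r p) * A r q) = (\<Sum>j<card I. of_real (s j * s j) * v j p * cnj (v j q)))"
proof -
  define N where "N p q = (\<Sum>r\<in>I. cnj (A r p) * A r q)" for p q
  have "pos_kernel I N"
    by (rule pos_kernel_gramI[where K = I and g = "\<lambda>r p. cnj (A r p)"]) (simp add: N_def)
  then obtain v d where v: "onb I v" "\<forall>j<card I. 0 \<le> d j"
     "\<forall>p\<in>I. \<forall>q\<in>I. N p q = (\<Sum>j<card I. of_real (d j) * v j p * cnj (v j q))"
    using pos_kernel_spectral[OF fin] by blast
  define s where "s j = sqrt (d j)" for j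
  have s: "0 \<le> s j" "s j * s j = d j" if "j < card I" for j using v(2) that by (auto simp: s_def)
  have Nv: "kernel_app I N (v j) p = of_real (d j) * v j p" if "j < card I" "p \<in> I" for j p
    using onb_kernel_app[OF v(1) that, of N "\<lambda>j. of_real (d j)"] v(3) by blast
  have AA: "inner_on I (kernel_app I A x) (kernel_app I A y) = inner_on I x (kernel_app I N y)" for x y
  proof -
    have "inner_on I (kernel_app I A x) (kernel_app I A y) = (\<Sum>r\<in>I. \<Sum>p\<in>I. \<Sum>q\<in>I. cnj (A r p) * cnj (x p) * (A r q * y q))"
      unfolding inner_on_def kernel_app_def by (simp add: sum_product)
    also have "\<dots> = (\<Sum>p\<in>I. \<Sum>q\<in>I. \<Sum>r\<in>I. cnj (A r p) * cnj (x p) * (A r q * y q))"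
      by (rule sum_swap3[symmetric])
    also have "\<dots> = inner_on I x (kernel_app I N y)"
      unfolding inner_on_def kernel_app_def N_def by (simp add: sum_distrib_left sum_distrib_right mult_ac)
    finally show ?thesis .
  qed
  have inn: "inner_on I (kernel_app I A (v j)) (kernel_app I A (v k)) = of_real (d k) * of_bool (j = k)"
    if "j < card I" "k < card I" for j k
  proof -
    have "inner_on I (v j) (kernel_app I N (v k)) = inner_on I (v j) (\<lambda>p. of_real (d k) * v k p)"
      unfolding inner_on_def using Nv[OF that(2)] by (intro sum.cong refl) simp
    then show ?thesis using v(1) that unfolding AA by (simp add: inner_on_scale_right onb_def)
  qed
  define u where "u j = (\<lambda>p. of_real (1 / s j) * kernel_app I A (v j) p)" for j
  have su: "kernel_app I A (v j) p = of_real (s j) * u j p" if "j < card I" "p \<in> I" for j p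
  proof (cases "s j = 0")
    case True
    then have "inner_on I (kernel_app I A (v j)) (kernel_app I A (v j)) = 0"
      using inn[OF that(1) that(1)] s(2)[OF that(1)] by simp
    then show ?thesis using inner_on_self_eq_0[OF fin _ that(2), of "kernel_app I A (v j)"] True by simp
  next
    case False
    then show ?thesis by (simp add: u_def)
  qed
  have uu: "inner_on I (u j) (u k) = of_bool (j = k)" if "j < card I" "k < card I" "0 < s j" "0 < s k" for j k
  proof -
    have "inner_on I (u j) (u k) = of_real (1 / s j) * of_real (1 / s k) * (of_real (d k) * of_bool (j = k))"
      unfolding u_def inner_on_scale_left inner_on_scale_right inn[OF that(1,2)] by simp
    also have "\<dots> = of_bool (j = k)"
      using that s(2)[OF that(2)] by (cases "j = k") (auto simp flip: of_real_mult)
    finally show ?thesis .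
  qed
  have exp: "A p q = (\<Sum>j<card I. of_real (s j) * u j p * cnj (v j q))" if "p \<in> I" "q \<in> I" for p q
  proof -
    have "(\<Sum>j<card I. of_real (s j) * u j p * cnj (v j q)) = (\<Sum>j<card I. kernel_app I A (v j) p * cnj (v j q))"
      using su that by simp
    also have "\<dots> = (\<Sum>r\<in>I. A p r * (\<Sum>j<card I. v j r * cnj (v j q)))"
      unfolding kernel_app_def sum_distrib_right sum_distrib_left
      by (subst sum.swap) (simp add: mult.assoc)
    also have "\<dots> = (\<Sum>r\<in>I. if r = q then A p r else 0)"
      using v(1) that by (intro sum.cong refl) (auto simp: onb_def)
    finally show ?thesis using that fin by simp
  qed
  have "\<forall>p\<in>I. \<forall>q\<in>I. (\<Sum>r\<in>I. cnj (A r p) * A r q) = (\<Sum>j<card I. of_real (s j * s j) * v j p * cnj (v j q))"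
    using v(3) s(2) unfolding N_def by simp
  then show ?thesis using v(1) s(1) uu su exp by blast
qed

text \<open>Identity minus the projection onto the family is again a projection, hence a Gram
  kernel, and pairs nonnegatively with \<open>A\<close>. The kernel \<open>U\<close> is the
  transposed projection because the pairing has no transpose.\<close>

lemma bessel_pos_kernel:
  assumes fin: "finite I" and A: "pos_kernel I A"
    and orth: "\<And>j k. j \<in> J \<Longrightarrow> k \<in> J \<Longrightarrow> inner_on I (u j) (u k) = of_bool (j = k)" and finJ: "finite J"
  shows "Re (\<Sum>j\<in>J. sform I A (u j) (u j)) \<le> Re (\<Sum>p\<in>I. A p p)"
proof -
  define U where "U p q = (\<Sum>j\<in>J. cnj (u j p) * u j q)" for p q
  have cU: "cnj (U q p) = U p q" for p q by (simp add: U_def mult.commute)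
  have UU: "(\<Sum>r\<in>I. U p r * U r q) = U p q" for p q
  proof -
    have "(\<Sum>r\<in>I. U p r * U r q) = (\<Sum>r\<in>I. \<Sum>j\<in>J. \<Sum>k\<in>J. (cnj (u j p) * u k q) * (cnj (u k r) * u j r))"
      unfolding U_def sum_product by (simp add: mult_ac)
    also have "\<dots> = (\<Sum>j\<in>J. \<Sum>k\<in>J. \<Sum>r\<in>I. (cnj (u j p) * u k q) * (cnj (u k r) * u j r))"
      by (rule sum_swap3[symmetric])
    also have "\<dots> = (\<Sum>j\<in>J. \<Sum>k\<in>J. (cnj (u j p) * u k q) * inner_on I (u k) (u j))"
      by (simp add: inner_on_def sum_distrib_left)
    also have "\<dots> = (\<Sum>j\<in>J. \<Sum>k\<in>J. if k = j then cnj (u j p) * u j q else 0)"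
      using orth by (intro sum.cong refl) auto
    finally show ?thesis using finJ by (simp add: U_def)
  qed
  have "pos_kernel I (\<lambda>p q. of_bool (p = q) - U p q)"
  proof (rule pos_kernel_gramI[where K = I and g = "\<lambda>r p. of_bool (p = r) - U p r"])
    fix p q assume pq: "p \<in> I" "q \<in> I"
    have "(\<Sum>r\<in>I. (of_bool (p = r) - U p r) * cnj (of_bool (q = r) - U q r)) =
       (\<Sum>r\<in>I. of_bool (p = r) * of_bool (q = r) - of_bool (p = r) * U r q - U p r * of_bool (q = r) + U p r * U r q)"
      by (intro sum.cong refl) (simp add: algebra_simps cU)
    also have "\<dots> = (\<Sum>r\<in>I. of_bool (p = r) * of_bool (q = r)) - (\<Sum>r\<in>I. of_bool (p = r) * U r q)
        - (\<Sum>r\<in>I. U p r * of_bool (q = r)) + (\<Sum>r\<in>I. U p r * U r q)"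
      by (simp add: sum.distrib sum_subtractf)
    also have "(\<Sum>r\<in>I. of_bool (p = r) * of_bool (q = r)) = (\<Sum>r\<in>I. if r = p then of_bool (p = q) else (0::complex))"
      by (intro sum.cong refl) auto
    also have "(\<Sum>r\<in>I. of_bool (p = r) * U r q) = (\<Sum>r\<in>I. if r = p then U p q else 0)"
      by (intro sum.cong refl) auto
    also have "(\<Sum>r\<in>I. U p r * of_bool (q = r)) = (\<Sum>r\<in>I. if r = q then U p q else 0)"
      by (intro sum.cong refl) auto
    finally show "of_bool (p = q) - U p q = (\<Sum>r\<in>I. (of_bool (p = r) - U p r) * cnj (of_bool (q = r) - U q r))"
      using pq fin UU by simp
  qed
  from kernel_pair_nonneg[OF fin A this] have "0 \<le> Re (kernel_pair I A (\<lambda>p q. of_bool (p = q)) - kernel_pair I A U)"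
    by (simp add: kernel_pair_diff_right less_eq_complex_def)
  moreover have "kernel_pair I A U = (\<Sum>j\<in>J. sform I A (u j) (u j))"
  proof -
    have "kernel_pair I A U = (\<Sum>p\<in>I. \<Sum>q\<in>I. \<Sum>j\<in>J. cnj (u j p) * A p q * u j q)"
      unfolding kernel_pair_def U_def by (simp add: sum_distrib_left mult_ac)
    also have "\<dots> = (\<Sum>j\<in>J. sform I A (u j) (u j))" unfolding sform_def by (rule sum_swap3)
    finally show ?thesis .
  qed
  ultimately show ?thesis using kernel_pair_delta[OF fin, of A] by simp
qed

section \<open>Matrices as kernels and the trace norm of the definitions\<close>

abbreviation mat_kernel :: "complex mat \<Rightarrow> nat \<Rightarrow> nat \<Rightarrow> complex" where
  "mat_kernel A \<equiv> \<lambda>p q. A $$ (p, q)"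

lemma psd_iff_pos_kernel: "psd d A \<longleftrightarrow> A \<in> carrier_mat d d \<and> pos_kernel {..<d} (mat_kernel A)"
proof (cases "A \<in> carrier_mat d d")
  case True
  have form: "(A *\<^sub>v v) \<bullet> conjugate v = sform {..<d} (mat_kernel A) (\<lambda>i. v $ i) (\<lambda>i. v $ i)"
    if v: "v \<in> carrier_vec d" for v
  proof -
    have "(A *\<^sub>v v) \<bullet> conjugate v = (\<Sum>i<d. (\<Sum>j<d. A $$ (i,j) * v $ j) * cnj (v $ i))"
      using True v by (auto simp: scalar_prod_def atLeast0LessThan intro!: sum.cong)
    then show ?thesis by (simp add: sform_def sum_distrib_left sum_distrib_right mult_ac)
  qed
  have vec: "sform {..<d} (mat_kernel A) v v = sform {..<d} (mat_kernel A) (\<lambda>i. vec d v $ i) (\<lambda>i. vec d v $ i)" for v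
    unfolding sform_def by simp
  have "(\<forall>v\<in>carrier_vec d. 0 \<le> sform {..<d} (mat_kernel A) (\<lambda>i. v $ i) (\<lambda>i. v $ i)) \<longleftrightarrow> pos_kernel {..<d} (mat_kernel A)"
    unfolding pos_kernel_def by (metis vec vec_carrier)
  moreover have "z \<in> \<real> \<and> 0 \<le> Re z \<longleftrightarrow> 0 \<le> z" for z
    by (auto simp: less_eq_complex_def complex_is_Real_iff)
  ultimately show ?thesis using True by (simp add: psd_def form)
qed (simp add: psd_def)

lemma mtrace_carrier: "A \<in> carrier_mat d d \<Longrightarrow> mtrace A = (\<Sum>i<d. A $$ (i,i))"
  by (simp add: mtrace_def)

lemma mat_adjoint_index:
  assumes "A \<in> carrier_mat n m" "i < m" "j < n"
  shows "mat_adjoint A $$ (i, j) = cnj (A $$ (j, i))"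
  using assms by (simp add: mat_adjoint_def mat_of_rows_def)

lemma mat_adjoint_carrier: "A \<in> carrier_mat n m \<Longrightarrow> mat_adjoint A \<in> carrier_mat m n"
  by (simp add: mat_adjoint_def mat_of_rows_def)

lemma mat_mult_index:
  assumes "A \<in> carrier_mat n m" "B \<in> carrier_mat m k" "i < n" "j < k"
  shows "(A * B) $$ (i, j) = (\<Sum>r<m. A $$ (i, r) * B $$ (r, j))"
  using assms by (auto simp: scalar_prod_def atLeast0LessThan)

lemma trace_norm_eqI:
  assumes A: "A \<in> carrier_mat d d" and B: "psd d B"
    and eq: "\<And>p q. p < d \<Longrightarrow> q < d \<Longrightarrow> (\<Sum>r<d. B $$ (p, r) * B $$ (r, q)) = (\<Sum>r<d. cnj (A $$ (r, p)) * A $$ (r, q))"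
  shows "trace_norm A = Re (mtrace B)"
proof -
  have carB: "B \<in> carrier_mat d d" using B by (simp add: psd_def)
  have ind: "(mat_adjoint A * A) $$ (p, q) = (\<Sum>r<d. cnj (A $$ (r, p)) * A $$ (r, q))" if "p < d" "q < d" for p q
    using mat_mult_index[OF mat_adjoint_carrier[OF A] A that] mat_adjoint_index[OF A that(1)] by simp
  have BB: "B * B = mat_adjoint A * A"
  proof (rule eq_matI)
    have d: "dim_row (mat_adjoint A * A) = d" "dim_col (mat_adjoint A * A) = d"
      using A mat_adjoint_carrier[OF A] by auto
    show "dim_row (B * B) = dim_row (mat_adjoint A * A)" "dim_col (B * B) = dim_col (mat_adjoint A * A)"
      using carB A mat_adjoint_carrier[OF A] by auto
    fix p q assume "p < dim_row (mat_adjoint A * A)" "q < dim_col (mat_adjoint A * A)"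
    then have pq: "p < d" "q < d" by (simp_all only: d)
    then show "(B * B) $$ (p, q) = (mat_adjoint A * A) $$ (p, q)"
      using mat_mult_index[OF carB carB pq] eq[OF pq] ind[OF pq] by simp
  qed
  have "(THE B. psd (dim_col A) B \<and> B * B = mat_adjoint A * A) = B"
  proof (rule the_equality)
    show "psd (dim_col A) B \<and> B * B = mat_adjoint A * A" using A B BB by simp
    fix C assume "psd (dim_col A) C \<and> C * C = mat_adjoint A * A"
    then have C: "psd d C" "C * C = B * B" using A BB by auto
    then have carC: "C \<in> carrier_mat d d" by (simp add: psd_def)
    have "C $$ (p, q) = B $$ (p, q)" if pq: "p < d" "q < d" for p q
    proof (rule pos_sqrt_unique[of "{..<d}" "mat_kernel C" "mat_kernel B"])
      show "pos_kernel {..<d} (mat_kernel C)" "pos_kernel {..<d} (mat_kernel B)"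
        using C(1) B by (auto simp: psd_iff_pos_kernel)
      fix p q assume "p \<in> {..<d}" "q \<in> {..<d}"
      then have pq: "p < d" "q < d" by auto
      show "(\<Sum>r<d. C $$ (p, r) * C $$ (r, q)) = (\<Sum>r<d. B $$ (p, r) * B $$ (r, q))"
        unfolding mat_mult_index[OF carC carC pq, symmetric] mat_mult_index[OF carB carB pq, symmetric] C(2) ..
    qed (use pq in auto)
    then show "C = B" using carB carC by (intro eq_matI) auto
  qed
  then show ?thesis by (simp add: trace_norm_def)
qed

lemma trace_norm_psd:
  assumes "psd d A"
  shows "trace_norm A = Re (mtrace A)"
proof (rule trace_norm_eqI[OF _ assms])
  show "A \<in> carrier_mat d d" using assms by (simp add: psd_def)
  have "herm_kernel {..<d} (mat_kernel A)" using assms pos_kernel_herm by (auto simp: psd_iff_pos_kernel)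
  then show "(\<Sum>r<d. A $$ (p, r) * A $$ (r, q)) = (\<Sum>r<d. cnj (A $$ (r, p)) * A $$ (r, q))" if "p < d" "q < d" for p q
    using that unfolding herm_kernel_def by (intro sum.cong refl) (metis lessThan_iff)
qed

text \<open>\<open>B\<close> is the candidate for the absolute value of a matrix, assembled in an
  eigenbasis; it serves both general matrices through singular values and Hermitian ones through
  absolute eigenvalues.\<close>

lemma psd_onb:
  assumes "onb {..<d} v" "\<And>j. j < d \<Longrightarrow> 0 \<le> (s j :: real)"
  defines "B \<equiv> mat d d (\<lambda>(p, q). \<Sum>j<d. of_real (s j) * v j p * cnj (v j q))"
  shows "psd d B" and "mtrace B = of_real (\<Sum>j<d. s j)"
    and "\<And>p q. p < d \<Longrightarrow> q < d \<Longrightarrow> (\<Sum>r<d. B $$ (p, r) * B $$ (r, q)) = (\<Sum>j<d. of_real (s j * s j) * v j p * cnj (v j q))"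
proof -
  have "pos_kernel {..<d} (\<lambda>p q. \<Sum>j<d. of_real (s j) * (v j p * cnj (v j q)))"
    using assms(2) by (intro pos_kernel_sum pos_kernel_scale pos_kernel_rank1) auto
  then have "pos_kernel {..<d} (mat_kernel B)"
    by (rule pos_kernel_cong) (simp add: B_def mult.assoc)
  then show "psd d B" unfolding psd_iff_pos_kernel by (simp add: B_def)
  show "mtrace B = of_real (\<Sum>j<d. s j)"
    using onb_trace[OF assms(1), of "\<lambda>j. of_real (s j)"] by (simp add: mtrace_def B_def)
  show "(\<Sum>r<d. B $$ (p, r) * B $$ (r, q)) = (\<Sum>j<d. of_real (s j * s j) * v j p * cnj (v j q))" if "p < d" "q < d" for p q
    using onb_mult[OF assms(1), of q "\<lambda>j. of_real (s j)" p "\<lambda>j. of_real (s j)"] that by (simp add: B_def)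
qed

lemma trace_norm_svd:
  assumes A: "A \<in> carrier_mat d d"
  obtains u v and s :: "nat \<Rightarrow> real" where "onb {..<d} v" "\<forall>j<d. 0 \<le> s j"
    "\<forall>j<d. \<forall>k<d. 0 < s j \<longrightarrow> 0 < s k \<longrightarrow> inner_on {..<d} (u j) (u k) = of_bool (j = k)"
    "\<forall>j<d. \<forall>p<d. kernel_app {..<d} (mat_kernel A) (v j) p = of_real (s j) * u j p"
    "\<forall>p<d. \<forall>q<d. A $$ (p, q) = (\<Sum>j<d. of_real (s j) * u j p * cnj (v j q))"
    "trace_norm A = (\<Sum>j<d. s j)"
proof -
  obtain u v and s :: "nat \<Rightarrow> real" where h: "onb {..<d} v" "\<forall>j<d. 0 \<le> s j"
    "\<forall>j<d. \<forall>k<d. 0 < s j \<longrightarrow> 0 < s k \<longrightarrow> inner_on {..<d} (u j) (u k) = of_bool (j = k)"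
    "\<forall>j<d. \<forall>p\<in>{..<d}. kernel_app {..<d} (mat_kernel A) (v j) p = of_real (s j) * u j p"
    "\<forall>p\<in>{..<d}. \<forall>q\<in>{..<d}. A $$ (p, q) = (\<Sum>j<d. of_real (s j) * u j p * cnj (v j q))"
    "\<forall>p\<in>{..<d}. \<forall>q\<in>{..<d}. (\<Sum>r<d. cnj (A $$ (r, p)) * A $$ (r, q)) = (\<Sum>j<d. of_real (s j * s j) * v j p * cnj (v j q))"
    using svd_kernel[of "{..<d}" "mat_kernel A"] unfolding card_lessThan by (auto simp del: of_real_mult)
  define B where "B = mat d d (\<lambda>(p, q). \<Sum>j<d. of_real (s j) * v j p * cnj (v j q))"
  have s: "0 \<le> s j" if "j < d" for j using h(2) that by blast
  note B = psd_onb[where s = s, OF h(1) s, folded B_def]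
  have "trace_norm A = Re (mtrace B)"
    by (rule trace_norm_eqI[OF A B(1)]) (use B(3) h(6) in auto)
  then have "trace_norm A = (\<Sum>j<d. s j)" using B(2) by simp
  then show ?thesis using that[of v s u] h by blast
qed

lemma trace_norm_nonneg: "A \<in> carrier_mat d d \<Longrightarrow> 0 \<le> trace_norm A"
  by (erule trace_norm_svd) (auto intro: sum_nonneg)

text \<open>Trace norms are compared through positive completions of an off-diagonal block, because complete
  positivity acts directly on such completions.\<close>

lemma trace_norm_block_attained:
  assumes X: "X \<in> carrier_mat d d"
  shows "\<exists>Z. pos_kernel ({..<2::nat} \<times> {..<d}) Z \<and>
    (\<forall>p<d. \<forall>q<d. Z (0, p) (1, q) = X $$ (p, q)) \<and>
    (\<Sum>p<d. Z (0, p) (0, p)) = of_real (trace_norm X) \<and> (\<Sum>p<d. Z (1, p) (1, p)) = of_real (trace_norm X)"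
proof -
  obtain u v and s :: "nat \<Rightarrow> real" where h: "onb {..<d} v" "\<forall>j<d. 0 \<le> s j"
    "\<forall>j<d. \<forall>k<d. 0 < s j \<longrightarrow> 0 < s k \<longrightarrow> inner_on {..<d} (u j) (u k) = of_bool (j = k)"
    "\<forall>j<d. \<forall>p<d. kernel_app {..<d} (mat_kernel X) (v j) p = of_real (s j) * u j p"
    "\<forall>p<d. \<forall>q<d. X $$ (p, q) = (\<Sum>j<d. of_real (s j) * u j p * cnj (v j q))"
    "trace_norm X = (\<Sum>j<d. s j)"
    by (rule trace_norm_svd[OF X])
  \<comment> \<open>One vector per singular value, with the left singular vector in block 0 and the
    right one in block 1. Weighted by \<open>s j\<close>, their projections produce \<open>X\<close>
    in the corner and trace \<open>s j\<close> in each diagonal block.\<close>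
  define y where "y j z = (if fst z = (0::nat) then u j (snd z) else v j (snd z))" for j and z :: "nat \<times> nat"
  define Z where "Z z z' = (\<Sum>j<d. of_real (s j) * (y j z * cnj (y j z')))" for z z'
  have "pos_kernel ({..<2::nat} \<times> {..<d}) Z"
    unfolding Z_def using h(2) by (intro pos_kernel_sum pos_kernel_scale pos_kernel_rank1) auto
  moreover have "\<forall>p<d. \<forall>q<d. Z (0, p) (1, q) = X $$ (p, q)"
    using h(5) by (simp add: Z_def y_def mult.assoc)
  moreover have "(\<Sum>p<d. Z (1, p) (1, p)) = of_real (trace_norm X)"
    using onb_trace[OF h(1), of "\<lambda>j. of_real (s j)"] by (simp add: Z_def y_def h(6) mult.assoc)
  moreover have "(\<Sum>p<d. Z (0, p) (0, p)) = of_real (trace_norm X)"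
  proof -
    have "(\<Sum>p<d. Z (0, p) (0, p)) = (\<Sum>j<d. of_real (s j) * inner_on {..<d} (u j) (u j))"
      unfolding Z_def y_def inner_on_def by (subst sum.swap) (simp add: sum_distrib_left mult_ac)
    also have "\<dots> = (\<Sum>j<d. of_real (s j))"
    proof (intro sum.cong refl)
      fix j assume "j \<in> {..<d}"
      then have j: "j < d" by simp
      then have "s j = 0 \<or> 0 < s j" using h(2) by fastforce
      then show "of_real (s j) * inner_on {..<d} (u j) (u j) = of_real (s j)" using h(3) j by auto
    qed
    finally show ?thesis by (simp add: h(6))
  qed
  ultimately show ?thesis by blast
qed

text \<open>Testing the completion on \<open>u j\<close> in block 0 and \<open>- v j\<close> in
  block 1 bounds \<open>2 * s j\<close> by the two diagonal forms, and Bessel's inequality adds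
  these up to the two traces. With the attained case, the trace norm is the least mean of the
  diagonal traces over all completions.\<close>

lemma trace_norm_block_le:
  assumes Y: "Y \<in> carrier_mat d d" and Z: "pos_kernel ({..<2::nat} \<times> {..<d}) Z"
    and off: "\<And>p q. p < d \<Longrightarrow> q < d \<Longrightarrow> Z (0, p) (1, q) = Y $$ (p, q)"
  shows "trace_norm Y \<le> (Re (\<Sum>p<d. Z (0, p) (0, p)) + Re (\<Sum>p<d. Z (1, p) (1, p))) / 2"
proof -
  obtain u v and s :: "nat \<Rightarrow> real" where h: "onb {..<d} v" "\<forall>j<d. 0 \<le> s j"
    "\<forall>j<d. \<forall>k<d. 0 < s j \<longrightarrow> 0 < s k \<longrightarrow> inner_on {..<d} (u j) (u k) = of_bool (j = k)"
    "\<forall>j<d. \<forall>p<d. kernel_app {..<d} (mat_kernel Y) (v j) p = of_real (s j) * u j p"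
    "\<forall>p<d. \<forall>q<d. Y $$ (p, q) = (\<Sum>j<d. of_real (s j) * u j p * cnj (v j q))"
    "trace_norm Y = (\<Sum>j<d. s j)"
    by (rule trace_norm_svd[OF Y])
  \<comment> \<open>Bessel's inequality applies to normalised left vectors, and these belong to the
    positive singular values.\<close>
  define J where "J = {j. j < d \<and> 0 < s j}"
  define Z0 where "Z0 p q = Z (0, p) (0, q)" for p q
  define Z1 where "Z1 p q = Z (1, p) (1, q)" for p q
  have fin: "finite ({..<2::nat} \<times> {..<d})" by simp
  have pos: "pos_kernel {..<d} Z0" "pos_kernel {..<d} Z1"
    unfolding Z0_def Z1_def
    by (rule pos_kernel_pullback[OF fin Z, of "\<lambda>p. (0, p)"], force)
       (rule pos_kernel_pullback[OF fin Z, of "\<lambda>p. (1, p)"], force)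
  have two: "{..<2::nat} = {0, 1}" by auto
  have each: "2 * s j \<le> Re (sform {..<d} Z0 (u j) (u j)) + Re (sform {..<d} Z1 (v j) (v j))" if "j \<in> J" for j
  proof -
    have j: "j < d" "0 < s j" using that by (auto simp: J_def)
    define x where "x z = (if fst z = (0::nat) then u j (snd z) else - v j (snd z))" for z :: "nat \<times> nat"
    define c where "c = sform {..<d} (mat_kernel Y) (u j) (v j)"
    have hc: "Z (1, q) (0, p) = cnj (Y $$ (p, q))" if "p < d" "q < d" for p q
    proof -
      have "(0, p) \<in> {..<2::nat} \<times> {..<d}" "(1, q) \<in> {..<2::nat} \<times> {..<d}" using that by auto
      then have "Z (1, q) (0, p) = cnj (Z (0, p) (1, q))"
        using pos_kernel_herm[OF fin Z] unfolding herm_kernel_def by blast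
      then show ?thesis using off that by simp
    qed
    have "c = inner_on {..<d} (u j) (\<lambda>p. of_real (s j) * u j p)"
      unfolding c_def sform_inner inner_on_def using h(4) j by (intro sum.cong refl) simp
    also have "\<dots> = of_real (s j)" using h(3) j by (simp add: inner_on_scale_right)
    finally have c: "c = of_real (s j)" .
    have c2: "c = (\<Sum>p<d. \<Sum>q<d. cnj (u j p) * Z (0, p) (1, q) * v j q)"
      unfolding c_def sform_def using off by (intro sum.cong refl) simp
    have c': "(\<Sum>p<d. \<Sum>q<d. cnj (v j p) * Z (1, p) (0, q) * u j q) = cnj c"
      unfolding c_def sform_def by (subst sum.swap) (simp add: hc[unfolded One_nat_def] mult_ac)
    have "sform ({..<2::nat} \<times> {..<d}) Z x x =
       (\<Sum>e<2. \<Sum>p<d. \<Sum>f<2. \<Sum>q<d. cnj (x (e, p)) * Z (e, p) (f, q) * x (f, q))"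
      unfolding sform_def sum.cartesian_product' ..
    also have "\<dots> = sform {..<d} Z0 (u j) (u j) - c - cnj c + sform {..<d} Z1 (v j) (v j)"
      unfolding two c'[symmetric] unfolding c2 sform_def x_def Z0_def Z1_def
      by (simp add: sum.distrib sum_negf sum_subtractf)
    finally have "0 \<le> Re (sform {..<d} Z0 (u j) (u j) - c - cnj c + sform {..<d} Z1 (v j) (v j))"
      using Z unfolding pos_kernel_def less_eq_complex_def by (metis zero_complex.sel(1))
    then show ?thesis by (simp add: c)
  qed
  have "2 * trace_norm Y = (\<Sum>j\<in>J. 2 * s j)"
  proof -
    have "(\<Sum>j<d. s j) = (\<Sum>j\<in>J. s j)"
    proof (rule sum.mono_neutral_right)
      show "\<forall>j\<in>{..<d} - J. s j = 0" using h(2) by (auto simp: J_def intro: antisym)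
    qed (auto simp: J_def)
    then show ?thesis by (simp add: h(6) sum_distrib_left)
  qed
  also have "\<dots> \<le> (\<Sum>j\<in>J. Re (sform {..<d} Z0 (u j) (u j)) + Re (sform {..<d} Z1 (v j) (v j)))"
    using each by (rule sum_mono)
  also have "\<dots> = Re (\<Sum>j\<in>J. sform {..<d} Z0 (u j) (u j)) + Re (\<Sum>j\<in>J. sform {..<d} Z1 (v j) (v j))"
    by (simp add: sum.distrib)
  also have "\<dots> \<le> Re (\<Sum>p<d. Z0 p p) + Re (\<Sum>p<d. Z1 p p)"
  proof (rule add_mono)
    have fJ: "finite J" by (simp add: J_def)
    show "Re (\<Sum>j\<in>J. sform {..<d} Z0 (u j) (u j)) \<le> Re (\<Sum>p<d. Z0 p p)"
      by (rule bessel_pos_kernel[OF _ pos(1) _ fJ]) (use h(3) in \<open>auto simp: J_def\<close>)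
    show "Re (\<Sum>j\<in>J. sform {..<d} Z1 (v j) (v j)) \<le> Re (\<Sum>p<d. Z1 p p)"
      by (rule bessel_pos_kernel[OF _ pos(2) _ fJ]) (use h(1) in \<open>auto simp: J_def onb_def\<close>)
  qed
  finally show ?thesis by (simp add: Z0_def Z1_def)
qed

text \<open>A test between 0 and 1 collects at most the positive eigenvalues. As all eigenvalues add
  up to zero, the positive ones make up half of the sum of absolute values.\<close>

lemma trace_norm_traceless_pair:
  assumes D: "D \<in> carrier_mat d d" and herm: "herm_kernel {..<d} (mat_kernel D)" and tr: "mtrace D = 0"
    and T: "pos_kernel {..<d} T" and T1: "pos_kernel {..<d} (\<lambda>p q. of_bool (p = q) - T p q)"
  shows "Re (kernel_pair {..<d} T (mat_kernel D)) \<le> trace_norm D / 2"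
proof -
  obtain v a where v: "onb {..<d} v"
    and Dv: "\<forall>p\<in>{..<d}. \<forall>q\<in>{..<d}. D $$ (p, q) = (\<Sum>j<d. of_real (a j) * v j p * cnj (v j q))"
    using spectral_kernel[OF _ herm] by auto
  define B where "B = mat d d (\<lambda>(p, q). \<Sum>j<d. of_real \<bar>a j\<bar> * v j p * cnj (v j q))"
  note B = psd_onb[where s = "\<lambda>j. \<bar>a j\<bar>", OF v abs_ge_zero, folded B_def]
  have "trace_norm D = Re (mtrace B)"
  proof (rule trace_norm_eqI[OF D B(1)])
    fix p q assume pq: "p < d" "q < d"
    have "(\<Sum>r<d. cnj (D $$ (r, p)) * D $$ (r, q)) = (\<Sum>r<d. D $$ (p, r) * D $$ (r, q))"
      using herm pq unfolding herm_kernel_def by (intro sum.cong refl) (metis lessThan_iff)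
    also have "\<dots> = (\<Sum>j<d. of_real (a j * a j) * v j p * cnj (v j q))"
      using onb_mult[OF v, of q "\<lambda>j. of_real (a j)" p "\<lambda>j. of_real (a j)"] pq Dv by simp
    finally show "(\<Sum>r<d. B $$ (p, r) * B $$ (r, q)) = (\<Sum>r<d. cnj (D $$ (r, p)) * D $$ (r, q))"
      using B(3)[OF pq] by simp
  qed
  then have tn: "trace_norm D = (\<Sum>j<d. \<bar>a j\<bar>)" using B(2) by simp
  have "complex_of_real (\<Sum>j<d. a j) = 0"
    using tr onb_trace[OF v, of "\<lambda>j. of_real (a j)"] Dv by (simp add: mtrace_carrier[OF D])
  then have sum0: "(\<Sum>j<d. a j) = 0" by (simp only: of_real_eq_0_iff)
  define t where "t j = Re (kernel_pair {..<d} T (\<lambda>p q. v j p * cnj (v j q)))" for j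
  have t: "0 \<le> t j" "t j \<le> 1" if "j < d" for j
  proof -
    have fin: "finite {..<d}" by simp
    show "0 \<le> t j" unfolding t_def
      using kernel_pair_nonneg[OF fin T pos_kernel_rank1] by (simp add: less_eq_complex_def)
    have "Re (kernel_pair {..<d} (\<lambda>p q. v j p * cnj (v j q)) T) \<le> Re (kernel_pair {..<d} (\<lambda>p q. v j p * cnj (v j q)) (\<lambda>p q. of_bool (p = q)))"
      by (rule kernel_pair_mono[OF fin pos_kernel_rank1 T1])
    also have "\<dots> = Re (inner_on {..<d} (v j) (v j))"
      unfolding kernel_pair_delta[OF fin] by (simp add: inner_on_def mult.commute)
    also have "\<dots> = 1" using v that by (simp add: onb_def)
    finally show "t j \<le> 1" unfolding t_def kernel_pair_commute[of _ T] .
  qed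
  have "kernel_pair {..<d} T (mat_kernel D) = (\<Sum>p<d. \<Sum>q<d. \<Sum>j<d. of_real (a j) * (T p q * (v j p * cnj (v j q))))"
    unfolding kernel_pair_def using Dv by (intro sum.cong refl) (simp add: sum_distrib_left mult_ac)
  also have "\<dots> = (\<Sum>j<d. of_real (a j) * kernel_pair {..<d} T (\<lambda>p q. v j p * cnj (v j q)))"
    unfolding kernel_pair_def sum_distrib_left by (rule sum_swap3)
  finally have "Re (kernel_pair {..<d} T (mat_kernel D)) = (\<Sum>j<d. a j * t j)" by (simp add: t_def)
  also have "\<dots> \<le> (\<Sum>j<d. (\<bar>a j\<bar> + a j) / 2)"
  proof (rule sum_mono)
    fix j assume "j \<in> {..<d}"
    then have "0 \<le> t j" "t j \<le> 1" using t by auto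
    then show "a j * t j \<le> (\<bar>a j\<bar> + a j) / 2"
      by (cases "a j \<ge> 0") (auto simp: mult_left_le mult_nonpos_nonneg)
  qed
  also have "\<dots> = trace_norm D / 2"
    using sum0 by (simp add: tn sum.distrib flip: sum_divide_distrib)
  finally show ?thesis .
qed

section \<open>Choi kernels\<close>

lemma pair_index_less: "i < r \<Longrightarrow> a < n \<Longrightarrow> i * n + a < r * (n :: nat)"
proof -
  assume "i < r" "a < n"
  then have "i * n + a < Suc i * n" by simp
  also have "\<dots> \<le> r * n" using \<open>i < r\<close> by (intro mult_le_mono1) simp
  finally show ?thesis .
qed

lemma div_mod_less:
  assumes "p < r * (n :: nat)"
  shows "p div n < r" "p mod n < n"
proof -
  have "n > 0" using assms by (cases n) auto
  then show "p div n < r" "p mod n < n" using assms by (auto simp: less_mult_imp_div_less)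
qed

lemma sum_pair_index: "(\<Sum>p<r * n. f p) = (\<Sum>z\<in>grid r n. f (fst z * n + snd z :: nat))"
  by (rule sum.reindex_bij_witness[where i = "\<lambda>z. fst z * n + snd z" and j = "\<lambda>p. (p div n, p mod n)"])
     (auto simp: div_mod_less pair_index_less)

definition bip_kernel :: "nat \<Rightarrow> complex mat \<Rightarrow> nat \<times> nat \<Rightarrow> nat \<times> nat \<Rightarrow> complex" where
  "bip_kernel n A p q = A $$ (fst p * n + snd p, fst q * n + snd q)"

lemma bip_kernel_div_mod: "bip_kernel n A (p div n, p mod n) (q div n, q mod n) = A $$ (p, q)"
  by (simp add: bip_kernel_def)

lemma psd_bip_kernel: "psd (r * n) A \<Longrightarrow> pos_kernel (grid r n) (bip_kernel n A)"
  unfolding psd_iff_pos_kernel bip_kernel_def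
  by (rule pos_kernel_pullback[of "{..<r * n}" "mat_kernel A" "\<lambda>p. fst p * n + snd p"]) (auto simp: pair_index_less)

lemma psd_of_kernel:
  assumes "A \<in> carrier_mat (r * n) (r * n)" "pos_kernel (grid r n) C"
    "\<And>p q. p < r * n \<Longrightarrow> q < r * n \<Longrightarrow> A $$ (p, q) = C (p div n, p mod n) (q div n, q mod n)"
  shows "psd (r * n) A"
proof -
  have "pos_kernel {..<r * n} (\<lambda>p q. C (p div n, p mod n) (q div n, q mod n))"
    by (rule pos_kernel_pullback[OF _ assms(2)]) (auto simp: div_mod_less)
  then have "pos_kernel {..<r * n} (mat_kernel A)" by (rule pos_kernel_cong) (use assms(3) in auto)
  then show ?thesis using assms(1) by (simp add: psd_iff_pos_kernel)
qed

lemma mtrace_mult: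
  assumes "A \<in> carrier_mat d d" "B \<in> carrier_mat d d"
  shows "mtrace (A * B) = (\<Sum>p<d. \<Sum>q<d. A $$ (p, q) * B $$ (q, p))"
proof -
  have "A * B \<in> carrier_mat d d" using assms by simp
  then show ?thesis by (simp add: mtrace_carrier mat_mult_index[OF assms] del: index_mult_mat)
qed

lemma mtrace_mult_bip_kernel:
  assumes "A \<in> carrier_mat (r * n) (r * n)" "B \<in> carrier_mat (r * n) (r * n)"
  shows "mtrace (A * B) = kernel_pair (grid r n) (bip_kernel n A) (\<lambda>p q. bip_kernel n B q p)"
  unfolding mtrace_mult[OF assms] kernel_pair_def sum_pair_index bip_kernel_def ..

lemma mtrace_bip_kernel: "A \<in> carrier_mat (r * n) (r * n) \<Longrightarrow> mtrace A = (\<Sum>p\<in>grid r n. bip_kernel n A p p)"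
  by (simp add: mtrace_carrier sum_pair_index bip_kernel_def)

lemma mtrace_adjoint_mult:
  assumes "A \<in> carrier_mat d d" "B \<in> carrier_mat d d"
  shows "mtrace (mat_adjoint A * B) = (\<Sum>l<d. \<Sum>k<d. cnj (A $$ (l, k)) * B $$ (l, k))"
  unfolding mtrace_mult[OF mat_adjoint_carrier[OF assms(1)] assms(2)]
  by (subst sum.swap) (simp add: mat_adjoint_index[OF assms(1)])

text \<open>The Choi matrix with the input factor first, matching operators on \<open>R0\<close> and
  \<open>B\<close> for a map from \<open>R0\<close> to \<open>B\<close>; \<open>choi\<close> puts
  the output first.\<close>

definition choi_kernel :: "nat \<Rightarrow> cmap \<Rightarrow> nat \<times> nat \<Rightarrow> nat \<times> nat \<Rightarrow> complex" where
  "choi_kernel d \<phi> p q = \<phi> (munit d (fst p) (fst q)) $$ (snd p, snd q)"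

text \<open>Choi's criterion: positivity expresses complete positivity, and the partial trace over
  the output expresses trace preservation.\<close>

definition chan_kernel :: "nat \<Rightarrow> nat \<Rightarrow> (nat \<times> nat \<Rightarrow> nat \<times> nat \<Rightarrow> complex) \<Rightarrow> bool" where
  "chan_kernel r n c \<longleftrightarrow> pos_kernel (grid r n) c \<and>
     (\<forall>i<r. \<forall>j<r. (\<Sum>a<n. c (i, a) (j, a)) = of_bool (i = j))"

definition map_of_kernel :: "nat \<Rightarrow> nat \<Rightarrow> (nat \<times> nat \<Rightarrow> nat \<times> nat \<Rightarrow> complex) \<Rightarrow> cmap" where
  "map_of_kernel r n c X = mat n n (\<lambda>(a, b). \<Sum>i<r. \<Sum>j<r. X $$ (i, j) * c (i, a) (j, b))"

text \<open>Arguments come in order of application: the map of \<open>c\<close> acts first, the map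
  of \<open>d\<close> on its output.\<close>

definition kernel_comp :: "nat \<Rightarrow> (nat \<times> nat \<Rightarrow> nat \<times> nat \<Rightarrow> complex) \<Rightarrow>
    (nat \<times> nat \<Rightarrow> nat \<times> nat \<Rightarrow> complex) \<Rightarrow> nat \<times> nat \<Rightarrow> nat \<times> nat \<Rightarrow> complex" where
  "kernel_comp m c d p q = (\<Sum>x<m. \<Sum>y<m. c (fst p, x) (fst q, y) * d (x, snd p) (y, snd q))"

lemma munit_carrier [simp]: "munit d i j \<in> carrier_mat d d"
  by (simp add: munit_def)

lemma sum_munit:
  assumes "i < d" "j < d"
  shows "(\<Sum>x<d. \<Sum>y<d. munit d i j $$ (x, y) * f x y) = f i j"
proof -
  have "(\<Sum>x<d. \<Sum>y<d. munit d i j $$ (x, y) * f x y) =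
      (\<Sum>x<d. \<Sum>y<d. if y = j then if x = i then f i j else 0 else 0)"
    by (intro sum.cong refl) (auto simp: munit_def)
  then show ?thesis using assms by simp
qed

text \<open>A map is a HOL function that is linear on the carrier only, so the expansion in matrix
  units is an induction over the set of retained entries, starting from the zero matrix written as
  \<open>0 \<cdot>\<^sub>m X\<close>.\<close>

lemma lin_map_expand:
  assumes lin: "lin_map r n \<phi>" and X: "X \<in> carrier_mat r r" and ab: "a < n" "b < n"
  shows "\<phi> X $$ (a, b) = (\<Sum>i<r. \<Sum>j<r. X $$ (i, j) * choi_kernel r \<phi> (i, a) (j, b))"
proof -
  define XS where "XS S = mat r r (\<lambda>z. if z \<in> S then X $$ z else 0)" for S
  have car: "XS S \<in> carrier_mat r r" for S by (simp add: XS_def)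
  have add: "\<phi> (A + B) = \<phi> A + \<phi> B" if "A \<in> carrier_mat r r" "B \<in> carrier_mat r r" for A B
    using lin that by (simp add: lin_map_def)
  have scale: "\<phi> (c \<cdot>\<^sub>m A) = c \<cdot>\<^sub>m \<phi> A" if "A \<in> carrier_mat r r" for A c
    using lin that by (simp add: lin_map_def)
  have out: "\<phi> A \<in> carrier_mat n n" if "A \<in> carrier_mat r r" for A
    using lin that by (simp add: lin_map_def)
  have "\<phi> (XS S) $$ (a, b) = (\<Sum>z\<in>S. X $$ z * choi_kernel r \<phi> (fst z, a) (snd z, b))"
    if "finite S" "S \<subseteq> grid r r" for S
    using that
  proof (induction S rule: finite_induct)
    case empty
    have "XS {} = 0 \<cdot>\<^sub>m X" using X by (intro eq_matI) (auto simp: XS_def)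
    then have "\<phi> (XS {}) = 0 \<cdot>\<^sub>m \<phi> X" using scale X by simp
    then show ?case using out[OF X] ab by simp
  next
    case (insert z S)
    obtain i j where z: "z = (i, j)" by (cases z)
    have "XS (insert z S) = XS S + X $$ z \<cdot>\<^sub>m munit r i j"
      using insert.hyps insert.prems X by (intro eq_matI) (auto simp: XS_def munit_def z)
    then have "\<phi> (XS (insert z S)) = \<phi> (XS S) + X $$ z \<cdot>\<^sub>m \<phi> (munit r i j)"
      using add[OF car] scale by simp
    then have "\<phi> (XS (insert z S)) $$ (a, b) = \<phi> (XS S) $$ (a, b) + X $$ z * \<phi> (munit r i j) $$ (a, b)"
      using out[OF car, of S] out[of "munit r i j"] ab by simp
    then show ?case using insert by (simp add: choi_kernel_def z)
  qed
  from this[of "grid r r"]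
  have "\<phi> (XS (grid r r)) $$ (a, b) = (\<Sum>i<r. \<Sum>j<r. X $$ (i, j) * choi_kernel r \<phi> (i, a) (j, b))"
    by (simp add: sum.cartesian_product')
  moreover have "XS (grid r r) = X" using X by (intro eq_matI) (auto simp: XS_def)
  ultimately show ?thesis by simp
qed

lemma max_ent_block: "x < d \<Longrightarrow> y < d \<Longrightarrow> mat d d (\<lambda>(i, j). max_ent d $$ (x * d + i, y * d + j)) = munit d x y"
  by (intro eq_matI) (auto simp: max_ent_def munit_def pair_index_less)

lemma max_ent_block': "x < d \<Longrightarrow> y < d \<Longrightarrow> mat d d (\<lambda>(i, j). max_ent d $$ (i * d + x, j * d + y)) = munit d x y"
  by (intro eq_matI) (auto simp: max_ent_def munit_def pair_index_less)

lemma psd_max_ent: "psd (d * d) (max_ent d)"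
proof -
  have "pos_kernel {..<d * d} (\<lambda>p q. of_bool (p div d = p mod d) * cnj (of_bool (q div d = q mod d)))"
    by (rule pos_kernel_rank1)
  then have "pos_kernel {..<d * d} (mat_kernel (max_ent d))"
    by (rule pos_kernel_cong) (auto simp: max_ent_def)
  then show ?thesis by (simp add: psd_iff_pos_kernel max_ent_def)
qed

lemma mtrace_munit: "i < d \<Longrightarrow> mtrace (munit d i j) = of_bool (i = j)"
  by (simp add: mtrace_def munit_def if_distrib cong: if_cong)

lemma channel_chan_kernel:
  assumes ch: "channel r n \<phi>"
  shows "chan_kernel r n (choi_kernel r \<phi>)"
proof (cases "r = 0")
  case True
  then show ?thesis by (simp add: chan_kernel_def pos_kernel_def sform_def)
next
  case False
  \<comment> \<open>An ancilla as large as the input, maximally entangled with it, turns the image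
    into the Choi kernel. Complete positivity speaks of ancillas of positive dimension, hence the
    separate case \<open>r = 0\<close>.\<close>
  have "psd (r * n) (id_tensor r r n \<phi> (max_ent r))"
    using ch psd_max_ent False by (simp add: channel_def CP_map_def)
  then have "pos_kernel (grid r n) (bip_kernel n (id_tensor r r n \<phi> (max_ent r)))" by (rule psd_bip_kernel)
  then have 1: "pos_kernel (grid r n) (choi_kernel r \<phi>)"
    by (rule pos_kernel_cong) (auto simp: bip_kernel_def id_tensor_def pair_index_less max_ent_block choi_kernel_def)
  have "(\<Sum>a<n. choi_kernel r \<phi> (i, a) (j, a)) = of_bool (i = j)" if "i < r" "j < r" for i j
  proof -
    have "\<phi> (munit r i j) \<in> carrier_mat n n" using ch by (simp add: channel_def lin_map_def)
    then have "(\<Sum>a<n. choi_kernel r \<phi> (i, a) (j, a)) = mtrace (\<phi> (munit r i j))"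
      by (simp add: mtrace_carrier choi_kernel_def)
    also have "\<dots> = mtrace (munit r i j)" using ch by (simp add: channel_def TP_map_def)
    finally show ?thesis using mtrace_munit that by simp
  qed
  with 1 show ?thesis by (simp add: chan_kernel_def)
qed

lemma map_of_kernel_carrier [simp]: "map_of_kernel r n c X \<in> carrier_mat n n"
  by (simp add: map_of_kernel_def)

lemma map_of_kernel_lin: "lin_map r n (map_of_kernel r n c)"
  unfolding lin_map_def
proof (intro conjI ballI allI)
  fix A B :: "complex mat" assume A: "A \<in> carrier_mat r r" and B: "B \<in> carrier_mat r r"
  show "map_of_kernel r n c (A + B) = map_of_kernel r n c A + map_of_kernel r n c B"
    using A B by (intro eq_matI) (auto simp: map_of_kernel_def distrib_right sum.distrib)
next
  fix A :: "complex mat" and k assume A: "A \<in> carrier_mat r r"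
  show "map_of_kernel r n c (k \<cdot>\<^sub>m A) = k \<cdot>\<^sub>m map_of_kernel r n c A"
    using A by (intro eq_matI) (auto simp: map_of_kernel_def mult.assoc sum_distrib_left)
qed simp

text \<open>The converse half of Choi's criterion, for any ancilla: the output is the contraction of
  \<open>P\<close> with \<open>c\<close> over the input system.\<close>

lemma id_tensor_kernel_psd:
  assumes c: "pos_kernel (grid r n) c" and P: "psd (m * r) P"
    and out: "\<And>X a b. X \<in> carrier_mat r r \<Longrightarrow> a < n \<Longrightarrow> b < n \<Longrightarrow>
      \<phi> X $$ (a, b) = (\<Sum>i<r. \<Sum>j<r. X $$ (i, j) * c (i, a) (j, b))"
  shows "psd (m * n) (id_tensor m r n \<phi> P)"
proof (rule psd_of_kernel)
  show "id_tensor m r n \<phi> P \<in> carrier_mat (m * n) (m * n)" by (simp add: id_tensor_def)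
  have 1: "pos_kernel (grid r m) (\<lambda>p q. bip_kernel r P (snd p, fst p) (snd q, fst q))"
    by (rule pos_kernel_pullback[OF _ psd_bip_kernel[OF P]]) auto
  have "pos_kernel (grid n m) (\<lambda>p q. \<Sum>i<r. \<Sum>j<r. bip_kernel r P (snd p, i) (snd q, j) * c (i, fst p) (j, fst q))"
    using pos_kernel_contract[OF _ _ _ 1 c] by simp
  from pos_kernel_pullback[OF _ this, of "\<lambda>p. (snd p, fst p)" "grid m n"]
  show "pos_kernel (grid m n) (\<lambda>p q. \<Sum>i<r. \<Sum>j<r. bip_kernel r P (fst p, i) (fst q, j) * c (i, snd p) (j, snd q))"
    by force
  show "id_tensor m r n \<phi> P $$ (p, q) =
     (\<Sum>i<r. \<Sum>j<r. bip_kernel r P (fst (p div n, p mod n), i) (fst (q div n, q mod n), j) *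
        c (i, snd (p div n, p mod n)) (j, snd (q div n, q mod n)))"
    if "p < m * n" "q < m * n" for p q
    using that by (simp add: id_tensor_def out div_mod_less bip_kernel_def)
qed

lemma chan_kernel_channel:
  assumes c: "chan_kernel r n c"
  shows "channel r n (map_of_kernel r n c)"
  unfolding channel_def
proof (intro conjI)
  show "lin_map r n (map_of_kernel r n c)" by (rule map_of_kernel_lin)
  show "CP_map r n (map_of_kernel r n c)"
    unfolding CP_map_def using c
    by (auto simp: chan_kernel_def map_of_kernel_def intro!: id_tensor_kernel_psd)
  show "TP_map r n (map_of_kernel r n c)"
    unfolding TP_map_def
  proof
    fix X :: "complex mat" assume X: "X \<in> carrier_mat r r"
    have "mtrace (map_of_kernel r n c X) = (\<Sum>a<n. \<Sum>i<r. \<Sum>j<r. X $$ (i, j) * c (i, a) (j, a))"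
      by (simp add: mtrace_def map_of_kernel_def)
    also have "\<dots> = (\<Sum>i<r. \<Sum>j<r. \<Sum>a<n. X $$ (i, j) * c (i, a) (j, a))"
      by (rule sum_swap3[symmetric])
    also have "\<dots> = (\<Sum>i<r. \<Sum>j<r. X $$ (i, j) * of_bool (i = j))"
      using c by (simp add: chan_kernel_def flip: sum_distrib_left)
    also have "\<dots> = mtrace X" using X by (simp add: mtrace_carrier of_bool_def if_distrib cong: if_cong)
    finally show "mtrace (map_of_kernel r n c X) = mtrace X" .
  qed
qed

lemma choi_kernel_map_of_kernel:
  assumes "p \<in> grid r n" "q \<in> grid r n"
  shows "choi_kernel r (map_of_kernel r n c) p q = c p q"
proof -
  obtain i a j b where pq: "p = (i, a)" "q = (j, b)" "i < r" "j < r" "a < n" "b < n" using assms by auto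
  have "choi_kernel r (map_of_kernel r n c) p q = (\<Sum>x<r. \<Sum>y<r. munit r i j $$ (x, y) * c (x, a) (y, b))"
    using pq by (simp add: choi_kernel_def map_of_kernel_def)
  also have "\<dots> = c p q" using pq by (simp add: sum_munit)
  finally show ?thesis .
qed

lemma kernel_comp_pos:
  assumes c: "pos_kernel (grid r m) c" and d: "pos_kernel (grid m n) d"
  shows "pos_kernel (grid r n) (kernel_comp m c d)"
proof -
  have 1: "pos_kernel (grid m r) (\<lambda>p q. c (snd p, fst p) (snd q, fst q))"
    by (rule pos_kernel_pullback[OF _ c]) auto
  show ?thesis
    by (rule pos_kernel_cong[OF pos_kernel_contract[OF _ _ _ d 1]]) (auto simp: kernel_comp_def mult.commute)
qed

lemma kernel_comp_partial_trace:
  assumes "\<And>x y. x < m \<Longrightarrow> y < m \<Longrightarrow> (\<Sum>a<n. d (x, a) (y, a)) = t * of_bool (x = y)"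
  shows "(\<Sum>a<n. kernel_comp m c d (i, a) (j, a)) = t * (\<Sum>x<m. c (i, x) (j, x))"
proof -
  have "(\<Sum>a<n. kernel_comp m c d (i, a) (j, a)) = (\<Sum>x<m. \<Sum>y<m. \<Sum>a<n. c (i, x) (j, y) * d (x, a) (y, a))"
    unfolding kernel_comp_def fst_conv snd_conv by (rule sum_swap3[symmetric])
  also have "\<dots> = (\<Sum>x<m. \<Sum>y<m. c (i, x) (j, y) * (t * of_bool (x = y)))"
    using assms by (simp flip: sum_distrib_left)
  also have "\<dots> = (\<Sum>x<m. \<Sum>y<m. if y = x then t * c (i, x) (j, x) else 0)"
    by (intro sum.cong refl) auto
  finally show ?thesis by (simp add: sum_distrib_left)
qed

lemma chan_kernel_comp:
  assumes c: "chan_kernel r m c" and d: "chan_kernel m n d"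
  shows "chan_kernel r n (kernel_comp m c d)"
proof -
  have "(\<Sum>a<n. kernel_comp m c d (i, a) (j, a)) = of_bool (i = j)" if "i < r" "j < r" for i j
    using kernel_comp_partial_trace[where m = m and n = n and d = d and t = 1 and c = c and i = i and j = j] c d that by (simp add: chan_kernel_def)
  then show ?thesis using kernel_comp_pos c d by (simp add: chan_kernel_def)
qed

lemma lin_map_comp: "lin_map r m \<alpha> \<Longrightarrow> lin_map m n \<phi> \<Longrightarrow> lin_map r n (\<lambda>X. \<phi> (\<alpha> X))"
  unfolding lin_map_def by simp

lemma choi_kernel_comp:
  assumes "lin_map r m \<alpha>" "lin_map m n \<phi>" "p \<in> grid r n" "q \<in> grid r n"
  shows "choi_kernel r (\<lambda>X. \<phi> (\<alpha> X)) p q = kernel_comp m (choi_kernel r \<alpha>) (choi_kernel m \<phi>) p q"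
proof -
  obtain i a j b where pq: "p = (i, a)" "q = (j, b)" "i < r" "j < r" "a < n" "b < n" using assms(3,4) by auto
  have "\<alpha> (munit r i j) \<in> carrier_mat m m"
    using assms(1) by (simp add: lin_map_def)
  from lin_map_expand[OF assms(2) this pq(5,6)] show ?thesis by (simp add: kernel_comp_def choi_kernel_def pq)
qed

lemma channel_lin: "channel r n \<phi> \<Longrightarrow> lin_map r n \<phi>"
  by (simp add: channel_def)

lemma chan_kernel_herm:
  assumes "chan_kernel r n c" "p \<in> grid r n" "q \<in> grid r n"
  shows "cnj (c q p) = c p q"
proof -
  have "herm_kernel (grid r n) c"
    using assms(1) by (intro pos_kernel_herm) (auto simp: chan_kernel_def)
  then show ?thesis using assms(2,3) unfolding herm_kernel_def by (metis complex_cnj_cnj)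
qed

lemma hs_adj_index:
  assumes "lin_map r n \<phi>" "Z \<in> carrier_mat n n" "i < r" "j < r"
  shows "hs_adj r n \<phi> Z $$ (i, j) = (\<Sum>l<n. \<Sum>k<n. cnj (choi_kernel r \<phi> (i, l) (j, k)) * Z $$ (l, k))"
proof -
  have "\<phi> (munit r i j) \<in> carrier_mat n n" using assms(1) by (simp add: lin_map_def)
  from mtrace_adjoint_mult[OF this assms(2)] show ?thesis
    using assms(3,4) by (simp add: hs_adj_def choi_kernel_def)
qed

text \<open>The adjoint conjugates the Choi kernel, while its Choi matrix and the trace exchange
  rows and columns; hermiticity makes these operations cancel.\<close>

lemma pairing_kernel:
  assumes \<alpha>: "channel r n \<alpha>" and X: "X \<in> carrier_mat (r * n) (r * n)"
  shows "pairing r n X \<alpha> = kernel_pair (grid r n) (bip_kernel n X) (choi_kernel r \<alpha>)"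
proof -
  have car: "choi n r (hs_adj r n \<alpha>) \<in> carrier_mat (r * n) (r * n)"
    by (simp add: choi_def tensor_id_def)
  have choi: "bip_kernel n (choi n r (hs_adj r n \<alpha>)) q p = choi_kernel r \<alpha> p q"
    if pq: "p \<in> grid r n" "q \<in> grid r n" for p q
  proof -
    obtain i a j b where pq': "p = (i, a)" "q = (j, b)" "i < r" "j < r" "a < n" "b < n" using pq by auto
    have "bip_kernel n (choi n r (hs_adj r n \<alpha>)) q p = hs_adj r n \<alpha> (munit n b a) $$ (j, i)"
      using pq' by (simp add: bip_kernel_def choi_def tensor_id_def pair_index_less max_ent_block')
    also have "\<dots> = (\<Sum>l<n. \<Sum>k<n. cnj (choi_kernel r \<alpha> (j, l) (i, k)) * munit n b a $$ (l, k))"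
      by (rule hs_adj_index[OF channel_lin[OF \<alpha>]]) (use pq' in auto)
    also have "\<dots> = cnj (choi_kernel r \<alpha> q p)" using pq' by (simp add: sum_munit mult.commute[of "cnj _"])
    also have "\<dots> = choi_kernel r \<alpha> p q" by (rule chan_kernel_herm[OF channel_chan_kernel[OF \<alpha>] pq])
    finally show ?thesis .
  qed
  show ?thesis unfolding pairing_def mtrace_mult_bip_kernel[OF X car]
    by (rule kernel_pair_cong) (auto simp: choi)
qed

lemma kernel_pair_prod:
  "kernel_pair (R \<times> S) A C = (\<Sum>i\<in>R. \<Sum>j\<in>R. \<Sum>a\<in>S. \<Sum>b\<in>S. A (i, a) (j, b) * C (i, a) (j, b))"
  unfolding kernel_pair_def sum.cartesian_product' by (intro sum.cong refl sum.swap)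

lemma sum_swap4:
  "(\<Sum>x\<in>A. \<Sum>y\<in>B. \<Sum>k\<in>C. \<Sum>l\<in>D. f x y k l) = (\<Sum>k\<in>C. \<Sum>l\<in>D. \<Sum>x\<in>A. \<Sum>y\<in>B. (f x y k l :: 'a :: comm_monoid_add))"
  by (subst sum_swap3, intro sum.cong refl, rule sum_swap3)

text \<open>Moving the transposed map off \<rho> leaves \<open>\<phi>\<close> after
  \<open>\<alpha>\<close>: hermiticity turns the conjugated kernel of the adjoint into one with rows
  and columns exchanged, and the two transposes exchange them back.\<close>

lemma pairing_transp:
  assumes \<alpha>: "channel r m \<alpha>" and \<phi>: "channel m n \<phi>" and \<rho>: "\<rho> \<in> carrier_mat (r * n) (r * n)"
  shows "pairing r m (id_tensor r n m (map_transp m n \<phi>) \<rho>) \<alpha> =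
    kernel_pair (grid r n) (bip_kernel n \<rho>) (kernel_comp m (choi_kernel r \<alpha>) (choi_kernel m \<phi>))"
proof -
  have car: "id_tensor r n m (map_transp m n \<phi>) \<rho> \<in> carrier_mat (r * m) (r * m)"
    by (simp add: id_tensor_def)
  have ent: "bip_kernel m (id_tensor r n m (map_transp m n \<phi>) \<rho>) (i, x) (j, y) =
      (\<Sum>k<n. \<Sum>l<n. bip_kernel n \<rho> (i, k) (j, l) * choi_kernel m \<phi> (x, k) (y, l))"
    if h: "i < r" "j < r" "x < m" "y < m" for i j x y
  proof -
    define Z where "Z = mat n n (\<lambda>(a, b). \<rho> $$ (i * n + a, j * n + b))"
    have "bip_kernel m (id_tensor r n m (map_transp m n \<phi>) \<rho>) (i, x) (j, y) = map_transp m n \<phi> Z $$ (x, y)"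
      using h by (simp add: bip_kernel_def id_tensor_def pair_index_less Z_def)
    also have "\<dots> = hs_adj m n \<phi> (transp Z) $$ (y, x)"
      using h by (simp add: map_transp_def transp_def hs_adj_def)
    also have "\<dots> = (\<Sum>l<n. \<Sum>k<n. cnj (choi_kernel m \<phi> (y, l) (x, k)) * transp Z $$ (l, k))"
      by (rule hs_adj_index[OF channel_lin[OF \<phi>]]) (use h in \<open>auto simp: transp_def Z_def\<close>)
    also have "\<dots> = (\<Sum>l<n. \<Sum>k<n. bip_kernel n \<rho> (i, k) (j, l) * choi_kernel m \<phi> (x, k) (y, l))"
      using chan_kernel_herm[OF channel_chan_kernel[OF \<phi>], of "(x, _)" "(y, _)"] h
      by (intro sum.cong refl) (simp add: transp_def Z_def bip_kernel_def)
    finally show ?thesis by (subst sum.swap)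
  qed
  have "kernel_pair (grid r m) (bip_kernel m (id_tensor r n m (map_transp m n \<phi>) \<rho>)) (choi_kernel r \<alpha>) =
    (\<Sum>i<r. \<Sum>j<r. \<Sum>x<m. \<Sum>y<m. \<Sum>k<n. \<Sum>l<n. bip_kernel n \<rho> (i, k) (j, l) * (choi_kernel r \<alpha> (i, x) (j, y) * choi_kernel m \<phi> (x, k) (y, l)))"
    unfolding kernel_pair_prod by (intro sum.cong refl) (simp add: ent sum_distrib_right sum_distrib_left mult_ac)
  also have "\<dots> = (\<Sum>i<r. \<Sum>j<r. \<Sum>k<n. \<Sum>l<n. \<Sum>x<m. \<Sum>y<m. bip_kernel n \<rho> (i, k) (j, l) * (choi_kernel r \<alpha> (i, x) (j, y) * choi_kernel m \<phi> (x, k) (y, l)))"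
    by (intro sum.cong refl sum_swap4)
  also have "\<dots> = kernel_pair (grid r n) (bip_kernel n \<rho>) (kernel_comp m (choi_kernel r \<alpha>) (choi_kernel m \<phi>))"
    unfolding kernel_pair_prod kernel_comp_def by (simp add: sum_distrib_left)
  finally show ?thesis unfolding pairing_kernel[OF \<alpha> car] .
qed

text \<open>The partial trace over the factor on which the channel does not act. \<open>M\<close>
  enters with rows and columns exchanged because it is multiplied under a trace; what remains pairs
  with the Choi kernel of the map on \<open>R0\<close>.\<close>

definition ens_kernel :: "nat \<Rightarrow> complex mat \<Rightarrow> complex mat \<Rightarrow> nat \<times> nat \<Rightarrow> nat \<times> nat \<Rightarrow> complex" where
  "ens_kernel n \<rho> M p q = (\<Sum>x<n. \<Sum>y<n. bip_kernel n \<rho> (fst p, x) (fst q, y) * bip_kernel n M (snd q, y) (snd p, x))"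

lemma mtrace_tensor_id:
  assumes lin: "lin_map r n \<psi>" and \<rho>: "\<rho> \<in> carrier_mat (r * n) (r * n)" and M: "M \<in> carrier_mat (n * n) (n * n)"
  shows "mtrace (tensor_id r n n \<psi> \<rho> * M) = kernel_pair (grid r n) (ens_kernel n \<rho> M) (choi_kernel r \<psi>)"
proof -
  have car: "tensor_id r n n \<psi> \<rho> \<in> carrier_mat (n * n) (n * n)" by (simp add: tensor_id_def)
  have ent: "bip_kernel n (tensor_id r n n \<psi> \<rho>) (a, x) (b, y) = (\<Sum>i<r. \<Sum>j<r. bip_kernel n \<rho> (i, x) (j, y) * choi_kernel r \<psi> (i, a) (j, b))"
    if "a < n" "x < n" "b < n" "y < n" for a x b y
    using that by (simp add: bip_kernel_def tensor_id_def pair_index_less lin_map_expand[OF lin])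
  have "mtrace (tensor_id r n n \<psi> \<rho> * M) =
     (\<Sum>a<n. \<Sum>b<n. \<Sum>x<n. \<Sum>y<n. \<Sum>i<r. \<Sum>j<r. bip_kernel n \<rho> (i, x) (j, y) * bip_kernel n M (b, y) (a, x) * choi_kernel r \<psi> (i, a) (j, b))"
    unfolding mtrace_mult_bip_kernel[OF car M] kernel_pair_prod
    by (intro sum.cong refl) (simp add: ent sum_distrib_right sum_distrib_left mult_ac)
  also have "\<dots> = (\<Sum>a<n. \<Sum>b<n. \<Sum>i<r. \<Sum>j<r. \<Sum>x<n. \<Sum>y<n. bip_kernel n \<rho> (i, x) (j, y) * bip_kernel n M (b, y) (a, x) * choi_kernel r \<psi> (i, a) (j, b))"
    by (intro sum.cong refl sum_swap4)
  also have "\<dots> = (\<Sum>i<r. \<Sum>j<r. \<Sum>a<n. \<Sum>b<n. \<Sum>x<n. \<Sum>y<n. bip_kernel n \<rho> (i, x) (j, y) * bip_kernel n M (b, y) (a, x) * choi_kernel r \<psi> (i, a) (j, b))"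
    by (rule sum_swap4)
  also have "\<dots> = kernel_pair (grid r n) (ens_kernel n \<rho> M) (choi_kernel r \<psi>)"
    unfolding kernel_pair_prod ens_kernel_def by (simp add: sum_distrib_right)
  finally show ?thesis .
qed

lemma ens_kernel_pos:
  assumes \<rho>: "psd (r * n) \<rho>" and M: "psd (n * n) M"
  shows "pos_kernel (grid r n) (ens_kernel n \<rho> M)"
proof -
  have 1: "pos_kernel (grid n r) (\<lambda>p q. bip_kernel n \<rho> (snd p, fst p) (snd q, fst q))"
    by (rule pos_kernel_pullback[OF _ psd_bip_kernel[OF \<rho>]]) auto
  have "pos_kernel (grid n n) (\<lambda>p q. bip_kernel n M q p)"
    by (rule pos_kernel_transpose[OF _ psd_bip_kernel[OF M]]) simp
  then have 2: "pos_kernel (grid n n) (\<lambda>p q. bip_kernel n M (snd q, fst q) (snd p, fst p))"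
    by (rule pos_kernel_pullback[rotated, where f = "\<lambda>p. (snd p, fst p)"]) auto
  show ?thesis
    by (rule pos_kernel_cong[OF pos_kernel_contract[OF _ _ _ 2 1]]) (auto simp: ens_kernel_def mult.commute)
qed

section \<open>Values of the optimisation problems\<close>

definition pre_val :: "nat \<Rightarrow> nat \<Rightarrow> nat \<Rightarrow> (nat \<times> nat \<Rightarrow> nat \<times> nat \<Rightarrow> complex) \<Rightarrow>
    (nat \<times> nat \<Rightarrow> nat \<times> nat \<Rightarrow> complex) \<Rightarrow> real" where
  "pre_val r m n J \<rho> = Sup {Re (kernel_pair (grid r n) \<rho> (kernel_comp m c J)) | c. chan_kernel r m c}"

definition cond_val :: "nat \<Rightarrow> nat \<Rightarrow> (nat \<times> nat \<Rightarrow> nat \<times> nat \<Rightarrow> complex) \<Rightarrow> real" where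
  "cond_val r n \<rho> = Sup {Re (kernel_pair (grid r n) \<rho> c) | c. chan_kernel r n c}"

lemma kernel_comp_cong:
  assumes "\<And>p q. p \<in> grid r m \<Longrightarrow> q \<in> grid r m \<Longrightarrow> c p q = c' p q"
    "p \<in> grid r n" "q \<in> grid r n"
  shows "kernel_comp m c d p q = kernel_comp m c' d p q"
  unfolding kernel_comp_def using assms by (intro sum.cong refl) auto

text \<open>Channels and kernels do not correspond one to one: a channel is arbitrary off the
  carrier, a kernel off the grid. The second premise says that the value depends on grid entries
  only, and there \<open>map_of_kernel\<close> recovers the kernel.\<close>

lemma channel_image:
  assumes "\<And>\<alpha>. channel r m \<alpha> \<Longrightarrow> f \<alpha> = g (choi_kernel r \<alpha>)"
    "\<And>c c'. (\<And>p q. p \<in> grid r m \<Longrightarrow> q \<in> grid r m \<Longrightarrow> c p q = c' p q) \<Longrightarrow> g c = g c'"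
  shows "{f \<alpha> | \<alpha>. channel r m \<alpha>} = {g c | c. chan_kernel r m c}"
proof (rule subset_antisym; rule subsetI)
  fix x assume "x \<in> {f \<alpha> | \<alpha>. channel r m \<alpha>}"
  then show "x \<in> {g c | c. chan_kernel r m c}" using assms(1) channel_chan_kernel by blast
next
  fix x assume "x \<in> {g c | c. chan_kernel r m c}"
  then obtain c where c: "x = g c" "chan_kernel r m c" by blast
  have ch: "channel r m (map_of_kernel r m c)" by (rule chan_kernel_channel[OF c(2)])
  have "f (map_of_kernel r m c) = g (choi_kernel r (map_of_kernel r m c))" by (rule assms(1)[OF ch])
  also have "\<dots> = g c" by (rule assms(2)) (rule choi_kernel_map_of_kernel)
  finally have "x = f (map_of_kernel r m c)" using c(1) by simp
  then show "x \<in> {f \<alpha> | \<alpha>. channel r m \<alpha>}" using ch by blast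
qed

lemma cond_dnorm_pre_val:
  assumes "channel m n \<phi>" "\<rho> \<in> carrier_mat (r * n) (r * n)"
  shows "cond_dnorm r m (id_tensor r n m (map_transp m n \<phi>) \<rho>) = pre_val r m n (choi_kernel m \<phi>) (bip_kernel n \<rho>)"
  unfolding cond_dnorm_def pre_val_def
proof (rule arg_cong[where f = Sup], rule channel_image)
  show "Re (pairing r m (id_tensor r n m (map_transp m n \<phi>) \<rho>) \<alpha>) =
      Re (kernel_pair (grid r n) (bip_kernel n \<rho>) (kernel_comp m (choi_kernel r \<alpha>) (choi_kernel m \<phi>)))" if "channel r m \<alpha>" for \<alpha>
    unfolding pairing_transp[OF that assms] ..
qed (intro arg_cong[where f = Re] kernel_pair_cong refl kernel_comp_cong)

lemma cond_dnorm_cond_val: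
  assumes "\<rho> \<in> carrier_mat (r * n) (r * n)"
  shows "cond_dnorm r n \<rho> = cond_val r n (bip_kernel n \<rho>)"
  unfolding cond_dnorm_def cond_val_def
  by (rule arg_cong[where f = Sup], rule channel_image)
     (auto simp: pairing_kernel[OF _ assms] intro!: arg_cong[where f = Re] kernel_pair_cong)

definition ensemble_kernel :: "nat \<Rightarrow> nat \<Rightarrow> (nat \<Rightarrow> real) \<Rightarrow> (nat \<Rightarrow> complex mat) \<Rightarrow> (nat \<Rightarrow> complex mat) \<Rightarrow>
    nat \<times> nat \<Rightarrow> nat \<times> nat \<Rightarrow> complex" where
  "ensemble_kernel n k lam rho M p q = (\<Sum>i<k. of_real (lam i) * ens_kernel n (rho i) (M i) p q)"

lemma kernel_pair_ensemble_kernel: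
  "kernel_pair I (ensemble_kernel n k lam rho M) c = (\<Sum>i<k. of_real (lam i) * kernel_pair I (ens_kernel n (rho i) (M i)) c)"
proof -
  have "kernel_pair I (ensemble_kernel n k lam rho M) c =
      (\<Sum>p\<in>I. \<Sum>q\<in>I. \<Sum>i<k. of_real (lam i) * (ens_kernel n (rho i) (M i) p q * c p q))"
    unfolding kernel_pair_def ensemble_kernel_def by (simp add: sum_distrib_right mult.assoc)
  also have "\<dots> = (\<Sum>i<k. \<Sum>p\<in>I. \<Sum>q\<in>I. of_real (lam i) * (ens_kernel n (rho i) (M i) p q * c p q))"
    by (rule sum_swap3)
  finally show ?thesis unfolding kernel_pair_def sum_distrib_left .
qed

lemma psucc_kernel:
  assumes "lin_map r n \<psi>" "ensemble (r * n) k lam rho" "measurement (n * n) k M"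
  shows "psucc k lam (\<lambda>i. tensor_id r n n \<psi> (rho i)) M =
    Re (kernel_pair (grid r n) (ensemble_kernel n k lam rho M) (choi_kernel r \<psi>))"
proof -
  have "rho i \<in> carrier_mat (r * n) (r * n)" "M i \<in> carrier_mat (n * n) (n * n)" if "i < k" for i
    using assms that by (auto simp: ensemble_def measurement_def state_def psd_def)
  then show ?thesis
    unfolding psucc_def kernel_pair_ensemble_kernel using assms(1) by (simp add: mtrace_tensor_id)
qed

lemma psucc_pre_val:
  assumes \<phi>: "channel m n \<phi>" and e: "ensemble (r * n) k lam rho" "measurement (n * n) k M"
  shows "Sup {psucc k lam (\<lambda>i. tensor_id r n n (\<lambda>X. \<phi> (\<alpha> X)) (rho i)) M | \<alpha>. channel r m \<alpha>} =
    pre_val r m n (choi_kernel m \<phi>) (ensemble_kernel n k lam rho M)"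
proof -
  have "psucc k lam (\<lambda>i. tensor_id r n n (\<lambda>X. \<phi> (\<alpha> X)) (rho i)) M =
     Re (kernel_pair (grid r n) (ensemble_kernel n k lam rho M) (kernel_comp m (choi_kernel r \<alpha>) (choi_kernel m \<phi>)))"
    if \<alpha>: "channel r m \<alpha>" for \<alpha>
    unfolding psucc_kernel[OF lin_map_comp[OF channel_lin[OF \<alpha>] channel_lin[OF \<phi>]] e]
    by (intro arg_cong[where f = Re] kernel_pair_cong refl choi_kernel_comp[OF channel_lin[OF \<alpha>] channel_lin[OF \<phi>]])
  then show ?thesis
    unfolding pre_val_def
    by (intro arg_cong[where f = Sup] channel_image arg_cong[where f = Re] kernel_pair_cong refl kernel_comp_cong)
qed

section \<open>Nonempty and bounded feasible sets, starting from the completely depolarising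
  channel\<close>

lemma chan_kernel_depol:
  assumes "0 < m"
  shows "chan_kernel r m (\<lambda>p q. of_real (1 / m) * of_bool (p = q))"
  unfolding chan_kernel_def
proof (intro conjI allI impI)
  show "pos_kernel (grid r m) (\<lambda>p q. of_real (1 / m) * of_bool (p = q))"
    by (intro pos_kernel_scale pos_kernel_delta) auto
  show "(\<Sum>a<m. of_real (1 / m) * of_bool ((i, a) = (j, a))) = (of_bool (i = j) :: complex)" for i j :: nat
    using assms by simp
qed

lemma chan_kernel_trace:
  assumes "chan_kernel r n c"
  shows "(\<Sum>p\<in>grid r n. c p p) = of_nat r"
  unfolding sum.cartesian_product' using assms by (simp add: chan_kernel_def)

text \<open>A channel kernel has trace equal to the input dimension, which bounds its entries. The
  bound does not depend on \<open>c\<close>, so suprema over channels are genuine least upper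
  bounds.\<close>

lemma kernel_pair_chan_bound:
  assumes "chan_kernel r n c"
  shows "Re (kernel_pair (grid r n) \<rho> c) \<le> (\<Sum>p\<in>grid r n. \<Sum>q\<in>grid r n. cmod (\<rho> p q) * r)"
proof -
  let ?I = "grid r n"
  have "Re (kernel_pair ?I \<rho> c) \<le> cmod (kernel_pair ?I \<rho> c)" by (rule complex_Re_le_cmod)
  also have "\<dots> \<le> (\<Sum>p\<in>?I. \<Sum>q\<in>?I. cmod (\<rho> p q * c p q))"
    unfolding kernel_pair_def by (intro order_trans[OF norm_sum] sum_mono order_refl)
  also have "\<dots> \<le> (\<Sum>p\<in>?I. \<Sum>q\<in>?I. cmod (\<rho> p q) * r)"
  proof (intro sum_mono)
    fix p q assume pq: "p \<in> ?I" "q \<in> ?I"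
    have "cmod (c p q) \<le> Re (\<Sum>x\<in>?I. c x x)"
      by (rule pos_kernel_entry_bound) (use assms pq in \<open>auto simp: chan_kernel_def\<close>)
    then have "cmod (c p q) \<le> r" using chan_kernel_trace[OF assms] by simp
    then show "cmod (\<rho> p q * c p q) \<le> cmod (\<rho> p q) * r" by (simp add: norm_mult mult_left_mono)
  qed
  finally show ?thesis .
qed

lemma cond_val_upper:
  assumes "chan_kernel r n c"
  shows "Re (kernel_pair (grid r n) \<rho> c) \<le> cond_val r n \<rho>"
  unfolding cond_val_def
proof (rule cSup_upper)
  show "bdd_above {Re (kernel_pair (grid r n) \<rho> c) | c. chan_kernel r n c}"
    using kernel_pair_chan_bound by (intro bdd_aboveI) blast
qed (use assms in blast)

lemma cond_val_least:
  assumes "0 < n" "\<And>c. chan_kernel r n c \<Longrightarrow> Re (kernel_pair (grid r n) \<rho> c) \<le> B"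
  shows "cond_val r n \<rho> \<le> B"
  unfolding cond_val_def
  by (rule cSup_least) (use chan_kernel_depol[OF assms(1)] assms(2) in blast)+

lemma pre_val_upper:
  assumes "chan_kernel r m c" "chan_kernel m n J"
  shows "Re (kernel_pair (grid r n) \<rho> (kernel_comp m c J)) \<le> pre_val r m n J \<rho>"
  unfolding pre_val_def
proof (rule cSup_upper)
  show "bdd_above {Re (kernel_pair (grid r n) \<rho> (kernel_comp m c J)) | c. chan_kernel r m c}"
    using kernel_pair_chan_bound[OF chan_kernel_comp[OF _ assms(2)]] by (intro bdd_aboveI) blast
qed (use assms in blast)

lemma pre_val_least:
  assumes "0 < m" "\<And>c. chan_kernel r m c \<Longrightarrow> Re (kernel_pair (grid r n) \<rho> (kernel_comp m c J)) \<le> B"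
  shows "pre_val r m n J \<rho> \<le> B"
  unfolding pre_val_def
  by (rule cSup_least) (use chan_kernel_depol[OF assms(1)] assms(2) in blast)+

lemma ensemble_kernel_pos:
  assumes "ensemble (r * n) k lam rho" "measurement (n * n) k M"
  shows "pos_kernel (grid r n) (ensemble_kernel n k lam rho M)"
  unfolding ensemble_kernel_def using assms
  by (intro pos_kernel_sum pos_kernel_scale ens_kernel_pos)
     (auto simp: ensemble_def measurement_def state_def)

lemma measurement_bip_kernel:
  assumes "measurement (r * n) k M" "p \<in> grid r n" "q \<in> grid r n"
  shows "(\<Sum>i<k. bip_kernel n (M i) p q) = of_bool (p = q)"
proof -
  obtain i a j b where pq: "p = (i, a)" "q = (j, b)" "i < r" "j < r" "a < n" "b < n" using assms(2,3) by auto
  have "(i * n + a = j * n + b) = (i = j \<and> a = b)"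
  proof
    assume e: "i * n + a = j * n + b"
    show "i = j \<and> a = b"
      using arg_cong[OF e, of "\<lambda>x. x div n"] arg_cong[OF e, of "\<lambda>x. x mod n"] pq by simp
  qed simp
  then show ?thesis using assms(1) pq by (simp add: measurement_def bip_kernel_def pair_index_less)
qed

text \<open>Each element of a measurement has trace at most the dimension, because the other
  elements have nonnegative trace and all of them add up to the identity.\<close>

lemma psucc_bdd:
  assumes "measurement d k N" "\<And>i. i < k \<Longrightarrow> rho i \<in> carrier_mat d d"
  shows "psucc k lam rho N \<le> (\<Sum>i<k. \<bar>lam i\<bar> * (\<Sum>p<d. \<Sum>q<d. cmod (rho i $$ (p, q)) * d))"
  unfolding psucc_def
proof (rule sum_mono)
  fix i assume "i \<in> {..<k}"
  then have i: "i < k" by simp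
  have posN: "pos_kernel {..<d} (mat_kernel (N j))" "N j \<in> carrier_mat d d" if "j < k" for j
    using assms(1) that by (auto simp: measurement_def psd_iff_pos_kernel)
  have trN: "Re (\<Sum>p<d. N i $$ (p, p)) \<le> d"
  proof -
    have "Re (\<Sum>p<d. N i $$ (p, p)) \<le> (\<Sum>j<k. Re (\<Sum>p<d. N j $$ (p, p)))"
    proof (rule member_le_sum[of i "{..<k}" "\<lambda>j. Re (\<Sum>p<d. N j $$ (p, p))"])
      fix j assume "j \<in> {..<k} - {i}"
      then have "0 \<le> N j $$ (p, p)" if "p < d" for p
        using pos_kernel_diag[OF _ posN(1), of j p] that by simp
      then show "0 \<le> Re (\<Sum>p<d. N j $$ (p, p))" by (auto simp: less_eq_complex_def intro!: sum_nonneg)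
    qed (use i in auto)
    also have "\<dots> = Re (\<Sum>p<d. \<Sum>j<k. N j $$ (p, p))" by (subst sum.swap) simp
    also have "\<dots> = d" using assms(1) by (simp add: measurement_def)
    finally show ?thesis .
  qed
  have "Re (mtrace (rho i * N i)) \<le> cmod (mtrace (rho i * N i))" by (rule complex_Re_le_cmod)
  also have "\<dots> \<le> (\<Sum>p<d. \<Sum>q<d. cmod (rho i $$ (p, q) * N i $$ (q, p)))"
    unfolding mtrace_mult[OF assms(2)[OF i] posN(2)[OF i]]
    by (intro order_trans[OF norm_sum] sum_mono order_refl)
  finally have 1: "\<bar>Re (mtrace (rho i * N i))\<bar> \<le> (\<Sum>p<d. \<Sum>q<d. cmod (rho i $$ (p, q) * N i $$ (q, p)))"
    using abs_Re_le_cmod order_trans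
    by (metis (no_types, lifting) \<open>cmod (mtrace (rho i * N i)) \<le> (\<Sum>p<d. \<Sum>q<d. cmod (rho i $$ (p, q) * N i $$ (q, p)))\<close>)
  also have "\<dots> \<le> (\<Sum>p<d. \<Sum>q<d. cmod (rho i $$ (p, q)) * d)"
  proof (intro sum_mono)
    fix p q assume pq: "p \<in> {..<d}" "q \<in> {..<d}"
    have "cmod (N i $$ (q, p)) \<le> d"
      using pos_kernel_entry_bound[OF _ posN(1)[OF i] pq(2,1)] trN by simp
    then show "cmod (rho i $$ (p, q) * N i $$ (q, p)) \<le> cmod (rho i $$ (p, q)) * d"
      by (simp add: norm_mult mult_left_mono)
  qed
  finally have "\<bar>lam i\<bar> * \<bar>Re (mtrace (rho i * N i))\<bar> \<le> \<bar>lam i\<bar> * (\<Sum>p<d. \<Sum>q<d. cmod (rho i $$ (p, q)) * d)"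
    by (rule mult_left_mono) simp
  then show "lam i * Re (mtrace (rho i * N i)) \<le> \<bar>lam i\<bar> * (\<Sum>p<d. \<Sum>q<d. cmod (rho i $$ (p, q)) * d)"
    using abs_ge_self[of "lam i * Re (mtrace (rho i * N i))"] by (simp add: abs_mult)
qed

lemma psucc_opt_upper:
  assumes "measurement d k N" "\<And>i. i < k \<Longrightarrow> rho i \<in> carrier_mat d d"
  shows "psucc k lam rho N \<le> psucc_opt d k lam rho"
  unfolding psucc_opt_def
proof (rule cSup_upper)
  show "bdd_above {psucc k lam rho M | M. measurement d k M}"
  proof (rule bdd_aboveI)
    fix x assume "x \<in> {psucc k lam rho M | M. measurement d k M}"
    then show "x \<le> (\<Sum>i<k. \<bar>lam i\<bar> * (\<Sum>p<d. \<Sum>q<d. cmod (rho i $$ (p, q)) * d))"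
      using psucc_bdd[of d k _ rho lam] assms(2) by blast
  qed
qed (use assms in blast)

text \<open>The Heisenberg picture of a channel turns the given measurement into a measurement on the
  ensemble itself.\<close>

lemma cond_val_ensemble_kernel:
  assumes "0 < n" and e: "ensemble (r * n) k lam rho" and M: "measurement (n * n) k M"
  shows "cond_val r n (ensemble_kernel n k lam rho M) \<le> psucc_opt (r * n) k lam rho"
proof (rule cond_val_least[OF assms(1)])
  fix c assume c: "chan_kernel r n c"
  \<comment> \<open>The adjoint of the channel applied to the first factor of \<open>M i\<close>;
    the conjugate of the Hermitian kernel \<open>c\<close> is written by exchanging its
    arguments.\<close>
  define Nk where "Nk i p q = (\<Sum>a<n. \<Sum>b<n. bip_kernel n (M i) (a, snd p) (b, snd q) * c (fst q, b) (fst p, a))" for i p q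
  define N where "N i = mat (r * n) (r * n) (\<lambda>(p, q). Nk i (p div n, p mod n) (q div n, q mod n))" for i
  have carN: "N i \<in> carrier_mat (r * n) (r * n)" for i by (simp add: N_def)
  have bkN: "bip_kernel n (N i) p q = Nk i p q" if "p \<in> grid r n" "q \<in> grid r n" for i p q
    using that by (auto simp: bip_kernel_def N_def pair_index_less)
  have "pos_kernel (grid r n) (\<lambda>p q. c q p)"
    by (rule pos_kernel_transpose) (use c in \<open>auto simp: chan_kernel_def\<close>)
  then have ct: "pos_kernel (grid n r) (\<lambda>p q. c (snd q, fst q) (snd p, fst p))"
    by (rule pos_kernel_pullback[rotated, where f = "\<lambda>p. (snd p, fst p)"]) auto
  have posN: "psd (r * n) (N i)" if "i < k" for i
  proof (rule psd_of_kernel[OF carN])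
    have Mi: "pos_kernel (grid n n) (bip_kernel n (M i))"
      using M that by (intro psd_bip_kernel) (simp add: measurement_def)
    show "pos_kernel (grid r n) (Nk i)"
      by (rule pos_kernel_cong[OF pos_kernel_contract[OF _ _ _ Mi ct]]) (auto simp: Nk_def)
  qed (simp add: N_def)
  \<comment> \<open>Trace preservation of the channel appears here as unitality of its
    adjoint.\<close>
  have sumN: "(\<Sum>i<k. Nk i p q) = of_bool (p = q)" if pq: "p \<in> grid r n" "q \<in> grid r n" for p q
  proof -
    have "(\<Sum>i<k. Nk i p q) = (\<Sum>a<n. \<Sum>b<n. (\<Sum>i<k. bip_kernel n (M i) (a, snd p) (b, snd q)) * c (fst q, b) (fst p, a))"
      unfolding Nk_def sum_distrib_right by (rule sum_swap3[symmetric])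
    also have "\<dots> = (\<Sum>a<n. \<Sum>b<n. if b = a then of_bool (snd p = snd q) * c (fst q, a) (fst p, a) else 0)"
      using pq by (intro sum.cong refl) (auto simp: measurement_bip_kernel[OF M])
    also have "\<dots> = of_bool (snd p = snd q) * (\<Sum>a<n. c (fst q, a) (fst p, a))"
      by (simp add: sum_distrib_left)
    also have "\<dots> = of_bool (p = q)"
      using c pq by (auto simp: chan_kernel_def)
    finally show ?thesis .
  qed
  have meas: "measurement (r * n) k N"
    unfolding measurement_def
  proof (intro conjI allI impI)
    fix a b assume ab: "a < r * n" "b < r * n"
    have "(\<Sum>i<k. N i $$ (a, b)) = (\<Sum>i<k. Nk i (a div n, a mod n) (b div n, b mod n))"
      using ab by (simp add: N_def)
    also have "\<dots> = of_bool ((a div n, a mod n) = (b div n, b mod n))"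
      by (rule sumN) (use ab in \<open>auto simp: div_mod_less\<close>)
    also have "\<dots> = 1\<^sub>m (r * n) $$ (a, b)"
      using ab by (auto simp: of_bool_def) (metis div_mult_mod_eq)
    finally show "(\<Sum>i<k. N i $$ (a, b)) = 1\<^sub>m (r * n) $$ (a, b)" .
  qed (use posN in auto)
  have car: "rho i \<in> carrier_mat (r * n) (r * n)" if "i < k" for i
    using e that by (auto simp: ensemble_def state_def psd_def)
  have tr: "mtrace (rho i * N i) = kernel_pair (grid r n) (ens_kernel n (rho i) (M i)) c" if i: "i < k" for i
  proof -
    have "mtrace (rho i * N i) = kernel_pair (grid r n) (bip_kernel n (rho i)) (\<lambda>p q. Nk i q p)"
      unfolding mtrace_mult_bip_kernel[OF car[OF i] carN] by (rule kernel_pair_cong) (auto simp: bkN)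
    also have "\<dots> = (\<Sum>s<r. \<Sum>t<r. \<Sum>x<n. \<Sum>y<n. \<Sum>a<n. \<Sum>b<n.
        bip_kernel n (rho i) (s, x) (t, y) * bip_kernel n (M i) (a, y) (b, x) * c (s, b) (t, a))"
      unfolding kernel_pair_prod Nk_def by (simp add: sum_distrib_left mult.assoc)
    also have "\<dots> = (\<Sum>s<r. \<Sum>t<r. \<Sum>a<n. \<Sum>b<n. \<Sum>x<n. \<Sum>y<n.
        bip_kernel n (rho i) (s, x) (t, y) * bip_kernel n (M i) (a, y) (b, x) * c (s, b) (t, a))"
      by (intro sum.cong refl sum_swap4)
    also have "\<dots> = (\<Sum>s<r. \<Sum>t<r. \<Sum>b<n. \<Sum>a<n. \<Sum>x<n. \<Sum>y<n.
        bip_kernel n (rho i) (s, x) (t, y) * bip_kernel n (M i) (a, y) (b, x) * c (s, b) (t, a))"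
      by (rule sum.cong[OF refl], rule sum.cong[OF refl], rule sum.swap)
    also have "\<dots> = kernel_pair (grid r n) (ens_kernel n (rho i) (M i)) c"
      unfolding kernel_pair_prod ens_kernel_def by (simp add: sum_distrib_right)
    finally show ?thesis .
  qed
  have "Re (kernel_pair (grid r n) (ensemble_kernel n k lam rho M) c) = psucc k lam rho N"
    unfolding kernel_pair_ensemble_kernel psucc_def by (simp add: tr)
  also have "\<dots> \<le> psucc_opt (r * n) k lam rho" by (rule psucc_opt_upper[OF meas car])
  finally show "Re (kernel_pair (grid r n) (ensemble_kernel n k lam rho M) c) \<le> psucc_opt (r * n) k lam rho" .
qed

section \<open>Trace norm bound for a difference of completely positive maps\<close>

lemma pos_kernel_diag_scale:
  assumes "finite I" "pos_kernel I A"
  shows "pos_kernel I (\<lambda>p q. s p * A p q * cnj (s q))"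
proof -
  obtain g where "\<And>p q. p \<in> I \<Longrightarrow> q \<in> I \<Longrightarrow> A p q = (\<Sum>k<card I. g k p * cnj (g k q))"
    using pos_kernel_gramE[OF assms] by blast
  then show ?thesis
    by (intro pos_kernel_gramI[where K = "{..<card I}" and g = "\<lambda>k p. s p * g k p"])
       (auto simp: sum_distrib_left sum_distrib_right mult_ac)
qed

text \<open>A positive completion \<open>Z\<close> of \<open>X\<close> stays positive under both
  maps. After reversing the sign of the off-diagonal blocks in the image under \<open>H\<close>, the
  sum of the two images completes the image of \<open>X\<close> under the difference, and each map
  contributes \<open>t * trace_norm X\<close> to every diagonal block.\<close>

lemma trace_norm_diff_bound:
  assumes lin: "\<And>X a b. X \<in> carrier_mat m m \<Longrightarrow> a < n \<Longrightarrow> b < n \<Longrightarrow>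
      \<Delta> X $$ (a, b) = (\<Sum>i<m. \<Sum>j<m. X $$ (i, j) * (G (i, a) (j, b) - H (i, a) (j, b)))"
    and G: "pos_kernel (grid m n) G" "\<And>i j. i < m \<Longrightarrow> j < m \<Longrightarrow> (\<Sum>a<n. G (i, a) (j, a)) = of_real t * of_bool (i = j)"
    and H: "pos_kernel (grid m n) H" "\<And>i j. i < m \<Longrightarrow> j < m \<Longrightarrow> (\<Sum>a<n. H (i, a) (j, a)) = of_real t * of_bool (i = j)"
    and X: "X \<in> carrier_mat (m * m) (m * m)"
  shows "trace_norm (tensor_id m n m \<Delta> X) \<le> 2 * t * trace_norm X"
proof -
  obtain Z where Z: "pos_kernel ({..<2::nat} \<times> {..<m * m}) Z"
    and off: "\<forall>p<m * m. \<forall>q<m * m. Z (0, p) (1, q) = X $$ (p, q)"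
    and tr0: "(\<Sum>p<m * m. Z (0, p) (0, p)) = of_real (trace_norm X)"
    and tr1: "(\<Sum>p<m * m. Z (1, p) (1, p)) = of_real (trace_norm X)"
    using trace_norm_block_attained[OF X] by blast
  define E where "E F p q = (\<Sum>i<m. \<Sum>j<m. Z (fst p, i * m + snd p mod m) (fst q, j * m + snd q mod m) *
     F (i, snd p div m) (j, snd q div m))" for F and p q :: "nat \<times> nat"
  have posE: "pos_kernel (grid 2 (n * m)) (E F)" if F: "pos_kernel (grid m n) F" for F
  proof -
    have 1: "pos_kernel ({..<m} \<times> (grid 2 m)) (\<lambda>p q. Z (fst (snd p), fst p * m + snd (snd p)) (fst (snd q), fst q * m + snd (snd q)))"
      by (rule pos_kernel_pullback[OF _ Z]) (auto simp: pair_index_less)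
    have 2: "pos_kernel ({..<n} \<times> (grid 2 m)) (\<lambda>p q. \<Sum>i<m. \<Sum>j<m.
        Z (fst (snd p), i * m + snd (snd p)) (fst (snd q), j * m + snd (snd q)) * F (i, fst p) (j, fst q))"
      by (rule pos_kernel_cong[OF pos_kernel_contract[OF _ _ _ 1 F]]) auto
    show ?thesis
      by (rule pos_kernel_cong[OF pos_kernel_pullback[OF _ 2, where f = "\<lambda>p. (snd p div m, fst p, snd p mod m)"]])
         (auto simp: E_def div_mod_less)
  qed
  have trE: "(\<Sum>p<n * m. E F (e, p) (e, p)) = of_real (t * trace_norm X)"
    if F: "\<And>i j. i < m \<Longrightarrow> j < m \<Longrightarrow> (\<Sum>a<n. F (i, a) (j, a)) = of_real t * of_bool (i = j)" and e: "e = 0 \<or> e = 1" for F e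
  proof -
    have "(\<Sum>p<n * m. E F (e, p) (e, p)) = (\<Sum>a<n. \<Sum>z<m. \<Sum>i<m. \<Sum>j<m. Z (e, i * m + z) (e, j * m + z) * F (i, a) (j, a))"
      unfolding sum_pair_index sum.cartesian_product' by (simp add: E_def)
    also have "\<dots> = (\<Sum>z<m. \<Sum>a<n. \<Sum>i<m. \<Sum>j<m. Z (e, i * m + z) (e, j * m + z) * F (i, a) (j, a))"
      by (rule sum.swap)
    also have "\<dots> = (\<Sum>z<m. \<Sum>i<m. \<Sum>j<m. \<Sum>a<n. Z (e, i * m + z) (e, j * m + z) * F (i, a) (j, a))"
      by (intro sum.cong refl sum_swap3[symmetric])
    also have "\<dots> = (\<Sum>z<m. \<Sum>i<m. \<Sum>j<m. if j = i then of_real t * Z (e, i * m + z) (e, i * m + z) else 0)"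
      using F by (intro sum.cong refl) (auto simp flip: sum_distrib_left)
    also have "\<dots> = of_real t * (\<Sum>z<m. \<Sum>i<m. Z (e, i * m + z) (e, i * m + z))"
      by (simp add: sum_distrib_left)
    also have "(\<Sum>z<m. \<Sum>i<m. Z (e, i * m + z) (e, i * m + z)) = (\<Sum>p<m * m. Z (e, p) (e, p))"
      unfolding sum_pair_index sum.cartesian_product' fst_conv snd_conv by (rule sum.swap)
    also have "\<dots> = of_real (trace_norm X)" using e tr0 tr1 by auto
    finally show ?thesis by simp
  qed
  \<comment> \<open>Conjugation with the sign of the block label negates the corner, keeps
    positivity and leaves the diagonal blocks alone.\<close>
  define s :: "nat \<times> nat \<Rightarrow> complex" where "s p = (if fst p = 0 then 1 else - 1)" for p
  define W where "W p q = E G p q + s p * E H p q * cnj (s q)" for p q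
  have "pos_kernel (grid 2 (n * m)) W"
    unfolding W_def by (intro pos_kernel_add pos_kernel_diag_scale posE G(1) H(1)) simp
  moreover have "tensor_id m n m \<Delta> X \<in> carrier_mat (n * m) (n * m)" by (simp add: tensor_id_def)
  moreover have "W (0, p) (1, q) = tensor_id m n m \<Delta> X $$ (p, q)" if pq: "p < n * m" "q < n * m" for p q
  proof -
    have "tensor_id m n m \<Delta> X $$ (p, q) = (\<Sum>i<m. \<Sum>j<m. X $$ (i * m + p mod m, j * m + q mod m) *
         (G (i, p div m) (j, q div m) - H (i, p div m) (j, q div m)))"
      using pq div_mod_less[OF pq(1)] div_mod_less[OF pq(2)] by (simp add: tensor_id_def lin)
    also have "\<dots> = (\<Sum>i<m. \<Sum>j<m. Z (0, i * m + p mod m) (1, j * m + q mod m) *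
         (G (i, p div m) (j, q div m) - H (i, p div m) (j, q div m)))"
      using off div_mod_less[OF pq(1)] div_mod_less[OF pq(2)] by (simp add: pair_index_less)
    also have "\<dots> = W (0, p) (1, q)"
      by (simp add: W_def E_def s_def right_diff_distrib sum_subtractf)
    finally show ?thesis ..
  qed
  ultimately have "trace_norm (tensor_id m n m \<Delta> X) \<le>
      (Re (\<Sum>p<n * m. W (0, p) (0, p)) + Re (\<Sum>p<n * m. W (1, p) (1, p))) / 2"
    by (intro trace_norm_block_le) auto
  also have "\<dots> = 2 * t * trace_norm X"
  proof -
    have "(\<Sum>p<n * m. W (e, p) (e, p)) = of_real (2 * t * trace_norm X)" if "e = 0 \<or> e = 1" for e
    proof -
      have "(\<Sum>p<n * m. W (e, p) (e, p)) = (\<Sum>p<n * m. E G (e, p) (e, p)) + (\<Sum>p<n * m. E H (e, p) (e, p))"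
        unfolding W_def by (simp add: s_def sum.distrib)
      then show ?thesis using trE[OF G(2) that] trE[OF H(2) that] by simp
    qed
    then show ?thesis by simp
  qed
  finally show ?thesis .
qed

section \<open>From the dual inequality to the diamond norm\<close>

lemma trace_norm_zero: "trace_norm (0\<^sub>m d d) = 0"
proof -
  have "psd d (0\<^sub>m d d)" unfolding psd_iff_pos_kernel
    by (auto intro: pos_kernel_cong[OF pos_kernel_zero])
  from trace_norm_psd[OF this] show ?thesis by (simp add: mtrace_def)
qed

text \<open>Two decompositions of the same difference are used. Two channels with
  \<open>t = 1\<close> make the diamond norm a finite supremum; the separation argument supplies
  another one with \<open>t\<close> close to \<epsilon> / 2, which yields the sharp bound.\<close>

locale diff_map =
  fixes m n :: nat and \<Delta> :: cmap and G H :: "nat \<times> nat \<Rightarrow> nat \<times> nat \<Rightarrow> complex" and t :: real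
  assumes lin: "\<And>X a b. X \<in> carrier_mat m m \<Longrightarrow> a < n \<Longrightarrow> b < n \<Longrightarrow>
      \<Delta> X $$ (a, b) = (\<Sum>i<m. \<Sum>j<m. X $$ (i, j) * (G (i, a) (j, b) - H (i, a) (j, b)))"
    and G: "pos_kernel (grid m n) G" "\<And>i j. i < m \<Longrightarrow> j < m \<Longrightarrow> (\<Sum>a<n. G (i, a) (j, a)) = of_real t * of_bool (i = j)"
    and H: "pos_kernel (grid m n) H" "\<And>i j. i < m \<Longrightarrow> j < m \<Longrightarrow> (\<Sum>a<n. H (i, a) (j, a)) = of_real t * of_bool (i = j)"
    and t: "0 \<le> t"
begin

lemma bound:
  assumes "X \<in> carrier_mat (m * m) (m * m)" "trace_norm X \<le> 1"
  shows "trace_norm (tensor_id m n m \<Delta> X) \<le> 2 * t"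
proof -
  have "trace_norm (tensor_id m n m \<Delta> X) \<le> 2 * t * trace_norm X"
    by (rule trace_norm_diff_bound[OF lin G H assms(1)])
  also have "\<dots> \<le> 2 * t * 1" using assms(2) t by (intro mult_left_mono) auto
  finally show ?thesis by simp
qed

lemma dnorm_le: "dnorm m n \<Delta> \<le> 2 * t"
  unfolding dnorm_def
proof (rule cSup_least)
  have "0\<^sub>m (m * m) (m * m) \<in> carrier_mat (m * m) (m * m) \<and> trace_norm (0\<^sub>m (m * m) (m * m)) \<le> 1"
    by (simp add: trace_norm_zero)
  then show "{trace_norm (tensor_id m n m \<Delta> X) |X. X \<in> carrier_mat (m * m) (m * m) \<and> trace_norm X \<le> 1} \<noteq> {}"
    by blast
qed (use bound in blast)

lemma dnorm_upper:
  assumes "X \<in> carrier_mat (m * m) (m * m)" "trace_norm X \<le> 1"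
  shows "trace_norm (tensor_id m n m \<Delta> X) \<le> dnorm m n \<Delta>"
  unfolding dnorm_def
proof (rule cSup_upper)
  show "bdd_above {trace_norm (tensor_id m n m \<Delta> X) |X. X \<in> carrier_mat (m * m) (m * m) \<and> trace_norm X \<le> 1}"
    using bound by (intro bdd_aboveI) blast
qed (use assms in blast)

lemma dnorm_nonneg: "0 \<le> dnorm m n \<Delta>"
proof -
  have "0 \<le> trace_norm (tensor_id m n m \<Delta> (0\<^sub>m (m * m) (m * m)))"
    by (rule trace_norm_nonneg[of _ "n * m"]) (simp add: tensor_id_def)
  also have "\<dots> \<le> dnorm m n \<Delta>" by (rule dnorm_upper) (auto simp: trace_norm_zero)
  finally show ?thesis .
qed

end

lemma pre_diff_expand:
  assumes "channel m1 n \<Phi>1" "channel m n \<Phi>2" "channel m m1 \<Lambda>"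
    "X \<in> carrier_mat m m" "a < n" "b < n"
  shows "(\<Phi>1 (\<Lambda> X) - \<Phi>2 X) $$ (a, b) = (\<Sum>i<m. \<Sum>j<m. X $$ (i, j) *
      (kernel_comp m1 (choi_kernel m \<Lambda>) (choi_kernel m1 \<Phi>1) (i, a) (j, b) - choi_kernel m \<Phi>2 (i, a) (j, b)))"
proof -
  note lin = channel_lin[OF assms(1)] channel_lin[OF assms(2)] channel_lin[OF assms(3)]
  have "\<Phi>2 X \<in> carrier_mat n n" using lin(2) assms(4) by (simp add: lin_map_def)
  then have "(\<Phi>1 (\<Lambda> X) - \<Phi>2 X) $$ (a, b) = \<Phi>1 (\<Lambda> X) $$ (a, b) - \<Phi>2 X $$ (a, b)"
    using assms(5,6) by simp
  also have "\<Phi>1 (\<Lambda> X) $$ (a, b) = (\<Sum>i<m. \<Sum>j<m. X $$ (i, j) * choi_kernel m (\<lambda>X. \<Phi>1 (\<Lambda> X)) (i, a) (j, b))"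
    by (rule lin_map_expand[OF lin_map_comp[OF lin(3,1)] assms(4-6)])
  also have "\<dots> = (\<Sum>i<m. \<Sum>j<m. X $$ (i, j) * kernel_comp m1 (choi_kernel m \<Lambda>) (choi_kernel m1 \<Phi>1) (i, a) (j, b))"
    using assms(5,6) by (intro sum.cong refl arg_cong2[where f = "(*)"] choi_kernel_comp[OF lin(3,1)]) auto
  finally show ?thesis
    unfolding lin_map_expand[OF lin(2) assms(4-6)] by (simp add: right_diff_distrib sum_subtractf)
qed

lemma diff_map_pre:
  assumes "channel m1 n \<Phi>1" "channel m n \<Phi>2" "channel m m1 \<Lambda>"
  shows "diff_map m n (\<lambda>X. \<Phi>1 (\<Lambda> X) - \<Phi>2 X) (kernel_comp m1 (choi_kernel m \<Lambda>) (choi_kernel m1 \<Phi>1)) (choi_kernel m \<Phi>2) 1"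
proof -
  have "chan_kernel m n (kernel_comp m1 (choi_kernel m \<Lambda>) (choi_kernel m1 \<Phi>1))"
    by (intro chan_kernel_comp channel_chan_kernel assms)
  moreover have "chan_kernel m n (choi_kernel m \<Phi>2)" by (intro channel_chan_kernel assms)
  ultimately show ?thesis
    by unfold_locales (auto simp: pre_diff_expand[OF assms] chan_kernel_def)
qed

lemma delta_pre_bdd_below:
  assumes "channel m1 n \<Phi>1" "channel m n \<Phi>2"
  shows "bdd_below {dnorm m n (\<lambda>X. \<Phi>1 (\<Lambda> X) - \<Phi>2 X) |\<Lambda>. channel m m1 \<Lambda>}"
  using diff_map.dnorm_nonneg[OF diff_map_pre[OF assms]] by (intro bdd_belowI[of _ 0]) blast

lemma channel_exists: "0 < m \<Longrightarrow> \<exists>\<alpha>. channel r m \<alpha>"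
  using chan_kernel_channel[OF chan_kernel_depol] by blast

lemma delta_pre_approx:
  assumes "channel m1 n \<Phi>1" "channel m n \<Phi>2" "0 < m1"
    and "delta_pre m1 m n \<Phi>1 \<Phi>2 \<le> \<epsilon>" "0 < \<eta>"
  shows "\<exists>\<Lambda>. channel m m1 \<Lambda> \<and> dnorm m n (\<lambda>X. \<Phi>1 (\<Lambda> X) - \<Phi>2 X) < \<epsilon> + \<eta>"
proof -
  let ?S = "{dnorm m n (\<lambda>X. \<Phi>1 (\<Lambda> X) - \<Phi>2 X) |\<Lambda>. channel m m1 \<Lambda>}"
  have "?S \<noteq> {}" using channel_exists[OF assms(3)] by blast
  moreover have "Inf ?S < \<epsilon> + \<eta>" using assms(4,5) by (simp add: delta_pre_def)
  ultimately show ?thesis using cInf_less_iff[of ?S] delta_pre_bdd_below[OF assms(1,2)] by blast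
qed

lemma delta_pre_leI:
  assumes "channel m1 n \<Phi>1" "channel m n \<Phi>2"
    and ex: "\<And>\<eta>. 0 < \<eta> \<Longrightarrow> \<exists>\<Lambda>. channel m m1 \<Lambda> \<and> dnorm m n (\<lambda>X. \<Phi>1 (\<Lambda> X) - \<Phi>2 X) \<le> \<epsilon> + \<eta>"
  shows "delta_pre m1 m n \<Phi>1 \<Phi>2 \<le> \<epsilon>"
proof (rule field_le_epsilon)
  fix \<eta> :: real assume "0 < \<eta>"
  then obtain \<Lambda> where \<Lambda>: "channel m m1 \<Lambda>" "dnorm m n (\<lambda>X. \<Phi>1 (\<Lambda> X) - \<Phi>2 X) \<le> \<epsilon> + \<eta>" using ex by blast
  have "delta_pre m1 m n \<Phi>1 \<Phi>2 \<le> dnorm m n (\<lambda>X. \<Phi>1 (\<Lambda> X) - \<Phi>2 X)"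
    unfolding delta_pre_def using \<Lambda>(1) by (intro cInf_lower[OF _ delta_pre_bdd_below[OF assms(1,2)]]) blast
  with \<Lambda>(2) show "delta_pre m1 m n \<Phi>1 \<Phi>2 \<le> \<epsilon> + \<eta>" by simp
qed

lemma herm_kernel_add: "herm_kernel I A \<Longrightarrow> herm_kernel I B \<Longrightarrow> herm_kernel I (\<lambda>p q. A p q + B p q)"
  unfolding herm_kernel_def by (metis complex_cnj_add)

lemma herm_kernel_diff: "herm_kernel I A \<Longrightarrow> herm_kernel I B \<Longrightarrow> herm_kernel I (\<lambda>p q. A p q - B p q)"
  unfolding herm_kernel_def by (metis complex_cnj_diff)

lemma herm_kernel_scale: "herm_kernel I A \<Longrightarrow> herm_kernel I (\<lambda>p q. of_real c * A p q)"
  unfolding herm_kernel_def by (metis complex_cnj_mult complex_cnj_complex_of_real)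

lemma chan_kernel_herm_kernel: "chan_kernel r n c \<Longrightarrow> herm_kernel (grid r n) c"
  by (rule pos_kernel_herm) (auto simp: chan_kernel_def)

lemma chan_kernel_convex:
  assumes "chan_kernel r n c" "chan_kernel r n c'" "0 \<le> t" "t \<le> (1::real)"
  shows "chan_kernel r n (\<lambda>p q. of_real (1 - t) * c p q + of_real t * c' p q)"
  unfolding chan_kernel_def
proof (intro conjI allI impI)
  show "pos_kernel (grid r n) (\<lambda>p q. of_real (1 - t) * c p q + of_real t * c' p q)"
    using assms by (intro pos_kernel_add pos_kernel_scale) (auto simp: chan_kernel_def)
  fix i j assume "i < r" "j < r"
  then have "(\<Sum>a<n. c (i, a) (j, a)) = of_bool (i = j)" "(\<Sum>a<n. c' (i, a) (j, a)) = of_bool (i = j)"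
    using assms by (auto simp: chan_kernel_def)
  then have "(\<Sum>a<n. of_real (1 - t) * c (i, a) (j, a) + of_real t * c' (i, a) (j, a)) =
     of_real (1 - t) * of_bool (i = j) + of_real t * of_bool (i = j)"
    by (simp only: sum.distrib flip: sum_distrib_left)
  then show "(\<Sum>a<n. of_real (1 - t) * c (i, a) (j, a) + of_real t * c' (i, a) (j, a)) = of_bool (i = j)"
    by (simp flip: distrib_right)
qed

lemma kernel_comp_linear_left:
  "kernel_comp m (\<lambda>p q. s * c p q + t * c' p q) d p q = s * kernel_comp m c d p q + t * kernel_comp m c' d p q"
  by (simp add: kernel_comp_def algebra_simps sum.distrib sum_distrib_left)

text \<open>The premise \<open>key\<close> is (ii) on the system of the input of \<Phi>2, with the
  left supremum replaced by its value at the identity channel. It is the common consequence through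
  which (ii) and (iii) both lead back to (i).\<close>

lemma delta_pre_le_of_key:
  assumes ch: "channel m1 n \<Phi>1" "channel m n \<Phi>2" and pos: "0 < m1" "0 < m" "0 < n" and \<epsilon>: "0 \<le> \<epsilon>"
    and key: "\<And>\<rho>. pos_kernel (grid m n) \<rho> \<Longrightarrow> (\<Sum>p\<in>grid m n. \<rho> p p) = 1 \<Longrightarrow>
      Re (kernel_pair (grid m n) \<rho> (choi_kernel m \<Phi>2)) \<le> pre_val m m1 n (choi_kernel m1 \<Phi>1) \<rho> + \<epsilon> / 2 * cond_val m n \<rho>"
  shows "delta_pre m1 m n \<Phi>1 \<Phi>2 \<le> \<epsilon>"
proof (rule delta_pre_leI[OF ch])
  fix \<eta>0 :: real assume \<eta>0: "0 < \<eta>0"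
  \<comment> \<open>\<eta> times the identity has partial trace \<open>\<eta> * n\<close>, and the
    diamond norm bound doubles it, which adds up to the allowed \<open>\<eta>0\<close>.\<close>
  define \<eta> where "\<eta> = \<eta>0 / (2 * n)"
  have \<eta>: "0 < \<eta>" "2 * (\<eta> * n) = \<eta>0" using \<eta>0 pos by (auto simp: \<eta>_def)
  let ?I = "grid m n"
  define J1 where "J1 = choi_kernel m1 \<Phi>1"
  define J2 where "J2 = choi_kernel m \<Phi>2"
  have J1: "chan_kernel m1 n J1" and J2: "chan_kernel m n J2"
    using ch by (auto simp: J1_def J2_def intro: channel_chan_kernel)
  define D where "D L \<gamma> = (\<lambda>p q. kernel_comp m1 L J1 p q + of_real (\<epsilon> / 2) * \<gamma> p q - J2 p q)" for L \<gamma>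
  define C where "C = {D L \<gamma> | L \<gamma>. chan_kernel m m1 L \<and> chan_kernel m n \<gamma>}"
  have "(\<exists>c\<in>C. pos_kernel ?I (\<lambda>p q. c p q + of_real \<eta> * of_bool (p = q))) \<or>
    (\<exists>Y t. pos_kernel ?I Y \<and> (\<Sum>p\<in>?I. Y p p) = 1 \<and> 0 < t \<and> (\<forall>c\<in>C. Re (kernel_pair ?I Y c) \<le> - t))"
  proof (rule pos_kernel_alternative)
    show "C \<noteq> {}" unfolding C_def using chan_kernel_depol pos by blast
    show "herm_kernel ?I c" if c: "c \<in> C" for c
    proof -
      obtain L \<gamma> where L: "c = D L \<gamma>" "chan_kernel m m1 L" "chan_kernel m n \<gamma>" using c unfolding C_def by blast
      show ?thesis unfolding L(1) D_def
        by (rule herm_kernel_diff[OF herm_kernel_add[OF chan_kernel_herm_kernel[OF chan_kernel_comp[OF L(2) J1]]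
            herm_kernel_scale[OF chan_kernel_herm_kernel[OF L(3)]]] chan_kernel_herm_kernel[OF J2]])
    qed
    fix x y t assume x: "x \<in> C" and y: "y \<in> C" and t: "0 \<le> t" "t \<le> (1::real)"
    obtain L \<gamma> where x': "x = D L \<gamma>" "chan_kernel m m1 L" "chan_kernel m n \<gamma>" using x unfolding C_def by blast
    obtain L' \<gamma>' where y': "y = D L' \<gamma>'" "chan_kernel m m1 L'" "chan_kernel m n \<gamma>'" using y unfolding C_def by blast
    have interp: "(1 - s) * (a + e * g - z) + s * (a' + e * g' - z) =
        (1 - s) * a + s * a' + e * ((1 - s) * g + s * g') - z" for s e a a' g g' z :: complex
      by (simp add: algebra_simps)
    have "(\<lambda>p q. of_real (1 - t) * x p q + of_real t * y p q) =
       D (\<lambda>p q. of_real (1 - t) * L p q + of_real t * L' p q) (\<lambda>p q. of_real (1 - t) * \<gamma> p q + of_real t * \<gamma>' p q)"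
      unfolding x'(1) y'(1) D_def kernel_comp_linear_left of_real_diff of_real_1
      by (intro ext) (rule interp)
    then show "(\<lambda>p q. of_real (1 - t) * x p q + of_real t * y p q) \<in> C"
      unfolding C_def using chan_kernel_convex[OF x'(2) y'(2) t] chan_kernel_convex[OF x'(3) y'(3) t] by blast
  qed (use \<eta>(1) in auto)
  then show "\<exists>\<Lambda>. channel m m1 \<Lambda> \<and> dnorm m n (\<lambda>X. \<Phi>1 (\<Lambda> X) - \<Phi>2 X) \<le> \<epsilon> + \<eta>0"
  proof (elim disjE bexE exE conjE)
    fix c assume c: "c \<in> C" "pos_kernel ?I (\<lambda>p q. c p q + of_real \<eta> * of_bool (p = q))"
    obtain L \<gamma> where L: "c = D L \<gamma>" "chan_kernel m m1 L" "chan_kernel m n \<gamma>" using c(1) unfolding C_def by blast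
    define \<Lambda> where "\<Lambda> = map_of_kernel m m1 L"
    have \<Lambda>: "channel m m1 \<Lambda>" unfolding \<Lambda>_def by (rule chan_kernel_channel[OF L(2)])
    \<comment> \<open>\<open>H\<close> dominates the kernel of \<Phi>2 minus that of \<Phi>1 after
      \<Lambda>, and \<open>G\<close> is the surplus. Thus \<open>G - H\<close> is the required
      difference, both parts are positive, and their partial traces agree because those of the two
      channels cancel.\<close>
    define H where "H p q = of_real (\<epsilon> / 2) * \<gamma> p q + of_real \<eta> * of_bool (p = q)" for p q
    define G where "G p q = kernel_comp m1 L J1 p q - J2 p q + H p q" for p q
    have posG: "pos_kernel ?I G"
      by (rule pos_kernel_cong[OF c(2)]) (simp add: G_def H_def L(1) D_def)
    have posH: "pos_kernel ?I H"
      unfolding H_def using L(3) \<epsilon> \<eta>(1)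
      by (intro pos_kernel_add pos_kernel_scale pos_kernel_delta) (auto simp: chan_kernel_def)
    have trH: "(\<Sum>a<n. H (i, a) (j, a)) = of_real (\<epsilon> / 2 + \<eta> * n) * of_bool (i = j)" if "i < m" "j < m" for i j
    proof -
      have "(\<Sum>a<n. H (i, a) (j, a)) = of_real (\<epsilon> / 2) * (\<Sum>a<n. \<gamma> (i, a) (j, a)) + of_nat n * (of_real \<eta> * of_bool (i = j))"
        unfolding H_def sum.distrib sum_distrib_left by simp
      also have "(\<Sum>a<n. \<gamma> (i, a) (j, a)) = of_bool (i = j)" using L(3) that by (simp add: chan_kernel_def)
      finally show ?thesis by (simp add: algebra_simps)
    qed
    have trG: "(\<Sum>a<n. G (i, a) (j, a)) = of_real (\<epsilon> / 2 + \<eta> * n) * of_bool (i = j)" if "i < m" "j < m" for i j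
    proof -
      have "(\<Sum>a<n. kernel_comp m1 L J1 (i, a) (j, a)) = of_bool (i = j)" "(\<Sum>a<n. J2 (i, a) (j, a)) = of_bool (i = j)"
        using chan_kernel_comp[OF L(2) J1] J2 that by (auto simp: chan_kernel_def)
      then show ?thesis unfolding G_def sum.distrib sum_subtractf trH[OF that] by simp
    qed
    interpret diff_map m n "\<lambda>X. \<Phi>1 (\<Lambda> X) - \<Phi>2 X" G H "\<epsilon> / 2 + \<eta> * n"
    proof
      fix X :: "complex mat" and a b assume h: "X \<in> carrier_mat m m" "a < n" "b < n"
      have "kernel_comp m1 (choi_kernel m \<Lambda>) (choi_kernel m1 \<Phi>1) (i, a) (j, b) = kernel_comp m1 L J1 (i, a) (j, b)" if "i < m" "j < m" for i j
        unfolding J1_def \<Lambda>_def using that h by (intro kernel_comp_cong[of m m1 _ _ _ n] choi_kernel_map_of_kernel) auto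
      then show "(\<Phi>1 (\<Lambda> X) - \<Phi>2 X) $$ (a, b) = (\<Sum>i<m. \<Sum>j<m. X $$ (i, j) * (G (i, a) (j, b) - H (i, a) (j, b)))"
        unfolding pre_diff_expand[OF ch \<Lambda> h] by (simp add: G_def J2_def)
    qed (use posG posH trG trH \<epsilon> \<eta>(1) in auto)
    have "2 * (\<epsilon> / 2 + \<eta> * n) = \<epsilon> + \<eta>0" using \<eta>(2) by simp
    then show ?thesis using \<Lambda> dnorm_le by metis
  next
    fix Y t assume Y: "pos_kernel ?I Y" "(\<Sum>p\<in>?I. Y p p) = 1" "0 < t" and le: "\<forall>c\<in>C. Re (kernel_pair ?I Y c) \<le> - t"
    have main: "Re (kernel_pair ?I Y (kernel_comp m1 L J1)) + \<epsilon> / 2 * Re (kernel_pair ?I Y \<gamma>) \<le> Re (kernel_pair ?I Y J2) - t"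
      if "chan_kernel m m1 L" "chan_kernel m n \<gamma>" for L \<gamma>
    proof -
      have "D L \<gamma> \<in> C" unfolding C_def using that by blast
      then have "Re (kernel_pair ?I Y (D L \<gamma>)) \<le> - t" using le by blast
      moreover have "kernel_pair ?I Y (D L \<gamma>) = kernel_pair ?I Y (kernel_comp m1 L J1) + of_real (\<epsilon> / 2) * kernel_pair ?I Y \<gamma> - kernel_pair ?I Y J2"
        unfolding D_def kernel_pair_diff_right kernel_pair_add_right kernel_pair_scale_right ..
      ultimately show ?thesis by simp
    qed
    have 1: "\<epsilon> / 2 * Re (kernel_pair ?I Y \<gamma>) \<le> Re (kernel_pair ?I Y J2) - t - pre_val m m1 n J1 Y"
      if "chan_kernel m n \<gamma>" for \<gamma>
    proof -
      have "pre_val m m1 n J1 Y \<le> Re (kernel_pair ?I Y J2) - t - \<epsilon> / 2 * Re (kernel_pair ?I Y \<gamma>)"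
        using main[OF _ that] by (intro pre_val_least[OF pos(1)]) (simp add: le_diff_eq)
      then show ?thesis by simp
    qed
    \<comment> \<open>The supremum over \<gamma> is formed after division by \<epsilon> / 2. For
      \<epsilon> = 0 the term vanishes, and the instance of \<open>1\<close> at any channel kernel,
      here \<open>J2\<close>, is enough.\<close>
    have 2: "\<epsilon> / 2 * cond_val m n Y \<le> Re (kernel_pair ?I Y J2) - t - pre_val m m1 n J1 Y"
    proof (cases "\<epsilon> = 0")
      case True
      then show ?thesis using 1[OF J2] by simp
    next
      case False
      with \<epsilon> have \<epsilon>p: "\<epsilon> > 0" by simp
      have "cond_val m n Y \<le> (Re (kernel_pair ?I Y J2) - t - pre_val m m1 n J1 Y) / (\<epsilon> / 2)"
        by (rule cond_val_least[OF pos(3)]) (use 1 \<epsilon>p in \<open>simp add: field_simps\<close>)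
      then show ?thesis using \<epsilon>p by (simp add: field_simps)
    qed
    have "Re (kernel_pair ?I Y J2) \<le> pre_val m m1 n J1 Y + \<epsilon> / 2 * cond_val m n Y"
      using key[OF Y(1,2)] by (simp add: J1_def J2_def)
    with 2 Y(3) show ?thesis by simp
  qed
qed

section \<open>Duality for the conditional diamond norm\<close>

lemma pos_kernel_tensor_delta:
  assumes "finite R" "finite S" "pos_kernel R Z"
  shows "pos_kernel (R \<times> S) (\<lambda>p q. Z (fst p) (fst q) * of_bool (snd p = snd q))"
proof -
  obtain g where g: "\<And>p q. p \<in> R \<Longrightarrow> q \<in> R \<Longrightarrow> Z p q = (\<Sum>k<card R. g k p * cnj (g k q))"
    using pos_kernel_gramE[OF assms(1,3)] by blast
  show ?thesis
  proof (rule pos_kernel_gramI[where K = "S \<times> {..<card R}" and g = "\<lambda>k p. g (snd k) (fst p) * of_bool (snd p = fst k)"])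
    fix p q assume pq: "p \<in> R \<times> S" "q \<in> R \<times> S"
    have "(\<Sum>k\<in>S \<times> {..<card R}. g (snd k) (fst p) * of_bool (snd p = fst k) * cnj (g (snd k) (fst q) * of_bool (snd q = fst k))) =
      (\<Sum>c\<in>S. if c = snd p then (\<Sum>k<card R. g k (fst p) * cnj (g k (fst q))) * of_bool (snd p = snd q) else 0)"
      unfolding sum.cartesian_product' by (intro sum.cong refl) (auto simp: sum_distrib_right)
    then show "Z (fst p) (fst q) * of_bool (snd p = snd q) =
      (\<Sum>k\<in>S \<times> {..<card R}. g (snd k) (fst p) * of_bool (snd p = fst k) * cnj (g (snd k) (fst q) * of_bool (snd q = fst k)))"
      using pq assms(2) g by auto
  qed
qed

lemma cond_val_nonneg:
  assumes "0 < n" "pos_kernel (grid r n) \<rho>"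
  shows "0 \<le> cond_val r n \<rho>"
proof -
  have c: "chan_kernel r n (\<lambda>p q. of_real (1 / n) * of_bool (p = q))" by (rule chan_kernel_depol[OF assms(1)])
  have "0 \<le> kernel_pair (grid r n) \<rho> (\<lambda>p q. of_real (1 / n) * of_bool (p = q))"
    by (rule kernel_pair_nonneg) (use c assms(2) in \<open>auto simp: chan_kernel_def\<close>)
  then show ?thesis using cond_val_upper[OF c, of \<rho>] by (simp add: less_eq_complex_def)
qed

text \<open>Were no \<sigma> feasible, the separating \<open>Y\<close> could be divided by slightly
  more than the top eigenvalue of its partial trace and completed to a channel kernel, whose pairing
  with \<rho> would exceed the supremum \<open>N\<close>.\<close>

lemma cond_val_dual:
  assumes pos: "0 < r" "0 < n" and \<rho>: "pos_kernel (grid r n) \<rho>" and \<eta>: "0 < \<eta>"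
  shows "\<exists>\<sigma>. pos_kernel {..<r} \<sigma> \<and> (\<Sum>i<r. \<sigma> i i) = 1 \<and>
    pos_kernel (grid r n) (\<lambda>p q. of_real (cond_val r n \<rho>) * \<sigma> (fst p) (fst q) * of_bool (snd p = snd q)
       - \<rho> p q + of_real \<eta> * of_bool (p = q))"
proof -
  let ?I = "grid r n"
  define N where "N = cond_val r n \<rho>"
  have N0: "0 \<le> N" unfolding N_def by (rule cond_val_nonneg[OF pos(2) \<rho>])
  define D where "D \<sigma> = (\<lambda>p q. of_real N * \<sigma> (fst p) (fst q) * of_bool (snd p = snd q) - \<rho> p q)" for \<sigma> :: "nat \<Rightarrow> nat \<Rightarrow> complex"
  define C where "C = {D \<sigma> | \<sigma>. pos_kernel {..<r} \<sigma> \<and> (\<Sum>i<r. \<sigma> i i) = 1}"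
  have tens: "pos_kernel ?I (\<lambda>p q. \<sigma> (fst p) (fst q) * of_bool (snd p = snd q))" if "pos_kernel {..<r} \<sigma>" for \<sigma>
    by (rule pos_kernel_tensor_delta[OF _ _ that]) auto
  have "(\<exists>c\<in>C. pos_kernel ?I (\<lambda>p q. c p q + of_real \<eta> * of_bool (p = q))) \<or>
    (\<exists>Y t. pos_kernel ?I Y \<and> (\<Sum>p\<in>?I. Y p p) = 1 \<and> 0 < t \<and> (\<forall>c\<in>C. Re (kernel_pair ?I Y c) \<le> - t))"
  proof (rule pos_kernel_alternative)
    have "pos_kernel {..<r} (\<lambda>p q. of_real (1 / r) * of_bool (p = q))"
      by (intro pos_kernel_scale pos_kernel_delta) auto
    moreover have "(\<Sum>i<r. of_real (1 / r) * of_bool (i = i)) = (1 :: complex)" using pos by simp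
    ultimately show "C \<noteq> {}" unfolding C_def by blast
    show "herm_kernel ?I c" if c: "c \<in> C" for c
    proof -
      obtain \<sigma> where \<sigma>: "c = D \<sigma>" "pos_kernel {..<r} \<sigma>" using c unfolding C_def by blast
      show ?thesis unfolding \<sigma>(1) D_def mult.assoc
        by (intro herm_kernel_diff herm_kernel_scale pos_kernel_herm[OF _ tens[OF \<sigma>(2)]] pos_kernel_herm[OF _ \<rho>]) auto
    qed
    fix x y t assume x: "x \<in> C" and y: "y \<in> C" and t: "0 \<le> t" "t \<le> (1::real)"
    obtain \<sigma> where x': "x = D \<sigma>" "pos_kernel {..<r} \<sigma>" "(\<Sum>i<r. \<sigma> i i) = 1" using x unfolding C_def by blast
    obtain \<sigma>' where y': "y = D \<sigma>'" "pos_kernel {..<r} \<sigma>'" "(\<Sum>i<r. \<sigma>' i i) = 1" using y unfolding C_def by blast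
    define \<tau> where "\<tau> p q = of_real (1 - t) * \<sigma> p q + of_real t * \<sigma>' p q" for p q
    have "(\<lambda>p q. of_real (1 - t) * x p q + of_real t * y p q) = D \<tau>"
      unfolding x'(1) y'(1) D_def \<tau>_def by (intro ext) (simp add: algebra_simps)
    moreover have "pos_kernel {..<r} \<tau>" unfolding \<tau>_def
      using t by (intro pos_kernel_add pos_kernel_scale x'(2) y'(2)) auto
    moreover have "(\<Sum>i<r. \<tau> i i) = 1"
      unfolding \<tau>_def sum.distrib sum_distrib_left[symmetric] x'(3) y'(3) by simp
    ultimately show "(\<lambda>p q. of_real (1 - t) * x p q + of_real t * y p q) \<in> C" unfolding C_def by blast
  qed (use \<eta> in auto)
  then show ?thesis
  proof (elim disjE bexE exE conjE)
    fix c assume c: "c \<in> C" "pos_kernel ?I (\<lambda>p q. c p q + of_real \<eta> * of_bool (p = q))"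
    obtain \<sigma> where \<sigma>: "c = D \<sigma>" "pos_kernel {..<r} \<sigma>" "(\<Sum>i<r. \<sigma> i i) = 1" using c(1) unfolding C_def by blast
    then show ?thesis using c(2) unfolding D_def N_def by blast
  next
    fix Y t assume Y: "pos_kernel ?I Y" "(\<Sum>p\<in>?I. Y p p) = 1" "0 < t" and le: "\<forall>c\<in>C. Re (kernel_pair ?I Y c) \<le> - t"
    define y where "y i j = (\<Sum>a<n. Y (i, a) (j, a))" for i j
    have posy: "pos_kernel {..<r} y" unfolding y_def
      by (intro pos_kernel_sum pos_kernel_pullback[OF _ Y(1)]) auto
    have Yt: "kernel_pair ?I Y (\<lambda>p q. \<sigma> (fst p) (fst q) * of_bool (snd p = snd q)) = kernel_pair {..<r} y \<sigma>" for \<sigma>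
    proof -
      have "kernel_pair ?I Y (\<lambda>p q. \<sigma> (fst p) (fst q) * of_bool (snd p = snd q)) =
        (\<Sum>i<r. \<Sum>j<r. \<Sum>a<n. \<Sum>b<n. if b = a then Y (i, a) (j, a) * \<sigma> i j else 0)"
        unfolding kernel_pair_prod by (intro sum.cong refl) auto
      then show ?thesis by (simp add: kernel_pair_def y_def sum_distrib_right)
    qed
    obtain v d where v: "onb {..<r} v" "\<forall>j<r. 0 \<le> d j"
      "\<forall>p\<in>{..<r}. \<forall>q\<in>{..<r}. y p q = (\<Sum>j<r. of_real (d j) * v j p * cnj (v j q))"
      using pos_kernel_spectral[OF _ posy] by auto
    \<comment> \<open>The gap is evaluated at the pure state on each eigenvector of
      \<open>y\<close>, conjugated because the pairing is bilinear.\<close>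
    have low: "N * d j + t \<le> Re (kernel_pair ?I Y \<rho>)" if j: "j < r" for j
    proof -
      define \<sigma> where "\<sigma> p q = cnj (v j p) * cnj (cnj (v j q))" for p q
      have "pos_kernel {..<r} \<sigma>" unfolding \<sigma>_def by (rule pos_kernel_rank1)
      moreover have "(\<Sum>i<r. \<sigma> i i) = 1"
        using v(1) j by (simp add: \<sigma>_def onb_def inner_on_def)
      ultimately have "D \<sigma> \<in> C" unfolding C_def by blast
      then have "Re (kernel_pair ?I Y (D \<sigma>)) \<le> - t" using le by blast
      moreover have "kernel_pair ?I Y (D \<sigma>) = of_real N * kernel_pair {..<r} y \<sigma> - kernel_pair ?I Y \<rho>"
        unfolding D_def mult.assoc kernel_pair_diff_right kernel_pair_scale_right Yt ..
      moreover have "kernel_pair {..<r} y \<sigma> = of_real (d j)"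
        unfolding \<sigma>_def kernel_pair_rank1 unfolding complex_cnj_cnj
        by (rule sform_spectral[of "{..<r}", unfolded card_lessThan, OF v(1) _ j]) (use v(3) in blast)
      ultimately show ?thesis by simp
    qed
    define \<kappa> where "\<kappa> = Max (d ` {..<r})"
    have "\<kappa> \<in> d ` {..<r}" unfolding \<kappa>_def using pos by (intro Max_in) auto
    then obtain j0 where j0: "j0 < r" "\<kappa> = d j0" by auto
    have d\<kappa>: "d j \<le> \<kappa>" if "j < r" for j unfolding \<kappa>_def using that by (intro Max_ge) auto
    \<comment> \<open>Raising the top eigenvalue by \<theta> makes the divisor strictly positive;
      \<open>N * \<theta> < t\<close> ensures that this does not use up the gap.\<close>
    define \<theta> where "\<theta> = t / (N + 1)"
    have \<theta>: "0 < \<theta>" "N * \<theta> < t" using N0 Y(3) by (auto simp: \<theta>_def field_simps)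
    define \<kappa>' where "\<kappa>' = \<kappa> + \<theta>"
    have \<kappa>0: "0 \<le> \<kappa>" using v(2) j0 by simp
    then have \<kappa>': "0 < \<kappa>'" using \<theta>(1) by (simp add: \<kappa>'_def)
    \<comment> \<open>The part of the identity that the partial trace of the scaled \<open>Y\<close>
      leaves uncovered. Spread uniformly over the output, it completes a channel kernel and can only
      increase the pairing with \<rho>.\<close>
    define Z where "Z p q = of_bool (p = q) - of_real (1 / \<kappa>') * y p q" for p q
    have posZ: "pos_kernel {..<r} Z"
    proof (rule pos_kernel_cong)
      show "pos_kernel {..<r} (\<lambda>p q. \<Sum>j<r. of_real (1 - d j / \<kappa>') * (v j p * cnj (v j q)))"
      proof (intro pos_kernel_sum pos_kernel_scale pos_kernel_rank1)
        fix j assume "j \<in> {..<r}"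
        then have "d j \<le> \<kappa>'" using d\<kappa>[of j] \<theta>(1) by (simp add: \<kappa>'_def)
        then show "0 \<le> 1 - d j / \<kappa>'" using \<kappa>' by (simp add: field_simps)
      qed
      fix p q assume pq: "p \<in> {..<r}" "q \<in> {..<r}"
      have "(\<Sum>j<r. of_real (1 - d j / \<kappa>') * (v j p * cnj (v j q))) =
         (\<Sum>j<r. v j p * cnj (v j q)) - of_real (1 / \<kappa>') * (\<Sum>j<r. of_real (d j) * v j p * cnj (v j q))"
        unfolding sum_distrib_left sum_subtractf[symmetric] by (intro sum.cong refl) (simp add: algebra_simps)
      also have "\<dots> = Z p q" using v(1,3) pq by (simp add: Z_def onb_def)
      finally show "Z p q = (\<Sum>j<r. of_real (1 - d j / \<kappa>') * (v j p * cnj (v j q)))" ..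
    qed
    define c where "c p q = of_real (1 / \<kappa>') * Y p q + of_real (1 / n) * (Z (fst p) (fst q) * of_bool (snd p = snd q))" for p q
    have "chan_kernel r n c"
      unfolding chan_kernel_def
    proof (intro conjI allI impI)
      show "pos_kernel ?I c" unfolding c_def using \<kappa>'
        by (intro pos_kernel_add pos_kernel_scale Y(1) tens posZ) auto
      fix i j assume "i < r" "j < r"
      have "(\<Sum>a<n. c (i, a) (j, a)) = of_real (1 / \<kappa>') * y i j + of_nat n * (of_real (1 / n) * Z i j)"
        unfolding c_def y_def sum.distrib sum_distrib_left by simp
      also have "\<dots> = of_bool (i = j)" using pos by (simp add: Z_def)
      finally show "(\<Sum>a<n. c (i, a) (j, a)) = of_bool (i = j)" .
    qed
    then have "Re (kernel_pair ?I \<rho> c) \<le> N" unfolding N_def by (rule cond_val_upper)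
    moreover have "Re (kernel_pair ?I Y \<rho>) / \<kappa>' \<le> Re (kernel_pair ?I \<rho> c)"
    proof -
      have "0 \<le> kernel_pair ?I \<rho> (\<lambda>p q. of_real (1 / n) * (Z (fst p) (fst q) * of_bool (snd p = snd q)))"
        by (intro kernel_pair_nonneg[OF _ \<rho>] pos_kernel_scale tens posZ) auto
      moreover have "kernel_pair ?I \<rho> c = of_real (1 / \<kappa>') * kernel_pair ?I Y \<rho> + kernel_pair ?I \<rho> (\<lambda>p q. of_real (1 / n) * (Z (fst p) (fst q) * of_bool (snd p = snd q)))"
        unfolding c_def kernel_pair_add_right kernel_pair_scale_right[of ?I \<rho> "of_real (1 / \<kappa>')"] kernel_pair_commute[of ?I \<rho> Y] ..
      ultimately show ?thesis by (simp add: less_eq_complex_def)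
    qed
    ultimately have "Re (kernel_pair ?I Y \<rho>) / \<kappa>' \<le> N" by (rule order_trans[rotated])
    then have "Re (kernel_pair ?I Y \<rho>) \<le> N * \<kappa>'" using \<kappa>' by (simp add: pos_divide_le_eq)
    then have "N * \<kappa> + t \<le> N * \<kappa> + N * \<theta>" using low[OF j0(1)] unfolding \<kappa>'_def j0(2) by (simp add: distrib_left)
    with \<theta>(2) show ?thesis by simp
  qed
qed

text \<open>Compression of the \<open>R\<close> factor by the vectors \<open>w\<close>, whose labels
  become the second index; the Gram vectors are compressed in the same way.\<close>

lemma pos_kernel_slice:
  assumes "finite R" "finite S" "pos_kernel (R \<times> S) A"
  shows "pos_kernel (S \<times> T) (\<lambda>p q. sform R (\<lambda>x y. A (x, fst p) (y, fst q)) (w (snd p)) (w (snd q)))"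
proof -
  obtain g where g: "\<And>p q. p \<in> R \<times> S \<Longrightarrow> q \<in> R \<times> S \<Longrightarrow> A p q = (\<Sum>k<card (R \<times> S). g k p * cnj (g k q))"
    using pos_kernel_gramE[OF _ assms(3)] assms(1,2) by blast
  show ?thesis
  proof (rule pos_kernel_gramI[where K = "{..<card (R \<times> S)}" and g = "\<lambda>k p. \<Sum>x\<in>R. cnj (w (snd p) x) * g k (x, fst p)"])
    fix p q assume pq: "p \<in> S \<times> T" "q \<in> S \<times> T"
    have "sform R (\<lambda>x y. A (x, fst p) (y, fst q)) (w (snd p)) (w (snd q)) =
       (\<Sum>x\<in>R. \<Sum>y\<in>R. \<Sum>k<card (R \<times> S). (cnj (w (snd p) x) * g k (x, fst p)) * cnj (cnj (w (snd q) y) * g k (y, fst q)))"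
      unfolding sform_def
    proof (intro sum.cong refl)
      fix x y assume xy: "x \<in> R" "y \<in> R"
      have m: "(x, fst p) \<in> R \<times> S" "(y, fst q) \<in> R \<times> S" using pq xy by auto
      show "cnj (w (snd p) x) * A (x, fst p) (y, fst q) * w (snd q) y =
         (\<Sum>k<card (R \<times> S). (cnj (w (snd p) x) * g k (x, fst p)) * cnj (cnj (w (snd q) y) * g k (y, fst q)))"
        unfolding g[OF m] by (simp add: sum_distrib_left sum_distrib_right mult_ac)
    qed
    also have "\<dots> = (\<Sum>k<card (R \<times> S). \<Sum>x\<in>R. \<Sum>y\<in>R. (cnj (w (snd p) x) * g k (x, fst p)) * cnj (cnj (w (snd q) y) * g k (y, fst q)))"
      by (rule sum_swap3)
    also have "\<dots> = (\<Sum>k<card (R \<times> S). (\<Sum>x\<in>R. cnj (w (snd p) x) * g k (x, fst p)) * cnj (\<Sum>x\<in>R. cnj (w (snd q) x) * g k (x, fst q)))"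
      by (simp add: sum_product)
    finally show "sform R (\<lambda>x y. A (x, fst p) (y, fst q)) (w (snd p)) (w (snd q)) = \<dots>" .
  qed
qed

text \<open>With \<open>S\<close> a square root of \<open>T\<close>, the operator \<open>\<rho>\<close> becomes \<open>S \<tau> S\<close> with \<open>0 \<le> \<tau> \<le> 1\<close>, and the
  pairing with the difference of two channels is \<open>Tr T\<close> times the pairing of \<open>\<tau>\<close> with the image of
  the purification of \<open>T / Tr T\<close>.\<close>

lemma (in diff_map) kernel_pair_diff_le_dnorm:
  assumes \<rho>: "pos_kernel (grid m n) \<rho>"
    and T0: "pos_kernel {..<m} T0" and \<eta>: "0 < \<eta>" and m: "0 < m"
    and T_def: "\<And>p q. T p q = T0 p q + of_real \<eta> * of_bool (p = q)"
    and trT: "(\<Sum>i<m. T i i) = of_real N"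
    and le: "pos_kernel (grid m n) (\<lambda>p q. T (fst p) (fst q) * of_bool (snd p = snd q) - \<rho> p q)"
  shows "Re (kernel_pair (grid m n) \<rho> (\<lambda>p q. H p q - G p q)) \<le> N * dnorm m n \<Delta> / 2"
proof -
  have "pos_kernel {..<m} (\<lambda>p q. T0 p q + of_real \<eta> * of_bool (p = q))"
    by (intro pos_kernel_add T0 pos_kernel_scale pos_kernel_delta) (use \<eta> in auto)
  then have posT: "pos_kernel {..<m} T" by (rule pos_kernel_cong) (rule T_def)
  obtain v d where v: "onb {..<m} v"
      "\<forall>p\<in>{..<m}. \<forall>q\<in>{..<m}. T p q = (\<Sum>j<m. of_real (d j) * v j p * cnj (v j q))"
    using pos_kernel_spectral[OF _ posT] by auto
  have onb: "inner_on {..<m} (v j) (v k) = of_bool (j = k)" if "j < m" "k < m" for j k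
    using v(1) that by (simp add: onb_def)
  \<comment> \<open>The multiple of the identity inside \<open>T\<close> keeps its eigenvalues away
    from zero, so that the square root can be inverted below.\<close>
  have d: "\<eta> \<le> d j" if j: "j < m" for j
  proof -
    have "sform {..<m} T (v j) (v j) = of_real (d j)"
      by (rule sform_spectral[of "{..<m}", unfolded card_lessThan, OF v(1) _ j]) (use v(2) in blast)
    moreover have "T = (\<lambda>p q. T0 p q + of_real \<eta> * of_bool (p = q))" using T_def by blast
    then have "sform {..<m} T (v j) (v j) = sform {..<m} T0 (v j) (v j) + of_real \<eta> * sform {..<m} (\<lambda>p q. of_bool (p = q)) (v j) (v j)"
      by (simp add: sform_kernel_add sform_kernel_scale)
    moreover have "sform {..<m} (\<lambda>p q. of_bool (p = q)) (v j) (v j) = inner_on {..<m} (v j) (v j)"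
    proof -
      have "sform {..<m} (\<lambda>p q. of_bool (p = q)) (v j) (v j) = (\<Sum>p<m. \<Sum>q<m. if q = p then cnj (v j p) * v j p else 0)"
        unfolding sform_def by (intro sum.cong refl) auto
      then show ?thesis by (simp add: inner_on_def)
    qed
    moreover have "0 \<le> sform {..<m} T0 (v j) (v j)" using T0 by (simp add: pos_kernel_def)
    ultimately show ?thesis using onb[OF j j] by (auto simp: less_eq_complex_def complex_eq_iff)
  qed
  then have dpos: "0 < d j" if "j < m" for j using \<eta> that by fastforce
  have sumd: "(\<Sum>j<m. d j) = N"
  proof -
    have "complex_of_real (\<Sum>j<m. d j) = (\<Sum>i<m. T i i)"
      using onb_trace[OF v(1), of "\<lambda>j. of_real (d j)"] v(2) by simp
    then show ?thesis unfolding trT by (simp only: of_real_eq_iff)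
  qed
  have N: "0 < N" unfolding sumd[symmetric] using m dpos by (intro sum_pos) auto
  have sq: "of_real (sqrt (d j)) * of_real (sqrt (d j)) = complex_of_real (d j)" "sqrt (d j) > 0" if "j < m" for j
    using dpos[OF that] by (auto simp flip: of_real_mult)
  \<comment> \<open>The unnormalised purification of \<open>T\<close>: each eigenvector, scaled by
    the root of its eigenvalue, is paired with its own label on the ancilla. Its squared norm is the
    trace \<open>N\<close>.\<close>
  define \<xi> where "\<xi> z = of_real (sqrt (d (snd z))) * v (snd z) (fst z)" for z :: "nat \<times> nat"
  define X where "X = mat (m * m) (m * m) (\<lambda>(p, q). of_real (1 / N) * (\<xi> (p div m, p mod m) * cnj (\<xi> (q div m, q mod m))))"
  have carX: "X \<in> carrier_mat (m * m) (m * m)" by (simp add: X_def)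
  have bkX: "bip_kernel m X p q = of_real (1 / N) * (\<xi> p * cnj (\<xi> q))" if "p \<in> grid m m" "q \<in> grid m m" for p q
    using that by (auto simp: bip_kernel_def X_def pair_index_less)
  have psdX: "psd (m * m) X"
    by (rule psd_of_kernel[OF carX pos_kernel_scale[OF pos_kernel_rank1[of _ \<xi>], of "1 / N"]])
       (use N in \<open>auto simp: X_def\<close>)
  have "mtrace X = 1"
  proof -
    have "mtrace X = (\<Sum>x<m. \<Sum>j<m. of_real (1 / N) * (\<xi> (x, j) * cnj (\<xi> (x, j))))"
      unfolding mtrace_bip_kernel[OF carX] sum.cartesian_product' by (intro sum.cong refl bkX) auto
    also have "\<dots> = of_real (1 / N) * (\<Sum>x<m. \<Sum>j<m. of_real (d j) * v j x * cnj (v j x))"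
      unfolding sum_distrib_left
    proof (intro sum.cong refl)
      fix x j assume "j \<in> {..<m}"
      then have "of_real (d j) = of_real (sqrt (d j)) * complex_of_real (sqrt (d j))" using sq by simp
      then show "of_real (1 / N) * (\<xi> (x, j) * cnj (\<xi> (x, j))) = of_real (1 / N) * (of_real (d j) * v j x * cnj (v j x))"
        by (simp add: \<xi>_def)
    qed
    also have "\<dots> = of_real (1 / N) * (\<Sum>x<m. T x x)" using v(2) by simp
    finally show ?thesis using N unfolding trT by simp
  qed
  then have "trace_norm X = 1" using trace_norm_psd[OF psdX] by simp
  define D where "D = tensor_id m n m \<Delta> X"
  have carD: "D \<in> carrier_mat (n * m) (n * m)" by (simp add: D_def tensor_id_def)
  have Dn: "trace_norm D \<le> dnorm m n \<Delta>"
    unfolding D_def using \<open>trace_norm X = 1\<close> by (intro dnorm_upper[OF carX]) simp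
  define F where "F p q = G p q - H p q" for p q
  have hermF: "F q p = cnj (F p q)" if "p \<in> grid m n" "q \<in> grid m n" for p q
  proof -
    have "herm_kernel (grid m n) F"
      unfolding F_def by (rule herm_kernel_diff[OF pos_kernel_herm[OF _ G(1)] pos_kernel_herm[OF _ H(1)]]) auto
    then show ?thesis using that unfolding herm_kernel_def by blast
  qed
  have trF: "(\<Sum>a<n. F (i, a) (j, a)) = 0" if "i < m" "j < m" for i j
    using G(2)[OF that] H(2)[OF that] by (simp add: F_def sum_subtractf)
  have bkD: "bip_kernel m D (a, z) (b, w) = (\<Sum>x<m. \<Sum>y<m. of_real (1 / N) * (\<xi> (x, z) * cnj (\<xi> (y, w))) * F (x, a) (y, b))"
    if "a < n" "b < n" "z < m" "w < m" for a b z w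
  proof -
    have "bip_kernel m D (a, z) (b, w) = (\<Sum>x<m. \<Sum>y<m. bip_kernel m X (x, z) (y, w) * F (x, a) (y, b))"
      using that by (simp add: bip_kernel_def D_def tensor_id_def pair_index_less lin F_def)
    also have "\<dots> = (\<Sum>x<m. \<Sum>y<m. of_real (1 / N) * (\<xi> (x, z) * cnj (\<xi> (y, w))) * F (x, a) (y, b))"
      using that by (intro sum.cong refl) (simp add: bkX)
    finally show ?thesis .
  qed
  have hermD: "herm_kernel {..<n * m} (mat_kernel D)"
    unfolding herm_kernel_def
  proof (intro ballI)
    fix p q assume pq: "p \<in> {..<n * m}" "q \<in> {..<n * m}"
    define a z b w where "a = p div m" "z = p mod m" "b = q div m" "w = q mod m"
    have ab: "a < n" "b < n" "z < m" "w < m" using pq unfolding a_z_b_w_def by (auto simp: div_mod_less)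
    have "cnj (bip_kernel m D (a, z) (b, w)) = (\<Sum>x<m. \<Sum>y<m. of_real (1 / N) * (\<xi> (y, w) * cnj (\<xi> (x, z))) * cnj (F (x, a) (y, b)))"
      unfolding bkD[OF ab] by (simp add: mult_ac)
    also have "\<dots> = (\<Sum>x<m. \<Sum>y<m. of_real (1 / N) * (\<xi> (y, w) * cnj (\<xi> (x, z))) * F (y, b) (x, a))"
      using ab by (intro sum.cong refl) (simp add: hermF[of "(_, a)" "(_, b)"])
    also have "\<dots> = bip_kernel m D (b, w) (a, z)"
      unfolding bkD[OF ab(2,1,4,3)] by (rule sum.swap)
    finally show "D $$ (q, p) = cnj (D $$ (p, q))" unfolding a_z_b_w_def bip_kernel_div_mod by simp
  qed
  have trD: "mtrace D = 0"
  proof -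
    have "mtrace D = (\<Sum>a<n. \<Sum>z<m. bip_kernel m D (a, z) (a, z))"
      unfolding mtrace_bip_kernel[OF carD] sum.cartesian_product' ..
    also have "\<dots> = (\<Sum>a<n. \<Sum>z<m. \<Sum>x<m. \<Sum>y<m. of_real (1 / N) * (\<xi> (x, z) * cnj (\<xi> (y, z))) * F (x, a) (y, a))"
      by (intro sum.cong refl bkD) auto
    also have "\<dots> = (\<Sum>z<m. \<Sum>a<n. \<Sum>x<m. \<Sum>y<m. of_real (1 / N) * (\<xi> (x, z) * cnj (\<xi> (y, z))) * F (x, a) (y, a))"
      by (rule sum.swap)
    also have "\<dots> = (\<Sum>z<m. \<Sum>x<m. \<Sum>y<m. \<Sum>a<n. of_real (1 / N) * (\<xi> (x, z) * cnj (\<xi> (y, z))) * F (x, a) (y, a))"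
      by (intro sum.cong refl sum_swap3[symmetric])
    also have "\<dots> = 0" unfolding sum_distrib_left[symmetric] using trF by simp
    finally show ?thesis .
  qed
  \<comment> \<open>With these vectors, \<tau> lists the matrix elements, in the eigenbasis of
    \<open>T\<close>, of an operator multiplied from both sides by the inverse square root of
    \<open>T\<close>.\<close>
  define w where "w j = (\<lambda>x. of_real (1 / sqrt (d j)) * v j x)" for j
  define \<tau> where "\<tau> A p q = sform {..<m} (\<lambda>x y. A (x, fst p) (y, fst q)) (w (snd p)) (w (snd q))"
    for A :: "nat \<times> nat \<Rightarrow> nat \<times> nat \<Rightarrow> complex" and p q :: "nat \<times> nat"
  have pos\<tau>: "pos_kernel (grid n m) (\<tau> A)" if "pos_kernel (grid m n) A" for A
    unfolding \<tau>_def by (rule pos_kernel_slice[OF _ _ that]) auto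
  have \<tau>diff: "\<tau> (\<lambda>p q. A p q - B p q) p q = \<tau> A p q - \<tau> B p q" for A B p q
    unfolding \<tau>_def sform_def by (simp add: algebra_simps sum_subtractf)
  \<comment> \<open>As \<open>T\<close> tensor identity goes to the identity, the hypothesis
    \<open>le\<close> becomes the upper bound 1 on the transformed \<rho>.\<close>
  have \<tau>T: "\<tau> (\<lambda>p q. T (fst p) (fst q) * of_bool (snd p = snd q)) p q = of_bool (p = q)"
    if pq: "p \<in> grid n m" "q \<in> grid n m" for p q
  proof -
    obtain a j b k where pq': "p = (a, j)" "q = (b, k)" "j < m" "k < m" using pq by auto
    have "\<tau> (\<lambda>p q. T (fst p) (fst q) * of_bool (snd p = snd q)) p q = sform {..<m} T (w j) (w k) * of_bool (a = b)"
      unfolding \<tau>_def pq' by (simp add: sform_def)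
    also have "sform {..<m} T (w j) (w k) = of_real (1 / sqrt (d j)) * of_real (1 / sqrt (d k)) * sform {..<m} T (v j) (v k)"
      unfolding w_def sform_scale_left sform_scale_right by simp
    also have "sform {..<m} T (v j) (v k) = of_real (d k) * of_bool (j = k)"
    proof -
      have "kernel_app {..<m} T (v k) p = of_real (d k) * v k p" if "p < m" for p
        using onb_kernel_app[of "{..<m}" v k p T "\<lambda>j. of_real (d j)", unfolded card_lessThan] v pq'(4) that by blast
      then have "sform {..<m} T (v j) (v k) = inner_on {..<m} (v j) (\<lambda>p. of_real (d k) * v k p)"
        unfolding sform_inner inner_on_def by (intro sum.cong refl) simp
      then show ?thesis using onb[OF pq'(3,4)] by (simp add: inner_on_scale_right)
    qed
    also have "of_real (1 / sqrt (d j)) * of_real (1 / sqrt (d k)) * (of_real (d k) * of_bool (j = k)) = (of_bool (j = k) :: complex)"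
    proof (cases "j = k")
      case True
      then show ?thesis using sq(1)[OF pq'(4)] sq(2)[OF pq'(4)] by simp
    qed simp
    finally show ?thesis using pq' by auto
  qed
  \<comment> \<open>The roots in \<xi> cancel the inverse roots in \<open>w\<close>, and
    completeness of the eigenbasis restores \<rho>.\<close>
  have pair: "kernel_pair (grid n m) (\<tau> \<rho>) (bip_kernel m D) = of_real (1 / N) * kernel_pair (grid m n) \<rho> F"
  proof -
    have "kernel_pair (grid n m) (\<tau> \<rho>) (bip_kernel m D) = (\<Sum>a<n. \<Sum>b<n. \<Sum>j<m. \<Sum>k<m. \<Sum>x<m. \<Sum>y<m.
       of_real (1 / N) * ((v j x * sform {..<m} (\<lambda>x y. \<rho> (x, a) (y, b)) (v j) (v k) * cnj (v k y)) * F (x, a) (y, b)))"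
      unfolding kernel_pair_prod
    proof (intro sum.cong refl)
      fix a b j k assume h: "a \<in> {..<n}" "b \<in> {..<n}" "j \<in> {..<m}" "k \<in> {..<m}"
      define S where "S = sform {..<m} (\<lambda>x y. \<rho> (x, a) (y, b)) (v j) (v k)"
      have te: "\<tau> \<rho> (a, j) (b, k) = of_real (1 / sqrt (d j)) * of_real (1 / sqrt (d k)) * S"
        unfolding \<tau>_def w_def sform_scale_left sform_scale_right S_def by simp
      have nz: "d j \<noteq> 0" "d k \<noteq> 0" using dpos[of j] dpos[of k] h by auto
      have eq: "\<tau> \<rho> (a, j) (b, k) * (of_real (1 / N) * (\<xi> (x, j) * cnj (\<xi> (y, k))) * F (x, a) (y, b)) =
         of_real (1 / N) * ((v j x * S * cnj (v k y)) * F (x, a) (y, b))" for x y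
        unfolding te \<xi>_def fst_conv snd_conv using nz by simp
      have B: "bip_kernel m D (a, j) (b, k) = (\<Sum>x<m. \<Sum>y<m. of_real (1 / N) * (\<xi> (x, j) * cnj (\<xi> (y, k))) * F (x, a) (y, b))"
        by (rule bkD) (use h in auto)
      show "\<tau> \<rho> (a, j) (b, k) * bip_kernel m D (a, j) (b, k) = (\<Sum>x<m. \<Sum>y<m.
         of_real (1 / N) * ((v j x * sform {..<m} (\<lambda>x y. \<rho> (x, a) (y, b)) (v j) (v k) * cnj (v k y)) * F (x, a) (y, b)))"
        unfolding B sum_distrib_left S_def[symmetric] by (intro sum.cong refl eq)
    qed
    also have "\<dots> = (\<Sum>a<n. \<Sum>b<n. \<Sum>x<m. \<Sum>y<m. \<Sum>j<m. \<Sum>k<m.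
       of_real (1 / N) * ((v j x * sform {..<m} (\<lambda>x y. \<rho> (x, a) (y, b)) (v j) (v k) * cnj (v k y)) * F (x, a) (y, b)))"
      by (intro sum.cong refl sum_swap4)
    also have "\<dots> = (\<Sum>a<n. \<Sum>b<n. \<Sum>x<m. \<Sum>y<m. of_real (1 / N) * (\<rho> (x, a) (y, b) * F (x, a) (y, b)))"
    proof (intro sum.cong refl)
      fix a b x y assume h: "x \<in> {..<m}" "y \<in> {..<m}"
      have "\<rho> (x, a) (y, b) = (\<Sum>j<m. \<Sum>k<m. v j x * sform {..<m} (\<lambda>x y. \<rho> (x, a) (y, b)) (v j) (v k) * cnj (v k y))"
        using onb_expand[OF v(1) v(1) _ h, of "\<lambda>x y. \<rho> (x, a) (y, b)"] by simp
      then show "(\<Sum>j<m. \<Sum>k<m. of_real (1 / N) * ((v j x * sform {..<m} (\<lambda>x y. \<rho> (x, a) (y, b)) (v j) (v k) * cnj (v k y)) * F (x, a) (y, b))) =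
          of_real (1 / N) * (\<rho> (x, a) (y, b) * F (x, a) (y, b))"
        by (simp only: sum_distrib_left sum_distrib_right)
    qed
    also have "\<dots> = of_real (1 / N) * kernel_pair (grid m n) \<rho> F"
      unfolding kernel_pair_prod sum_distrib_left by (rule sum_swap4)
    finally show ?thesis .
  qed
  \<comment> \<open>Since \<open>D\<close> is traceless, the complementary test has the negative
    value; this produces the sign of \<open>H - G\<close>.\<close>
  define U where "U p q = of_bool (p = q) - \<tau> \<rho> p q" for p q
  have posU: "pos_kernel (grid n m) U"
    by (rule pos_kernel_cong[OF pos\<tau>[OF le]]) (simp add: U_def \<tau>diff \<tau>T)
  define V where "V p q = U (p div m, p mod m) (q div m, q mod m)" for p q
  have "Re (kernel_pair {..<n * m} V (mat_kernel D)) \<le> trace_norm D / 2"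
  proof (rule trace_norm_traceless_pair[OF carD hermD trD])
    show "pos_kernel {..<n * m} V" unfolding V_def
      by (rule pos_kernel_pullback[OF _ posU]) (auto simp: div_mod_less)
    have "pos_kernel {..<n * m} (\<lambda>p q. \<tau> \<rho> (p div m, p mod m) (q div m, q mod m))"
      by (rule pos_kernel_pullback[OF _ pos\<tau>[OF \<rho>]]) (auto simp: div_mod_less)
    then show "pos_kernel {..<n * m} (\<lambda>p q. of_bool (p = q) - V p q)"
      by (rule pos_kernel_cong) (auto simp: V_def U_def, metis div_mult_mod_eq)
  qed
  moreover have "kernel_pair {..<n * m} V (mat_kernel D) = - (of_real (1 / N) * kernel_pair (grid m n) \<rho> F)"
  proof -
    have "kernel_pair {..<n * m} V (mat_kernel D) = kernel_pair (grid n m) U (bip_kernel m D)"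
      unfolding kernel_pair_def sum_pair_index by (intro sum.cong refl) (auto simp: V_def bip_kernel_def)
    also have "\<dots> = kernel_pair (grid n m) (bip_kernel m D) (\<lambda>p q. of_bool (p = q)) - kernel_pair (grid n m) (bip_kernel m D) (\<tau> \<rho>)"
      unfolding kernel_pair_commute[of _ U] U_def kernel_pair_diff_right ..
    also have "kernel_pair (grid n m) (bip_kernel m D) (\<lambda>p q. of_bool (p = q)) = 0"
      using trD mtrace_bip_kernel[OF carD] by (simp add: kernel_pair_delta)
    finally show ?thesis using pair by (simp add: kernel_pair_commute)
  qed
  ultimately have "- (Re (kernel_pair (grid m n) \<rho> F) / N) \<le> dnorm m n \<Delta> / 2" using Dn by simp
  then have "- Re (kernel_pair (grid m n) \<rho> F) \<le> N * dnorm m n \<Delta> / 2" using N by (simp add: field_simps)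
  moreover have "kernel_pair (grid m n) \<rho> (\<lambda>p q. H p q - G p q) = - kernel_pair (grid m n) \<rho> F"
    unfolding F_def kernel_pair_diff_right by simp
  ultimately show ?thesis by simp
qed

section \<open>Equivalence of the three conditions\<close>

lemma kernel_comp_assoc: "kernel_comp m c (kernel_comp m1 L J) p q = kernel_comp m1 (kernel_comp m c L) J p q"
proof -
  have "kernel_comp m c (kernel_comp m1 L J) p q = (\<Sum>x<m. \<Sum>y<m. \<Sum>u<m1. \<Sum>v<m1.
      c (fst p, x) (fst q, y) * L (x, u) (y, v) * J (u, snd p) (v, snd q))"
    by (simp add: kernel_comp_def sum_distrib_left mult.assoc)
  also have "\<dots> = (\<Sum>u<m1. \<Sum>v<m1. \<Sum>x<m. \<Sum>y<m.
      c (fst p, x) (fst q, y) * L (x, u) (y, v) * J (u, snd p) (v, snd q))"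
    by (rule sum_swap4)
  finally show ?thesis by (simp add: kernel_comp_def sum_distrib_right)
qed

text \<open>The counterpart of precomposition on the side of the operator: the map of
  \<open>c\<close> acts on the first factor of \<rho>. It trades an arbitrary ancilla for the input
  system of the difference map, where the diamond norm bound lives.\<close>

definition kernel_push :: "nat \<Rightarrow> (nat \<times> nat \<Rightarrow> nat \<times> nat \<Rightarrow> complex) \<Rightarrow>
    (nat \<times> nat \<Rightarrow> nat \<times> nat \<Rightarrow> complex) \<Rightarrow> nat \<times> nat \<Rightarrow> nat \<times> nat \<Rightarrow> complex" where
  "kernel_push r c \<rho> p q = (\<Sum>i<r. \<Sum>j<r. \<rho> (i, snd p) (j, snd q) * c (i, fst p) (j, fst q))"

lemma kernel_push_pos:
  assumes "pos_kernel (grid r m) c" "pos_kernel (grid r n) \<rho>"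
  shows "pos_kernel (grid m n) (kernel_push r c \<rho>)"
  using pos_kernel_contract[OF _ _ _ assms(2,1)] unfolding kernel_push_def[abs_def] by simp

lemma kernel_pair_kernel_comp:
  "kernel_pair (grid r n) \<rho> (kernel_comp m c F) = kernel_pair (grid m n) (kernel_push r c \<rho>) F"
proof -
  let ?f = "\<lambda>i j a b x y. \<rho> (i, a) (j, b) * c (i, x) (j, y) * F (x, a) (y, b)"
  have "kernel_pair (grid r n) \<rho> (kernel_comp m c F) =
      (\<Sum>i<r. \<Sum>j<r. \<Sum>a<n. \<Sum>b<n. \<Sum>x<m. \<Sum>y<m. ?f i j a b x y)"
    unfolding kernel_pair_prod kernel_comp_def by (simp add: sum_distrib_left mult.assoc)
  also have "\<dots> = (\<Sum>i<r. \<Sum>j<r. \<Sum>x<m. \<Sum>y<m. \<Sum>a<n. \<Sum>b<n. ?f i j a b x y)"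
    by (intro sum.cong refl sum_swap4)
  also have "\<dots> = (\<Sum>x<m. \<Sum>y<m. \<Sum>i<r. \<Sum>j<r. \<Sum>a<n. \<Sum>b<n. ?f i j a b x y)"
    by (rule sum_swap4)
  also have "\<dots> = (\<Sum>x<m. \<Sum>y<m. \<Sum>a<n. \<Sum>b<n. \<Sum>i<r. \<Sum>j<r. ?f i j a b x y)"
    by (intro sum.cong refl sum_swap4)
  also have "\<dots> = kernel_pair (grid m n) (kernel_push r c \<rho>) F"
    unfolding kernel_pair_prod kernel_push_def by (simp add: sum_distrib_right)
  finally show ?thesis .
qed

text \<open>The contraction lemma with a one-point second factor.\<close>

lemma pos_kernel_apply:
  assumes c: "pos_kernel ({..<r::nat} \<times> {..<m::nat}) c" and Z: "pos_kernel {..<r} Z"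
  shows "pos_kernel {..<m} (\<lambda>x y. \<Sum>i<r. \<Sum>j<r. Z i j * c (i, x) (j, y))"
proof -
  have 1: "pos_kernel ({..<r} \<times> {()}) (\<lambda>p q. Z (fst p) (fst q))"
    by (rule pos_kernel_pullback[OF _ Z]) auto
  have 2: "pos_kernel ({..<m} \<times> {()}) (\<lambda>p q. \<Sum>i<r. \<Sum>j<r. Z i j * c (i, fst p) (j, fst q))"
    by (rule pos_kernel_cong[OF pos_kernel_contract[OF _ _ _ 1 c]]) auto
  from pos_kernel_pullback[OF _ 2, of "\<lambda>x. (x, ())" "{..<m}"] show ?thesis by auto
qed

lemma pre_val_le_of_delta_pre:
  assumes ch: "channel m1 n \<Phi>1" "channel m n \<Phi>2" and pos: "0 < r" "0 < m1" "0 < m" "0 < n"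
    and \<delta>: "delta_pre m1 m n \<Phi>1 \<Phi>2 \<le> \<epsilon>" and \<rho>: "pos_kernel (grid r n) \<rho>"
  shows "pre_val r m n (choi_kernel m \<Phi>2) \<rho> \<le> pre_val r m1 n (choi_kernel m1 \<Phi>1) \<rho> + \<epsilon> / 2 * cond_val r n \<rho>"
proof (rule pre_val_least[OF pos(3)])
  fix c assume c: "chan_kernel r m c"
  then have posc: "pos_kernel (grid r m) c" by (simp add: chan_kernel_def)
  define N where "N = cond_val r n \<rho>"
  have N0: "0 \<le> N" unfolding N_def by (rule cond_val_nonneg[OF pos(4) \<rho>])
  define x where "x = Re (kernel_pair (grid r n) \<rho> (kernel_comp m c (choi_kernel m \<Phi>2)))"
  define P where "P = pre_val r m1 n (choi_kernel m1 \<Phi>1) \<rho>"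
  have approx: "x \<le> P + (N + \<eta> * (r + m)) * (\<epsilon> + \<eta>) / 2" if \<eta>: "0 < \<eta>" for \<eta> :: real
  proof -
    obtain \<Lambda> where \<Lambda>: "channel m m1 \<Lambda>" "dnorm m n (\<lambda>X. \<Phi>1 (\<Lambda> X) - \<Phi>2 X) < \<epsilon> + \<eta>"
      using delta_pre_approx[OF ch pos(2) \<delta> \<eta>] by blast
    define G where "G = kernel_comp m1 (choi_kernel m \<Lambda>) (choi_kernel m1 \<Phi>1)"
    define H where "H = choi_kernel m \<Phi>2"
    interpret diff_map m n "\<lambda>X. \<Phi>1 (\<Lambda> X) - \<Phi>2 X" G H 1
      unfolding G_def H_def by (rule diff_map_pre[OF ch \<Lambda>(1)])
    obtain \<sigma> where \<sigma>: "pos_kernel {..<r} \<sigma>" "(\<Sum>i<r. \<sigma> i i) = 1"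
      and dual: "pos_kernel (grid r n) (\<lambda>p q. of_real N * \<sigma> (fst p) (fst q) * of_bool (snd p = snd q)
         - \<rho> p q + of_real \<eta> * of_bool (p = q))"
      using cond_val_dual[OF pos(1,4) \<rho> \<eta>] unfolding N_def by blast
    define Z where "Z i j = of_real N * \<sigma> i j + of_real \<eta> * of_bool (i = j)" for i j :: nat
    have Z: "pos_kernel {..<r} Z" unfolding Z_def
      using N0 \<eta> by (intro pos_kernel_add pos_kernel_scale pos_kernel_delta \<sigma>(1)) auto
    define T0 where "T0 x y = (\<Sum>i<r. \<Sum>j<r. Z i j * c (i, x) (j, y))" for x y
    have T0: "pos_kernel {..<m} T0" unfolding T0_def by (rule pos_kernel_apply[OF posc Z])
    \<comment> \<open>\<eta> enters twice: inside \<open>Z\<close> as the slack of duality,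
      contributing \<open>\<eta> * r\<close> to the trace since \<open>c\<close> preserves it, and
      here to make \<open>T\<close> invertible, contributing \<open>\<eta> * m\<close>.\<close>
    define T where "T x y = T0 x y + of_real \<eta> * of_bool (x = y)" for x y
    have trT: "(\<Sum>x<m. T x x) = of_real (N + \<eta> * (r + m))"
    proof -
      have "(\<Sum>x<m. T0 x x) = (\<Sum>i<r. \<Sum>j<r. \<Sum>x<m. Z i j * c (i, x) (j, x))"
        unfolding T0_def by (rule sum_swap3[symmetric])
      also have "\<dots> = (\<Sum>i<r. \<Sum>j<r. if j = i then Z i i else 0)"
        using c by (intro sum.cong refl) (auto simp: chan_kernel_def simp flip: sum_distrib_left)
      also have "\<dots> = of_real N * (\<Sum>i<r. \<sigma> i i) + of_nat r * of_real \<eta>"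
        by (simp add: Z_def sum.distrib sum_distrib_left)
      finally show ?thesis by (simp add: T_def sum.distrib \<sigma>(2) algebra_simps)
    qed
    define \<rho>' where "\<rho>' = kernel_push r c \<rho>"
    have \<rho>': "pos_kernel (grid m n) \<rho>'" unfolding \<rho>'_def by (rule kernel_push_pos[OF posc \<rho>])
    have le: "pos_kernel (grid m n) (\<lambda>p q. T (fst p) (fst q) * of_bool (snd p = snd q) - \<rho>' p q)"
    proof -
      have 1: "pos_kernel (grid m n) (\<lambda>p q. of_real \<eta> * of_bool (p = q))"
        using \<eta> by (intro pos_kernel_scale pos_kernel_delta) auto
      show ?thesis
      proof (rule pos_kernel_cong[OF pos_kernel_add[OF kernel_push_pos[OF posc dual] 1]])
        fix p q assume "p \<in> grid m n" "q \<in> grid m n"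
        have "kernel_push r c (\<lambda>p q. of_real N * \<sigma> (fst p) (fst q) * of_bool (snd p = snd q) - \<rho> p q + of_real \<eta> * of_bool (p = q)) p q
          = (\<Sum>i<r. \<Sum>j<r. Z i j * c (i, fst p) (j, fst q) * of_bool (snd p = snd q) - \<rho> (i, snd p) (j, snd q) * c (i, fst p) (j, fst q))"
          unfolding kernel_push_def Z_def by (intro sum.cong refl) (auto simp: algebra_simps)
        also have "\<dots> = T0 (fst p) (fst q) * of_bool (snd p = snd q) - \<rho>' p q"
          unfolding T0_def \<rho>'_def kernel_push_def by (simp add: sum_subtractf sum_distrib_right)
        finally show "T (fst p) (fst q) * of_bool (snd p = snd q) - \<rho>' p q =
           kernel_push r c (\<lambda>p q. of_real N * \<sigma> (fst p) (fst q) * of_bool (snd p = snd q) - \<rho> p q + of_real \<eta> * of_bool (p = q)) p q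
            + of_real \<eta> * of_bool (p = q)"
          by (auto simp: T_def prod_eq_iff algebra_simps)
      qed
    qed
    have "Re (kernel_pair (grid m n) \<rho>' (\<lambda>p q. H p q - G p q)) \<le>
        (N + \<eta> * (r + m)) * dnorm m n (\<lambda>X. \<Phi>1 (\<Lambda> X) - \<Phi>2 X) / 2"
      by (rule kernel_pair_diff_le_dnorm[OF \<rho>' T0 \<eta> pos(3) T_def trT le])
    also have "\<dots> \<le> (N + \<eta> * (r + m)) * (\<epsilon> + \<eta>) / 2"
      using \<Lambda>(2) N0 \<eta> by (intro divide_right_mono mult_left_mono) auto
    finally have d: "Re (kernel_pair (grid m n) \<rho>' (\<lambda>p q. H p q - G p q)) \<le> (N + \<eta> * (r + m)) * (\<epsilon> + \<eta>) / 2" .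
    \<comment> \<open>By associativity, \<open>c\<close> followed by \<Lambda> is a single strategy
      that competes in the supremum for \<Phi>1.\<close>
    have "kernel_comp m c G = kernel_comp m1 (kernel_comp m c (choi_kernel m \<Lambda>)) (choi_kernel m1 \<Phi>1)"
      unfolding G_def by (intro ext kernel_comp_assoc)
    then have "Re (kernel_pair (grid r n) \<rho> (kernel_comp m c G)) \<le> P"
      unfolding P_def using pre_val_upper[OF chan_kernel_comp[OF c channel_chan_kernel[OF \<Lambda>(1)]] channel_chan_kernel[OF ch(1)], of \<rho>]
      by simp
    moreover have "x = Re (kernel_pair (grid r n) \<rho> (kernel_comp m c G)) + Re (kernel_pair (grid m n) \<rho>' (\<lambda>p q. H p q - G p q))"
      unfolding x_def kernel_pair_kernel_comp \<rho>'_def kernel_pair_diff_right H_def by simp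
    ultimately show ?thesis using d by simp
  qed
  \<comment> \<open>\<eta> tends to 0 along the inverses of the positive naturals; the zeros are
    kept so that the limit matches term by term.\<close>
  have "x \<le> P + (N + 0) * (\<epsilon> + 0) / 2"
  proof (rule LIMSEQ_le_const)
    note L = LIMSEQ_inverse_real_of_nat
    show "(\<lambda>k. P + (N + inverse (real (Suc k)) * (r + m)) * (\<epsilon> + inverse (real (Suc k))) / 2) \<longlonglongrightarrow>
        P + (N + 0) * (\<epsilon> + 0) / 2"
      by (intro tendsto_add tendsto_mult[of "\<lambda>k. N + _ k"] tendsto_divide tendsto_const L tendsto_mult_left_zero[OF L]) simp
    show "\<exists>k0. \<forall>k\<ge>k0. x \<le> P + (N + inverse (real (Suc k)) * (r + m)) * (\<epsilon> + inverse (real (Suc k))) / 2"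
      using approx by auto
  qed
  then show "x \<le> P + \<epsilon> / 2 * cond_val r n \<rho>"
    unfolding N_def by (simp add: algebra_simps)
qed

lemma cond_ii_of_delta_pre:
  assumes ch: "channel m1 n \<Phi>1" "channel m n \<Phi>2" and pos: "0 < r" "0 < m1" "0 < m" "0 < n"
    and \<delta>: "delta_pre m1 m n \<Phi>1 \<Phi>2 \<le> \<epsilon>"
  shows "cond_ii m1 m n \<Phi>1 \<Phi>2 \<epsilon> r"
  unfolding cond_ii_def
proof (intro allI impI)
  fix \<rho> assume \<rho>: "state (r * n) \<rho>"
  then have car: "\<rho> \<in> carrier_mat (r * n) (r * n)" by (simp add: state_def psd_def)
  show "cond_dnorm r m (id_tensor r n m (map_transp m n \<Phi>2) \<rho>)
     \<le> cond_dnorm r m1 (id_tensor r n m1 (map_transp m1 n \<Phi>1) \<rho>) + \<epsilon> / 2 * cond_dnorm r n \<rho>"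
    unfolding cond_dnorm_pre_val[OF ch(1) car] cond_dnorm_pre_val[OF ch(2) car] cond_dnorm_cond_val[OF car]
    by (rule pre_val_le_of_delta_pre[OF ch pos \<delta> psd_bip_kernel]) (use \<rho> in \<open>simp add: state_def\<close>)
qed

lemma cond_iii_of_delta_pre:
  assumes ch: "channel m1 n \<Phi>1" "channel m n \<Phi>2" and pos: "0 < r" "0 < m1" "0 < m" "0 < n"
    and \<delta>: "delta_pre m1 m n \<Phi>1 \<Phi>2 \<le> \<epsilon>" and \<epsilon>: "0 \<le> \<epsilon>"
  shows "cond_iii m1 m n \<Phi>1 \<Phi>2 \<epsilon> r"
  unfolding cond_iii_def
proof (intro allI impI)
  fix k lam rho M assume e: "ensemble (r * n) k lam rho" "measurement (n * n) k M"
  have "pre_val r m n (choi_kernel m \<Phi>2) (ensemble_kernel n k lam rho M) \<le>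
     pre_val r m1 n (choi_kernel m1 \<Phi>1) (ensemble_kernel n k lam rho M) + \<epsilon> / 2 * cond_val r n (ensemble_kernel n k lam rho M)"
    by (rule pre_val_le_of_delta_pre[OF ch pos \<delta> ensemble_kernel_pos[OF e]])
  also have "\<dots> \<le> pre_val r m1 n (choi_kernel m1 \<Phi>1) (ensemble_kernel n k lam rho M) + \<epsilon> / 2 * psucc_opt (r * n) k lam rho"
    using cond_val_ensemble_kernel[OF pos(4) e] \<epsilon> by (intro add_left_mono mult_left_mono) auto
  finally show "Sup {psucc k lam (\<lambda>i. tensor_id r n n (\<lambda>X. \<Phi>2 (\<alpha> X)) (rho i)) M |\<alpha>. channel r m \<alpha>}
     \<le> Sup {psucc k lam (\<lambda>i. tensor_id r n n (\<lambda>X. \<Phi>1 (\<alpha> X)) (rho i)) M |\<alpha>. channel r m1 \<alpha>} +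
        \<epsilon> / 2 * psucc_opt (r * n) k lam rho"
    unfolding psucc_pre_val[OF ch(1) e] psucc_pre_val[OF ch(2) e] .
qed

definition id_kernel :: "nat \<times> nat \<Rightarrow> nat \<times> nat \<Rightarrow> complex" where
  "id_kernel p q = of_bool (fst p = snd p) * of_bool (fst q = snd q)"

lemma chan_kernel_id: "chan_kernel m m id_kernel"
  unfolding chan_kernel_def
proof (intro conjI allI impI)
  show "pos_kernel (grid m m) id_kernel"
    by (rule pos_kernel_cong[OF pos_kernel_rank1[of _ "\<lambda>p. of_bool (fst p = snd p)"]]) (simp add: id_kernel_def)
  fix i j assume "i < m" "j < m"
  have "(\<Sum>a<m. id_kernel (i, a) (j, a)) = (\<Sum>a<m. if a = i then of_bool (i = j) else 0)"
    unfolding id_kernel_def by (intro sum.cong refl) auto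
  then show "(\<Sum>a<m. id_kernel (i, a) (j, a)) = of_bool (i = j)" using \<open>i < m\<close> by simp
qed

lemma kernel_comp_id:
  assumes "p \<in> grid m n" "q \<in> grid m n"
  shows "kernel_comp m id_kernel J p q = J p q"
proof -
  have "kernel_comp m id_kernel J p q = (\<Sum>x<m. \<Sum>y<m. if y = fst q then if x = fst p then J p q else 0 else 0)"
    unfolding kernel_comp_def id_kernel_def by (intro sum.cong refl) auto
  then show ?thesis using assms by auto
qed

lemma pre_val_id_upper:
  assumes "chan_kernel m n J"
  shows "Re (kernel_pair (grid m n) \<rho> J) \<le> pre_val m m n J \<rho>"
proof -
  have "kernel_pair (grid m n) \<rho> (kernel_comp m id_kernel J) = kernel_pair (grid m n) \<rho> J"
    by (rule kernel_pair_cong) (simp_all add: kernel_comp_id)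
  then show ?thesis using pre_val_upper[OF chan_kernel_id assms, of \<rho>] by simp
qed

definition mat_of_bip_kernel :: "nat \<Rightarrow> nat \<Rightarrow> (nat \<times> nat \<Rightarrow> nat \<times> nat \<Rightarrow> complex) \<Rightarrow> complex mat" where
  "mat_of_bip_kernel r n C = mat (r * n) (r * n) (\<lambda>(p, q). C (p div n, p mod n) (q div n, q mod n))"

lemma mat_of_bip_kernel_carrier [simp]: "mat_of_bip_kernel r n C \<in> carrier_mat (r * n) (r * n)"
  by (simp add: mat_of_bip_kernel_def)

lemma bip_kernel_mat_of_bip_kernel:
  assumes "p \<in> grid r n" "q \<in> grid r n"
  shows "bip_kernel n (mat_of_bip_kernel r n C) p q = C p q"
  using assms by (auto simp: bip_kernel_def mat_of_bip_kernel_def pair_index_less)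

lemma psd_mat_of_bip_kernel: "pos_kernel (grid r n) C \<Longrightarrow> psd (r * n) (mat_of_bip_kernel r n C)"
  by (rule psd_of_kernel[OF mat_of_bip_kernel_carrier]) (auto simp: mat_of_bip_kernel_def)

lemma mtrace_mat_of_bip_kernel: "mtrace (mat_of_bip_kernel r n C) = (\<Sum>p\<in>grid r n. C p p)"
  unfolding mtrace_bip_kernel[OF mat_of_bip_kernel_carrier] by (intro sum.cong refl bip_kernel_mat_of_bip_kernel)

lemma delta_pre_of_cond_ii:
  assumes ch: "channel m1 n \<Phi>1" "channel m n \<Phi>2" and pos: "0 < m1" "0 < m" "0 < n" and \<epsilon>: "0 \<le> \<epsilon>"
    and ii: "cond_ii m1 m n \<Phi>1 \<Phi>2 \<epsilon> m"
  shows "delta_pre m1 m n \<Phi>1 \<Phi>2 \<le> \<epsilon>"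
proof (rule delta_pre_le_of_key[OF ch pos \<epsilon>])
  fix C assume C: "pos_kernel (grid m n) C" "(\<Sum>p\<in>grid m n. C p p) = 1"
  define \<rho> where "\<rho> = mat_of_bip_kernel m n C"
  have car: "\<rho> \<in> carrier_mat (m * n) (m * n)" by (simp add: \<rho>_def)
  have "state (m * n) \<rho>" unfolding state_def \<rho>_def using psd_mat_of_bip_kernel[OF C(1)] C(2) by (simp add: mtrace_mat_of_bip_kernel)
  then have "pre_val m m n (choi_kernel m \<Phi>2) (bip_kernel n \<rho>) \<le> pre_val m m1 n (choi_kernel m1 \<Phi>1) (bip_kernel n \<rho>) + \<epsilon> / 2 * cond_val m n (bip_kernel n \<rho>)"
    using ii unfolding cond_ii_def
    by (metis cond_dnorm_pre_val[OF ch(1) car] cond_dnorm_pre_val[OF ch(2) car] cond_dnorm_cond_val[OF car])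
  moreover have "kernel_pair (grid m n) (bip_kernel n \<rho>) J = kernel_pair (grid m n) C J" for J
    unfolding \<rho>_def by (rule kernel_pair_cong) (simp_all add: bip_kernel_mat_of_bip_kernel)
  then have "pre_val m m2 n J (bip_kernel n \<rho>) = pre_val m m2 n J C" "cond_val m n (bip_kernel n \<rho>) = cond_val m n C" for m2 J
    unfolding pre_val_def cond_val_def by simp_all
  ultimately show "Re (kernel_pair (grid m n) C (choi_kernel m \<Phi>2)) \<le> pre_val m m1 n (choi_kernel m1 \<Phi>1) C + \<epsilon> / 2 * cond_val m n C"
    using pre_val_id_upper[OF channel_chan_kernel[OF ch(2)], of C] by simp
qed


section \<open>Weyl operators and the ensemble that tests (iii)\<close>

definition root1 :: "nat \<Rightarrow> nat \<Rightarrow> complex" where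
  "root1 n a = cis (2 * pi * real a / real n)"

text \<open>Matrix elements of the Weyl operators: the label \<open>i\<close> stands for a cyclic
  shift by \<open>i div n\<close> following the power \<open>i mod n\<close> of the diagonal phase
  operator.\<close>

definition weyl :: "nat \<Rightarrow> nat \<Rightarrow> nat \<Rightarrow> nat \<Rightarrow> complex" where
  "weyl n i x y = of_bool (x = (y + i div n) mod n) * root1 n y ^ (i mod n)"

lemma root1_unit: "root1 n a * cnj (root1 n a) = 1" "cnj (root1 n a) * root1 n a = 1"
  by (simp_all add: root1_def cis_cnj cis_mult)

text \<open>The quotient of two distinct n-th roots of unity is a root of unity other than 1, and
  its powers sum to zero.\<close>

lemma sum_root1_orthogonal:
  assumes "a < n" "b < n"
  shows "(\<Sum>l<n. root1 n b ^ l * cnj (root1 n a ^ l)) = of_nat n * of_bool (a = b)"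
proof (cases "a = b")
  case True
  then show ?thesis by (simp add: root1_unit flip: power_mult_distrib)
next
  case False
  define z where "z = root1 n b * cnj (root1 n a)"
  have "inj_on (root1 n) {..<n}"
    using bij_betw_roots_unity[of n] assms(1) unfolding root1_def by (auto simp: bij_betw_def)
  then have "root1 n b \<noteq> root1 n a" using False assms by (auto dest: inj_onD)
  then have "z \<noteq> 1"
    unfolding z_def by (metis mult.assoc mult_1 mult_1_right root1_unit(2))
  moreover have pow: "root1 n c ^ n = 1" for c
    using assms(1) cis_multiple_2pi[of "real c"] by (simp add: root1_def DeMoivre)
  have "z ^ n = 1" unfolding z_def power_mult_distrib by (simp add: pow flip: complex_cnj_power)
  ultimately have "(\<Sum>l<n. z ^ l) = 0" by (simp add: geometric_sum)
  then show ?thesis using False by (simp add: z_def power_mult_distrib)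
qed

lemma shift_mod_inj:
  assumes "(a + k) mod n = (b + k) mod n" "a < n" "b < (n :: nat)"
  shows "a = b"
proof -
  obtain q1 q2 where "a + k + n * q1 = b + k + n * q2" using assms(1) by (auto simp: nat_mod_eq_iff)
  then have "(a + n * q1) mod n = (b + n * q2) mod n" by simp
  then show ?thesis using assms(2,3) by simp
qed

lemma sum_shift_mod:
  fixes g :: "nat \<Rightarrow> 'a :: comm_monoid_add"
  shows "(\<Sum>a<n. g ((a + k) mod n)) = (\<Sum>x<n. g x)"
proof (rule sum.reindex_bij_betw)
  have inj: "inj_on (\<lambda>a. (a + k) mod n) {..<n}"
    by (auto intro!: inj_onI dest: shift_mod_inj)
  moreover have "(\<lambda>a. (a + k) mod n) ` {..<n} \<subseteq> {..<n}" by (cases "n = 0") auto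
  ultimately have "(\<lambda>a. (a + k) mod n) ` {..<n} = {..<n}" by (intro endo_inj_surj) auto
  then show "bij_betw (\<lambda>a. (a + k) mod n) {..<n} {..<n}" using inj by (simp add: bij_betw_def)
qed

lemma weyl_columns:
  assumes "a < n" "b < n"
  shows "(\<Sum>x<n. weyl n i x a * cnj (weyl n i x b)) = of_bool (a = b)"
proof -
  have "(\<Sum>x<n. weyl n i x a * cnj (weyl n i x b)) = (\<Sum>x<n. if x = (a + i div n) mod n then of_bool (a = b) else 0)"
  proof (intro sum.cong refl)
    fix x
    have "weyl n i x a * cnj (weyl n i x b) = 0" if "a \<noteq> b"
      using shift_mod_inj[of a "i div n" n b] that assms by (auto simp: weyl_def)
    moreover have "weyl n i x a * cnj (weyl n i x a) = of_bool (x = (a + i div n) mod n)"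
      by (simp add: weyl_def root1_unit flip: power_mult_distrib)
    ultimately show "weyl n i x a * cnj (weyl n i x b) = (if x = (a + i div n) mod n then of_bool (a = b) else 0)"
      by (cases "a = b") auto
  qed
  then show ?thesis using assms by simp
qed

lemma weyl_rows:
  assumes "x < n"
  shows "(\<Sum>a<n. weyl n i x a * cnj (weyl n i y a)) = of_bool (x = y)"
proof -
  have "(\<Sum>a<n. weyl n i x a * cnj (weyl n i y a)) =
     (\<Sum>a<n. of_bool (x = (a + i div n) mod n) * of_bool (y = (a + i div n) mod n))"
    by (intro sum.cong refl) (simp add: weyl_def root1_unit mult_ac flip: power_mult_distrib)
  also have "\<dots> = (\<Sum>z<n. of_bool (x = z) * of_bool (y = z))"
    by (rule sum_shift_mod[of "\<lambda>z. of_bool (x = z) * of_bool (y = z)"])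
  also have "\<dots> = (\<Sum>z<n. if z = x then of_bool (x = y) else 0)" by (intro sum.cong refl) auto
  finally show ?thesis using assms by simp
qed

text \<open>The sum over phase powers forces equal column indices, and the sum over shifts then
  meets each row exactly once. In vector form this says that the maximally entangled vectors of the
  \<open>n * n\<close> operators resolve the identity.\<close>

lemma weyl_complete:
  assumes "a < n" "b < n" "x < n"
  shows "(\<Sum>i<n * n. weyl n i y b * cnj (weyl n i x a)) = of_nat n * of_bool ((b, y) = (a, x))"
proof -
  have "(\<Sum>i<n * n. weyl n i y b * cnj (weyl n i x a)) =
     (\<Sum>k<n. \<Sum>l<n. weyl n (k * n + l) y b * cnj (weyl n (k * n + l) x a))"
    unfolding sum_pair_index sum.cartesian_product' by simp
  also have "\<dots> = (\<Sum>k<n. of_bool (y = (b + k) mod n) * of_bool (x = (a + k) mod n) *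
       (\<Sum>l<n. root1 n b ^ l * cnj (root1 n a ^ l)))"
    unfolding sum_distrib_left by (intro sum.cong refl) (auto simp: weyl_def)
  also have "\<dots> = (\<Sum>k<n. of_bool (y = (k + b) mod n) * of_bool (x = (k + b) mod n) * (of_nat n * of_bool (a = b)))"
    unfolding sum_root1_orthogonal[OF assms(1,2)] by (intro sum.cong refl) (auto simp: add.commute)
  also have "\<dots> = (\<Sum>z<n. of_bool (y = z) * of_bool (x = z) * (of_nat n * of_bool (a = b)))"
    by (rule sum_shift_mod[of "\<lambda>z. of_bool (y = z) * of_bool (x = z) * (of_nat n * of_bool (a = b))"])
  also have "\<dots> = (\<Sum>z<n. if z = x then of_bool (x = y) * (of_nat n * of_bool (a = b)) else 0)"
    by (intro sum.cong refl) auto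
  finally show ?thesis using assms(3) by auto
qed

text \<open>The ensemble consists of the Weyl rotations of \<open>C\<close>, measured in the corresponding maximally
  entangled basis: every outcome then reproduces \<open>C / n\<close>, while a measurement on the ensemble,
  rotated back and summed, is \<open>n\<close> times the Choi kernel of a channel.\<close>

lemma weyl_ensemble:
  assumes n: "0 < n" and C: "pos_kernel (grid r n) C" and trC: "(\<Sum>p\<in>grid r n. C p p) = 1"
  shows "\<exists>lam rho M. ensemble (r * n) (n * n) lam rho \<and> measurement (n * n) (n * n) M \<and>
    (\<forall>p\<in>grid r n. \<forall>q\<in>grid r n. ensemble_kernel n (n * n) lam rho M p q = of_real (1 / n) * C p q) \<and>
    psucc_opt (r * n) (n * n) lam rho \<le> cond_val r n C / n"
proof -
  let ?I = "grid r n"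
  define W where "W i p q = (\<Sum>a<n. \<Sum>b<n. weyl n i (snd p) a * cnj (weyl n i (snd q) b) * C (fst p, a) (fst q, b))"
    for i and p q :: "nat \<times> nat"
  define rho where "rho i = mat_of_bip_kernel r n (W i)" for i
  \<comment> \<open>The projection onto the maximally entangled vector of the \<open>i\<close>-th
    Weyl operator; \<open>1 / n\<close> normalises it, as a unitary has squared Hilbert-Schmidt norm
    \<open>n\<close>.\<close>
  define K where "K i p q = of_real (1 / n) * (weyl n i (snd p) (fst p) * cnj (weyl n i (snd q) (fst q)))"
    for i and p q :: "nat \<times> nat"
  define M where "M i = mat_of_bip_kernel n n (K i)" for i
  define lam :: "nat \<Rightarrow> real" where "lam i = 1 / (n * n)" for i
  have posW: "pos_kernel ?I (W i)" for i
  proof -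
    have "pos_kernel ?I (\<lambda>p q. \<Sum>x\<in>?I. \<Sum>y\<in>?I. (of_bool (fst x = fst p) * weyl n i (snd p) (snd x)) * C x y *
        cnj (of_bool (fst y = fst q) * weyl n i (snd q) (snd y)))"
      by (rule pos_kernel_congruence[OF _ C]) simp
    then show ?thesis
    proof (rule pos_kernel_cong)
      fix p q assume pq: "p \<in> ?I" "q \<in> ?I"
      have "(\<Sum>x\<in>?I. \<Sum>y\<in>?I. (of_bool (fst x = fst p) * weyl n i (snd p) (snd x)) * C x y *
          cnj (of_bool (fst y = fst q) * weyl n i (snd q) (snd y))) =
        (\<Sum>s<r. \<Sum>a<n. \<Sum>t<r. \<Sum>b<n. if t = fst q then if s = fst p then
            weyl n i (snd p) a * cnj (weyl n i (snd q) b) * C (fst p, a) (fst q, b) else 0 else 0)"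
        unfolding sum.cartesian_product' by (intro sum.cong refl) auto
      also have "\<dots> = (\<Sum>s<r. \<Sum>a<n. \<Sum>b<n. \<Sum>t<r. if t = fst q then if s = fst p then
            weyl n i (snd p) a * cnj (weyl n i (snd q) b) * C (fst p, a) (fst q, b) else 0 else 0)"
        by (rule sum.cong[OF refl], rule sum.cong[OF refl], rule sum.swap)
      also have "\<dots> = (\<Sum>s<r. \<Sum>a<n. \<Sum>b<n. if s = fst p then
            weyl n i (snd p) a * cnj (weyl n i (snd q) b) * C (fst p, a) (fst q, b) else 0)"
        using pq by auto
      also have "\<dots> = (\<Sum>a<n. \<Sum>b<n. \<Sum>s<r. if s = fst p then
            weyl n i (snd p) a * cnj (weyl n i (snd q) b) * C (fst p, a) (fst q, b) else 0)"
        by (rule sum_swap3[symmetric])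
      also have "\<dots> = W i p q" using pq by (auto simp: W_def)
      finally show "W i p q = (\<Sum>x\<in>?I. \<Sum>y\<in>?I. (of_bool (fst x = fst p) * weyl n i (snd p) (snd x)) * C x y *
          cnj (of_bool (fst y = fst q) * weyl n i (snd q) (snd y)))" ..
    qed
  qed
  have trW: "(\<Sum>p\<in>?I. W i p p) = 1" for i
  proof -
    have "(\<Sum>p\<in>?I. W i p p) = (\<Sum>s<r. \<Sum>x<n. \<Sum>a<n. \<Sum>b<n. weyl n i x a * cnj (weyl n i x b) * C (s, a) (s, b))"
      unfolding W_def sum.cartesian_product' by simp
    also have "\<dots> = (\<Sum>s<r. \<Sum>a<n. \<Sum>b<n. \<Sum>x<n. weyl n i x a * cnj (weyl n i x b) * C (s, a) (s, b))"
      by (intro sum.cong refl sum_swap3[symmetric])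
    also have "\<dots> = (\<Sum>s<r. \<Sum>a<n. \<Sum>b<n. if b = a then C (s, a) (s, a) else 0)"
      unfolding sum_distrib_right[symmetric] by (intro sum.cong refl) (auto simp: weyl_columns)
    also have "\<dots> = (\<Sum>p\<in>?I. C p p)" unfolding sum.cartesian_product' by simp
    finally show ?thesis using trC by simp
  qed
  have "ensemble (r * n) (n * n) lam rho"
    unfolding ensemble_def state_def rho_def lam_def
    using n psd_mat_of_bip_kernel[OF posW] trW by (simp add: mtrace_mat_of_bip_kernel)
  moreover have "measurement (n * n) (n * n) M"
    unfolding measurement_def
  proof (intro conjI allI impI)
    show "psd (n * n) (M i)" for i
      unfolding M_def K_def
      by (intro psd_mat_of_bip_kernel pos_kernel_scale pos_kernel_rank1[where u = "\<lambda>p. weyl n i (snd p) (fst p)"]) simp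
    fix a b assume ab: "a < n * n" "b < n * n"
    note dm = div_mod_less[OF ab(1)] div_mod_less[OF ab(2)]
    have "(\<Sum>i<n * n. M i $$ (a, b)) = of_real (1 / n) * (\<Sum>i<n * n. weyl n i (a mod n) (a div n) * cnj (weyl n i (b mod n) (b div n)))"
      using ab by (simp add: M_def mat_of_bip_kernel_def K_def sum_distrib_left)
    also have "\<dots> = of_bool ((a div n, a mod n) = (b div n, b mod n))"
      unfolding weyl_complete[OF dm(3,1,4)] using n by simp
    also have "\<dots> = 1\<^sub>m (n * n) $$ (a, b)"
      using ab by (auto simp: of_bool_def) (metis div_mult_mod_eq)
    finally show "(\<Sum>i<n * n. M i $$ (a, b)) = 1\<^sub>m (n * n) $$ (a, b)" .
  qed
  moreover have ens: "ensemble_kernel n (n * n) lam rho M p q = of_real (1 / n) * C p q" if pq: "p \<in> ?I" "q \<in> ?I" for p q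
  proof -
    obtain s a t b where pq': "p = (s, a)" "q = (t, b)" "s < r" "t < r" "a < n" "b < n" using pq by auto
    \<comment> \<open>Unitarity lets the rotation of the state cancel the rotation of the measured
      vector, so the result does not depend on \<open>i\<close>.\<close>
    have one: "ens_kernel n (rho i) (M i) p q = of_real (1 / n) * C p q" for i
    proof -
      have "ens_kernel n (rho i) (M i) p q = (\<Sum>x<n. \<Sum>y<n. W i (s, x) (t, y) * K i (b, y) (a, x))"
        unfolding ens_kernel_def rho_def M_def using pq' by (intro sum.cong refl) (simp add: bip_kernel_mat_of_bip_kernel)
      also have "\<dots> = (\<Sum>x<n. \<Sum>y<n. \<Sum>a'<n. \<Sum>b'<n. (of_real (1 / n) * C (s, a') (t, b')) *
          ((weyl n i x a' * cnj (weyl n i x a)) * (weyl n i y b * cnj (weyl n i y b'))))"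
        unfolding W_def K_def by (simp add: sum_distrib_right sum_distrib_left mult_ac)
      also have "\<dots> = (\<Sum>a'<n. \<Sum>b'<n. \<Sum>x<n. \<Sum>y<n. (of_real (1 / n) * C (s, a') (t, b')) *
          ((weyl n i x a' * cnj (weyl n i x a)) * (weyl n i y b * cnj (weyl n i y b'))))"
        by (rule sum_swap4)
      also have "\<dots> = (\<Sum>a'<n. \<Sum>b'<n. (of_real (1 / n) * C (s, a') (t, b')) *
          ((\<Sum>x<n. weyl n i x a' * cnj (weyl n i x a)) * (\<Sum>y<n. weyl n i y b * cnj (weyl n i y b'))))"
        unfolding sum_product unfolding sum_distrib_left ..
      also have "\<dots> = (\<Sum>a'<n. \<Sum>b'<n. if b' = b then if a' = a then of_real (1 / n) * C p q else 0 else 0)"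
        using pq' by (intro sum.cong refl) (auto simp: weyl_columns)
      finally show ?thesis using pq' by simp
    qed
    show ?thesis unfolding ensemble_kernel_def one lam_def using n by simp
  qed
  moreover have "psucc_opt (r * n) (n * n) lam rho \<le> cond_val r n C / n"
    unfolding psucc_opt_def
  proof (rule cSup_least)
    \<comment> \<open>A witness that the supremum runs over a nonempty set: all weight lies on
      outcome 0, which exists because \<open>n\<close> is positive.\<close>
    have "measurement (r * n) (n * n) (\<lambda>i. if i = 0 then 1\<^sub>m (r * n) else 0\<^sub>m (r * n) (r * n))"
      unfolding measurement_def
    proof (intro conjI allI impI)
      have "psd d (1\<^sub>m d)" for d unfolding psd_iff_pos_kernel
        by (intro conjI one_carrier_mat, rule pos_kernel_cong[OF pos_kernel_delta]) auto
      moreover have "psd d (0\<^sub>m d d)" for d unfolding psd_iff_pos_kernel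
        by (auto intro: pos_kernel_cong[OF pos_kernel_zero])
      ultimately show "psd (r * n) (if i = 0 then 1\<^sub>m (r * n) else 0\<^sub>m (r * n) (r * n))" for i :: nat by simp
      fix a b assume "a < r * n" "b < r * n"
      then have "(\<Sum>i<n * n. (if i = 0 then 1\<^sub>m (r * n) else 0\<^sub>m (r * n) (r * n)) $$ (a, b)) =
          (\<Sum>i<n * n. if i = 0 then 1\<^sub>m (r * n) $$ (a, b) else (0 :: complex))"
        by (intro sum.cong refl) simp
      then show "(\<Sum>i<n * n. (if i = 0 then 1\<^sub>m (r * n) else 0\<^sub>m (r * n) (r * n)) $$ (a, b)) = (1\<^sub>m (r * n) $$ (a, b) :: complex)"
        using n by simp
    qed
    then show "{psucc (n * n) lam rho M |M. measurement (r * n) (n * n) M} \<noteq> {}" by blast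
  next
    fix z assume "z \<in> {psucc (n * n) lam rho M |M. measurement (r * n) (n * n) M}"
    then obtain N where N: "measurement (r * n) (n * n) N" "z = psucc (n * n) lam rho N" by blast
    have Npos: "N i \<in> carrier_mat (r * n) (r * n)" "pos_kernel ?I (\<lambda>p q. bip_kernel n (N i) q p)" if "i < n * n" for i
    proof -
      have "psd (r * n) (N i)" using N(1) that by (simp add: measurement_def)
      then show "N i \<in> carrier_mat (r * n) (r * n)" by (simp add: psd_def)
      show "pos_kernel ?I (\<lambda>p q. bip_kernel n (N i) q p)"
        by (rule pos_kernel_transpose[OF _ psd_bip_kernel[OF \<open>psd (r * n) (N i)\<close>]]) simp
    qed
    define V where "V i p q = (\<Sum>x<n. \<Sum>y<n. weyl n i x (snd p) * bip_kernel n (N i) (fst q, y) (fst p, x) * cnj (weyl n i y (snd q)))"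
      for i and p q :: "nat \<times> nat"
    \<comment> \<open>Rotation does not change partial traces. Those of the transposed
      \<open>N i\<close> add up to \<open>n\<close> times the identity, because the
      \<open>N i\<close> resolve the identity on both factors; hence the prefactor
      \<open>1 / n\<close>.\<close>
    define c where "c p q = (\<Sum>i<n * n. of_real (1 / n) * V i p q)" for p q
    have posV: "pos_kernel ?I (V i)" if i: "i < n * n" for i
    proof -
      have 1: "pos_kernel (grid n r) (\<lambda>p q. bip_kernel n (N i) (snd q, fst q) (snd p, fst p))"
        by (rule pos_kernel_pullback[OF _ Npos(2)[OF i], where f = "\<lambda>p. (snd p, fst p)"]) auto
      have 2: "pos_kernel (grid n n) (\<lambda>p q. weyl n i (fst p) (snd p) * cnj (weyl n i (fst q) (snd q)))"
        by (rule pos_kernel_rank1[of _ "\<lambda>p. weyl n i (fst p) (snd p)"])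
      show ?thesis
        by (rule pos_kernel_cong[OF pos_kernel_contract[OF _ _ _ 2 1]]) (auto simp: V_def mult_ac)
    qed
    have c: "chan_kernel r n c"
      unfolding chan_kernel_def
    proof (intro conjI allI impI)
      show "pos_kernel ?I c" unfolding c_def using posV by (intro pos_kernel_sum pos_kernel_scale) auto
      fix s t assume st: "s < r" "t < r"
      have Vtr: "(\<Sum>a<n. V i (s, a) (t, a)) = (\<Sum>x<n. bip_kernel n (N i) (t, x) (s, x))" for i
      proof -
        have "(\<Sum>a<n. V i (s, a) (t, a)) = (\<Sum>x<n. \<Sum>y<n. \<Sum>a<n. (weyl n i x a * cnj (weyl n i y a)) * bip_kernel n (N i) (t, y) (s, x))"
          unfolding V_def fst_conv snd_conv by (subst sum_swap3) (simp add: mult_ac)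
        also have "\<dots> = (\<Sum>x<n. \<Sum>y<n. if y = x then bip_kernel n (N i) (t, x) (s, x) else 0)"
          unfolding sum_distrib_right[symmetric] by (intro sum.cong refl) (auto simp: weyl_rows)
        finally show ?thesis by simp
      qed
      have "(\<Sum>a<n. c (s, a) (t, a)) = of_real (1 / n) * (\<Sum>i<n * n. \<Sum>a<n. V i (s, a) (t, a))"
        unfolding c_def sum_distrib_left by (rule sum.swap)
      also have "(\<Sum>i<n * n. \<Sum>a<n. V i (s, a) (t, a)) = (\<Sum>x<n. \<Sum>i<n * n. bip_kernel n (N i) (t, x) (s, x))"
        unfolding Vtr by (rule sum.swap)
      also have "\<dots> = of_nat n * of_bool (s = t)"
        using st by (simp add: measurement_bip_kernel[OF N(1)])
      finally show "(\<Sum>a<n. c (s, a) (t, a)) = of_bool (s = t)" using n by simp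
    qed
    have tr: "mtrace (rho i * N i) = kernel_pair ?I C (V i)" if i: "i < n * n" for i
    proof -
      have car: "rho i \<in> carrier_mat (r * n) (r * n)" by (simp add: rho_def)
      have "mtrace (rho i * N i) = kernel_pair ?I (W i) (\<lambda>p q. bip_kernel n (N i) q p)"
        unfolding mtrace_mult_bip_kernel[OF car Npos(1)[OF i]] by (rule kernel_pair_cong) (simp_all add: rho_def bip_kernel_mat_of_bip_kernel)
      also have "\<dots> = (\<Sum>s<r. \<Sum>t<r. \<Sum>x<n. \<Sum>y<n. \<Sum>a<n. \<Sum>b<n.
          C (s, a) (t, b) * (weyl n i x a * bip_kernel n (N i) (t, y) (s, x) * cnj (weyl n i y b)))"
        unfolding kernel_pair_prod W_def by (simp add: sum_distrib_right sum_distrib_left mult_ac)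
      also have "\<dots> = (\<Sum>s<r. \<Sum>t<r. \<Sum>a<n. \<Sum>b<n. \<Sum>x<n. \<Sum>y<n.
          C (s, a) (t, b) * (weyl n i x a * bip_kernel n (N i) (t, y) (s, x) * cnj (weyl n i y b)))"
        by (intro sum.cong refl sum_swap4)
      also have "\<dots> = kernel_pair ?I C (V i)"
        unfolding kernel_pair_prod V_def by (simp add: sum_distrib_left)
      finally show ?thesis .
    qed
    have "kernel_pair ?I C c = (\<Sum>i<n * n. of_real (1 / n) * kernel_pair ?I C (V i))"
    proof -
      have "kernel_pair ?I C c = (\<Sum>p\<in>?I. \<Sum>q\<in>?I. \<Sum>i<n * n. of_real (1 / n) * (C p q * V i p q))"
        unfolding kernel_pair_def c_def by (simp add: sum_distrib_left mult_ac)
      also have "\<dots> = (\<Sum>i<n * n. \<Sum>p\<in>?I. \<Sum>q\<in>?I. of_real (1 / n) * (C p q * V i p q))" by (rule sum_swap3)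
      finally show ?thesis unfolding kernel_pair_def sum_distrib_left .
    qed
    \<comment> \<open>The weights are \<open>1 / (n * n)\<close> and \<open>c\<close> already
      carries \<open>1 / n\<close>, which leaves a factor \<open>1 / n\<close>.\<close>
    then have "Re (kernel_pair ?I C c) / n = z"
      unfolding N(2) psucc_def lam_def by (simp add: tr sum_divide_distrib)
    then show "z \<le> cond_val r n C / n"
      using cond_val_upper[OF c, of C] n by (metis divide_right_mono of_nat_0_le_iff)
  qed
  ultimately show ?thesis by blast
qed

text \<open>The ensemble of \<open>weyl_ensemble\<close> scales the values for \<Phi>1 and \<Phi>2
  by exactly \<open>1 / n\<close>, and its success probability is at most \<open>1 / n\<close> times
  the conditional norm; cancelling \<open>n\<close> leaves the required inequality.\<close>

lemma delta_pre_of_cond_iii: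
  assumes ch: "channel m1 n \<Phi>1" "channel m n \<Phi>2" and pos: "0 < m1" "0 < m" "0 < n" and \<epsilon>: "0 \<le> \<epsilon>"
    and iii: "cond_iii m1 m n \<Phi>1 \<Phi>2 \<epsilon> m"
  shows "delta_pre m1 m n \<Phi>1 \<Phi>2 \<le> \<epsilon>"
proof (rule delta_pre_le_of_key[OF ch pos \<epsilon>])
  let ?I = "grid m n"
  fix C assume C: "pos_kernel ?I C" "(\<Sum>p\<in>?I. C p p) = 1"
  obtain lam rho M where e: "ensemble (m * n) (n * n) lam rho" "measurement (n * n) (n * n) M"
    and ek: "\<forall>p\<in>?I. \<forall>q\<in>?I. ensemble_kernel n (n * n) lam rho M p q = of_real (1 / n) * C p q"
    and opt: "psucc_opt (m * n) (n * n) lam rho \<le> cond_val m n C / n"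
    using weyl_ensemble[OF pos(3) C] by blast
  define E where "E = ensemble_kernel n (n * n) lam rho M"
  have kE: "Re (kernel_pair ?I E J) = Re (kernel_pair ?I C J) / n" for J
  proof -
    have "kernel_pair ?I E J = kernel_pair ?I (\<lambda>p q. of_real (1 / n) * C p q) J"
      unfolding E_def using ek by (intro kernel_pair_cong) auto
    then show ?thesis unfolding kernel_pair_scale_left by simp
  qed
  have "Re (kernel_pair ?I C (choi_kernel m \<Phi>2)) / n \<le> pre_val m m n (choi_kernel m \<Phi>2) E"
    using pre_val_id_upper[OF channel_chan_kernel[OF ch(2)], of E] kE by simp
  also have "\<dots> \<le> pre_val m m1 n (choi_kernel m1 \<Phi>1) E + \<epsilon> / 2 * psucc_opt (m * n) (n * n) lam rho"
    using iii[unfolded cond_iii_def, rule_format, OF e]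
    unfolding E_def psucc_pre_val[OF ch(1) e] psucc_pre_val[OF ch(2) e] .
  also have "pre_val m m1 n (choi_kernel m1 \<Phi>1) E \<le> pre_val m m1 n (choi_kernel m1 \<Phi>1) C / n"
  proof (rule pre_val_least[OF pos(1)])
    fix c assume "chan_kernel m m1 c"
    then show "Re (kernel_pair ?I E (kernel_comp m1 c (choi_kernel m1 \<Phi>1))) \<le> pre_val m m1 n (choi_kernel m1 \<Phi>1) C / n"
      unfolding kE using pre_val_upper[OF _ channel_chan_kernel[OF ch(1)], of m c C]
      by (intro divide_right_mono) auto
  qed
  also have "\<epsilon> / 2 * psucc_opt (m * n) (n * n) lam rho \<le> \<epsilon> / 2 * (cond_val m n C / n)"
    using opt \<epsilon> by (intro mult_left_mono) auto
  finally have "Re (kernel_pair ?I C (choi_kernel m \<Phi>2)) / n \<le> (pre_val m m1 n (choi_kernel m1 \<Phi>1) C + \<epsilon> / 2 * cond_val m n C) / n"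
    by (simp add: add_divide_distrib)
  then show "Re (kernel_pair ?I C (choi_kernel m \<Phi>2)) \<le> pre_val m m1 n (choi_kernel m1 \<Phi>1) C + \<epsilon> / 2 * cond_val m n C"
    using pos(3) by (simp add: divide_le_cancel)
qed

theorem theorem6:
  fixes dA0 dA0' dA1 :: nat and \<Phi>1 \<Phi>2 :: cmap and \<epsilon> :: real
  assumes "0 < dA0" and "0 < dA0'" and "0 < dA1"
    and "channel dA0 dA1 \<Phi>1" and "channel dA0' dA1 \<Phi>2"
    and "0 \<le> \<epsilon>"
  shows "(delta_pre dA0 dA0' dA1 \<Phi>1 \<Phi>2 \<le> \<epsilon> \<longleftrightarrow>
            (\<forall>dR>0. cond_ii dA0 dA0' dA1 \<Phi>1 \<Phi>2 \<epsilon> dR))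
       \<and> (delta_pre dA0 dA0' dA1 \<Phi>1 \<Phi>2 \<le> \<epsilon> \<longleftrightarrow>
            (\<forall>dR>0. cond_iii dA0 dA0' dA1 \<Phi>1 \<Phi>2 \<epsilon> dR))
       \<and> (delta_pre dA0 dA0' dA1 \<Phi>1 \<Phi>2 \<le> \<epsilon> \<longleftrightarrow>
            cond_ii dA0 dA0' dA1 \<Phi>1 \<Phi>2 \<epsilon> dA0')
       \<and> (delta_pre dA0 dA0' dA1 \<Phi>1 \<Phi>2 \<le> \<epsilon> \<longleftrightarrow>
            cond_iii dA0 dA0' dA1 \<Phi>1 \<Phi>2 \<epsilon> dA0')"
proof -
  have "cond_ii dA0 dA0' dA1 \<Phi>1 \<Phi>2 \<epsilon> dR" "cond_iii dA0 dA0' dA1 \<Phi>1 \<Phi>2 \<epsilon> dR"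
    if "delta_pre dA0 dA0' dA1 \<Phi>1 \<Phi>2 \<le> \<epsilon>" "0 < dR" for dR
    using cond_ii_of_delta_pre[OF assms(4,5) that(2) assms(1-3) that(1)]
      cond_iii_of_delta_pre[OF assms(4,5) that(2) assms(1-3) that(1) assms(6)] by auto
  then show ?thesis
    using delta_pre_of_cond_ii[OF assms(4,5,1-3,6)] delta_pre_of_cond_iii[OF assms(4,5,1-3,6)] assms(2)
    by blast
qed

end
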